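(* Let $k$ be an algebraically closed field and let $f_1,\dots,f_m \in k[x_1,\dots,x_n]$ be polynomials of total degrees $d_1 \ge d_2 \ge \cdots \ge d_m$ respectively, having no common zero in $k^n$. Suppose the transcendence degree of $\{f_1,\dots,f_m\}$ equals $r$. Then there exist polynomials $h_1,\dots,h_m \in k[x_1,\dots,x_n]$ with $\deg(f_i h_i) \le \prod_{j=1}^{r+1} d_j$ for every $i$, satisfying $\sum_{i=1}^m f_i h_i = 1$.
   Context: The transcendence degree of a set of polynomials is the size of any maximal algebraically independent (over $k$) subset of it.
   Formalization: The product of d_1,…,d_{r+1} is taken only over indices j ≤ m with f_j nonzero, since d_{m+1} does not exist when r = m (e.g. x, 1+xy) and a zero polynomial has no usable degree; all other cases are as stated. *)

theory Defs
  imports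
    "HOL-Library.Poly_Mapping"
    "HOL-Library.FuncSet"
    "HOL-Computational_Algebra.Polynomial"
begin

(* Multivariate polynomials are finitely supported maps from monomials (themselves finitely
   supported exponent maps) to coefficients; Poly_Mapping supplies the commutative ring. *)
type_synonym ('v, 'k) mpolynomial = "('v \<Rightarrow>\<^sub>0 nat) \<Rightarrow>\<^sub>0 'k"

definition mp_vars :: "('v, 'k::zero) mpolynomial \<Rightarrow> 'v set" where
  "mp_vars p = (\<Union>m\<in>Poly_Mapping.keys p. Poly_Mapping.keys m)"

(* k[x_1,...,x_n]; the coefficient field is the whole type *)
definition polys_upto :: "nat \<Rightarrow> (nat, 'k::zero) mpolynomial set" where
  "polys_upto n = {p. mp_vars p \<subseteq> {1..n}}"

(* k^n *)
definition affine_points :: "nat \<Rightarrow> (nat \<Rightarrow> 'k) set" where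
  "affine_points n = ({1..n} \<rightarrow>\<^sub>E UNIV)"

definition mp_const :: "'k::zero \<Rightarrow> ('v, 'k) mpolynomial" where
  "mp_const c = Poly_Mapping.single 0 c"

(* Substitute x v for each variable v, mapping coefficients along c. *)
definition mp_subst ::
  "('k::zero \<Rightarrow> 'r::comm_semiring_1) \<Rightarrow> ('v \<Rightarrow> 'r) \<Rightarrow> ('v, 'k) mpolynomial \<Rightarrow> 'r" where
  "mp_subst c x p =
     (\<Sum>m\<in>Poly_Mapping.keys p.
        c (Poly_Mapping.lookup p m) * (\<Prod>v\<in>Poly_Mapping.keys m. x v ^ Poly_Mapping.lookup m v))"

definition mp_eval :: "(nat \<Rightarrow> 'k) \<Rightarrow> (nat, 'k::comm_semiring_1) mpolynomial \<Rightarrow> 'k" where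
  "mp_eval a p = mp_subst (\<lambda>c. c) a p"

definition monom_degree :: "('v \<Rightarrow>\<^sub>0 nat) \<Rightarrow> nat" where
  "monom_degree m = (\<Sum>v\<in>Poly_Mapping.keys m. Poly_Mapping.lookup m v)"

(* Convention: the zero polynomial has total degree 0. *)
definition total_degree :: "('v, 'k::zero) mpolynomial \<Rightarrow> nat" where
  "total_degree p = Max (insert 0 (monom_degree ` Poly_Mapping.keys p))"

(* The elements of S themselves serve as the names of the variables of a relation P, and the
   variable named g is replaced by the polynomial g. *)
definition alg_independent :: "('v, 'k::field) mpolynomial set \<Rightarrow> bool" where
  "alg_independent S \<longleftrightarrow>
     (\<forall>P :: (('v, 'k) mpolynomial, 'k) mpolynomial.
        mp_vars P \<subseteq> S \<longrightarrow> mp_subst mp_const (\<lambda>g. g) P = 0 \<longrightarrow> P = 0)"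

definition max_alg_independent_subset ::
  "('v, 'k::field) mpolynomial set \<Rightarrow> ('v, 'k) mpolynomial set \<Rightarrow> bool" where
  "max_alg_independent_subset S B \<longleftrightarrow>
     B \<subseteq> S \<and> alg_independent B \<and> (\<forall>C. B \<subseteq> C \<and> C \<subseteq> S \<and> alg_independent C \<longrightarrow> C = B)"

(* All maximal algebraically independent subsets have the same size, so the choice is immaterial. *)
definition trdeg :: "('v, 'k::field) mpolynomial set \<Rightarrow> nat" where
  "trdeg S = card (SOME B. max_alg_independent_subset S B)"

end

(* Write r for the transcendence degree. While more than min(r, n) + 1 polynomials are left, they
   satisfy a homogeneous relation, by growth of the span of their products, and a generic triangular
   change makes it monic in the last one, which is thus redundant for the zero set. For the remaining
   g_1, ..., g_m we follow Jelonek's proof: since 1 is a combination of the g_i, Noether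
   normalization applied to z g_1, ..., z g_m, x_1, ..., x_n gives n + 1 algebraically independent
   Psi_i = z g_i + l_i(x) (put g_i = 0 for i > m) with l_i linear, over which z is integral. The
   minimal equation P(Psi, z) = 0 of z is monic, and it generates all relations. Comparing the number
   of monomials in Psi of weight at most e (Psi_i has weight deg g_i, or 1 if i > m) avoiding the
   leading monomial of P with the number of monomials in x of degree at most e bounds the weight of P
   by the product of the degrees. The coefficient of the top power of z in P(Psi, z) = 0 then
   expresses 1 as the desired combination of the g_i. *)

theory Submission
  imports Defs "Jordan_Normal_Form.Char_Poly" "HOL-Algebra.Algebraic_Closure_Type"
    "HOL-Library.Product_Lexorder"
begin

text \<open>Transcendence degree enters only through growth, so every dependence statement is a
  pigeonhole: more monomials than dimensions yield a relation with prescribed monomials. Homogeneous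
  ones cost one more generator, and homogeneity is what makes a common zero of the reduced family a
  zero of all. The product of the degrees is a ratio of leading terms. About e^(n+1) / ((n+1)!
  w_1...w_(n+1)) monomials have weight at most e, where w_i is the weight of the i-th variable.
  Those not divisible by a fixed monomial of weight W number about W e^n / (n! w_1...w_(n+1)). Up to
  e^n / n! of them fit into the polynomials in x of degree at most e, so W is at most w_1...w_(n+1).
  Powers of z do not disturb this, since their range can be taken as long as desired. The obstacle
  is monicity: the coefficient 1 of the top power of z is what becomes the 1 of the final identity,
  so a relation of least degree must be made monic with coefficients in k[Psi], not just in its
  fraction field. It divides a multiple of a monic equation, and this is turned into monicity by a
  form of Gauss's lemma.\<close>

hide_const (open) Polynomials.degree Polynomials.lead_coeff up_ring.coeff up_ring.monom
  Coset.order module.smult Divisibility.prime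

alias keys = Poly_Mapping.keys
alias lookup = Poly_Mapping.lookup
alias single = Poly_Mapping.single

section \<open>Monomials, weighted degrees and subrings\<close>

type_synonym 'k mp = "(nat, 'k) mpolynomial"

definition mvar :: "'v \<Rightarrow> ('v, 'k::zero_neq_one) mpolynomial" where
  "mvar v = single (single v 1) 1"

definition monom_eval :: "('v \<Rightarrow> 'r::comm_monoid_mult) \<Rightarrow> ('v \<Rightarrow>\<^sub>0 nat) \<Rightarrow> 'r" where
  "monom_eval y m = (\<Prod>v\<in>keys m. y v ^ lookup m v)"

definition wdeg :: "('v \<Rightarrow> nat) \<Rightarrow> ('v \<Rightarrow>\<^sub>0 nat) \<Rightarrow> nat" where
  "wdeg w m = (\<Sum>v\<in>keys m. w v * lookup m v)"

text \<open>A bound instead of a degree: cancellation in sums and the zero polynomial then require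
  no special cases. Constant weight 1 gives the total degree.\<close>

definition wdeg_le :: "('v \<Rightarrow> nat) \<Rightarrow> nat \<Rightarrow> ('v, 'k::zero) mpolynomial \<Rightarrow> bool" where
  "wdeg_le w e p \<longleftrightarrow> (\<forall>m\<in>keys p. wdeg w m \<le> e)"

text \<open>The variable type is arbitrary because relations name their variables by indices of
  generators or, for \<open>trdeg\<close>, by the polynomials themselves.\<close>

definition polysV :: "'v set \<Rightarrow> ('v, 'k::zero) mpolynomial set" where
  "polysV S = {p. mp_vars p \<subseteq> S}"

text \<open>Subrings are sets inside one ambient type, since polynomials in fewer variables, the
  algebra generated by the \<open>\<Psi> i\<close>, and its integral extensions all have to be
  compared there.\<close>

definition is_subring :: "'r::comm_ring_1 set \<Rightarrow> bool" where
  "is_subring S \<longleftrightarrow> 1 \<in> S \<and> (\<forall>a\<in>S. \<forall>b\<in>S. a - b \<in> S \<and> a * b \<in> S)"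

lemma poly_mapping_decomp: "p = (\<Sum>m\<in>keys p. single m (lookup p m))"
proof (rule poly_mapping_eqI)
  fix k
  show "lookup p k = lookup (\<Sum>m\<in>keys p. single m (lookup p m)) k"
    by (auto simp: lookup_sum lookup_single when_def in_keys_iff)
qed

lemma monom_eval_superset:
  assumes "finite V" "keys m \<subseteq> V"
  shows "monom_eval y m = (\<Prod>v\<in>V. y v ^ lookup m v)"
  unfolding monom_eval_def using assms by (intro prod.mono_neutral_left) (auto simp: in_keys_iff)

lemma wdeg_superset:
  assumes "finite V" "keys m \<subseteq> V"
  shows "wdeg w m = (\<Sum>v\<in>V. w v * lookup m v)"
  unfolding wdeg_def using assms by (intro sum.mono_neutral_left) (auto simp: in_keys_iff)

lemma keys_add_nat: "keys (a + b :: 'v \<Rightarrow>\<^sub>0 nat) = keys a \<union> keys b"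
  by (auto simp: in_keys_iff lookup_add)

lemma monom_eval_add: "monom_eval y (a + b) = monom_eval y a * monom_eval y b"
proof -
  let ?V = "keys a \<union> keys b"
  have "monom_eval y (a + b) = (\<Prod>v\<in>?V. y v ^ lookup (a + b) v)"
    by (rule monom_eval_superset) (auto simp: keys_add_nat)
  also have "\<dots> = (\<Prod>v\<in>?V. y v ^ lookup a v) * (\<Prod>v\<in>?V. y v ^ lookup b v)"
    by (simp add: lookup_add power_add prod.distrib)
  also have "\<dots> = monom_eval y a * monom_eval y b"
    by (simp add: monom_eval_superset[of ?V a] monom_eval_superset[of ?V b])
  finally show ?thesis .
qed

lemma wdeg_add: "wdeg w (a + b) = wdeg w a + wdeg w b"
proof -
  let ?V = "keys a \<union> keys b"
  have "wdeg w (a + b) = (\<Sum>v\<in>?V. w v * lookup (a + b) v)"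
    by (rule wdeg_superset) (auto simp: keys_add_nat)
  also have "\<dots> = (\<Sum>v\<in>?V. w v * lookup a v) + (\<Sum>v\<in>?V. w v * lookup b v)"
    by (simp add: lookup_add algebra_simps sum.distrib)
  also have "\<dots> = wdeg w a + wdeg w b"
    by (simp add: wdeg_superset[of ?V a] wdeg_superset[of ?V b])
  finally show ?thesis .
qed

lemma monom_eval_0 [simp]: "monom_eval y 0 = 1" and wdeg_0 [simp]: "wdeg w 0 = 0"
  by (simp_all add: monom_eval_def wdeg_def)

lemma monom_eval_single [simp]: "monom_eval y (single v k) = y v ^ k"
  by (cases "k = 0") (simp_all add: monom_eval_def)

lemma wdeg_single [simp]: "wdeg w (single v k) = w v * k"
  by (cases "k = 0") (simp_all add: wdeg_def)

lemma monom_degree_wdeg: "monom_degree m = wdeg (\<lambda>_. 1) m"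
  by (simp add: monom_degree_def wdeg_def)

lemma monom_eval_cong: "(\<And>v. v \<in> keys m \<Longrightarrow> y v = y' v) \<Longrightarrow> monom_eval y m = monom_eval y' m"
  unfolding monom_eval_def by (intro prod.cong) auto

lemma total_degree_le_iff: "total_degree p \<le> e \<longleftrightarrow> wdeg_le (\<lambda>_. 1) e p"
  unfolding total_degree_def wdeg_le_def by (subst Max_le_iff) (auto simp: monom_degree_wdeg)

lemma wdeg_le_mono: "wdeg_le w e p \<Longrightarrow> e \<le> e' \<Longrightarrow> wdeg_le w e' p"
  unfolding wdeg_le_def by force

lemma wdeg_le_0 [simp]: "wdeg_le w e 0"
  by (simp add: wdeg_le_def)

lemma wdeg_le_add: "wdeg_le w e p \<Longrightarrow> wdeg_le w e q \<Longrightarrow> wdeg_le w e (p + q)"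
  unfolding wdeg_le_def using Poly_Mapping.keys_add[of p q] by blast

lemma wdeg_le_uminus: "wdeg_le w e p \<Longrightarrow> wdeg_le w e (- p)"
  for p :: "('v, 'k::comm_ring_1) mpolynomial"
  unfolding wdeg_le_def by (auto simp: in_keys_iff)

lemma wdeg_le_diff: "wdeg_le w e p \<Longrightarrow> wdeg_le w e q \<Longrightarrow> wdeg_le w e (p - q)"
  for p :: "('v, 'k::comm_ring_1) mpolynomial"
  using wdeg_le_add[of w e p "- q"] wdeg_le_uminus[of w e q] by simp

lemma wdeg_le_mult: "wdeg_le w e p \<Longrightarrow> wdeg_le w e' q \<Longrightarrow> wdeg_le w (e + e') (p * q)"
  unfolding wdeg_le_def using Poly_Mapping.keys_mult[of p q] by (fastforce simp: wdeg_add intro: add_mono)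

lemma wdeg_le_const [simp]: "wdeg_le w e (mp_const c)"
  by (simp add: wdeg_le_def mp_const_def)

lemma wdeg_le_1 [simp]: "wdeg_le w e 1"
  by (simp add: wdeg_le_def)

lemma wdeg_le_mvar: "w v \<le> e \<Longrightarrow> wdeg_le w e (mvar v)"
  by (auto simp: wdeg_le_def mvar_def)

lemma wdeg_le_sum: "(\<And>i. i \<in> A \<Longrightarrow> wdeg_le w e (f i)) \<Longrightarrow> wdeg_le w e (sum f A)"
  by (induction A rule: infinite_finite_induct) (auto intro: wdeg_le_add)

lemma is_subringD:
  assumes "is_subring S"
  shows "1 \<in> S" "0 \<in> S" "\<And>a b. a \<in> S \<Longrightarrow> b \<in> S \<Longrightarrow> a + b \<in> S"
    "\<And>a b. a \<in> S \<Longrightarrow> b \<in> S \<Longrightarrow> a - b \<in> S" "\<And>a b. a \<in> S \<Longrightarrow> b \<in> S \<Longrightarrow> a * b \<in> S"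
    "\<And>a. a \<in> S \<Longrightarrow> - a \<in> S"
proof -
  show one: "1 \<in> S" and diff: "\<And>a b. a \<in> S \<Longrightarrow> b \<in> S \<Longrightarrow> a - b \<in> S"
    and "\<And>a b. a \<in> S \<Longrightarrow> b \<in> S \<Longrightarrow> a * b \<in> S"
    using assms unfolding is_subring_def by auto
  show zero: "0 \<in> S" using diff[OF one one] by simp
  show neg: "- a \<in> S" if "a \<in> S" for a using diff[OF zero that] by simp
  show "a + b \<in> S" if "a \<in> S" "b \<in> S" for a b using diff[OF that(1) neg[OF that(2)]] by simp
qed

lemma is_subring_sum: "is_subring S \<Longrightarrow> (\<And>i. i \<in> A \<Longrightarrow> f i \<in> S) \<Longrightarrow> sum f A \<in> S"
  by (induction A rule: infinite_finite_induct) (auto dest: is_subringD)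

lemma is_subring_prod: "is_subring S \<Longrightarrow> (\<And>i. i \<in> A \<Longrightarrow> f i \<in> S) \<Longrightarrow> prod f A \<in> S"
  by (induction A rule: infinite_finite_induct) (auto dest: is_subringD)

lemma is_subring_power: "is_subring S \<Longrightarrow> a \<in> S \<Longrightarrow> a ^ n \<in> S"
  by (induction n) (auto dest: is_subringD)

lemma mp_vars_mult: "mp_vars (p * q) \<subseteq> mp_vars p \<union> mp_vars q"
  unfolding mp_vars_def using Poly_Mapping.keys_mult[of p q] by (fastforce simp: keys_add_nat)

lemma mp_vars_add: "mp_vars (p + q) \<subseteq> mp_vars p \<union> mp_vars q"
  unfolding mp_vars_def using Poly_Mapping.keys_add[of p q] by blast

lemma mp_vars_diff: "mp_vars (p - q) \<subseteq> mp_vars p \<union> mp_vars q"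
  for p :: "('v, 'k::comm_ring_1) mpolynomial"
proof -
  have "keys (- q) = keys q" by (auto simp: in_keys_iff)
  hence "mp_vars (- q) = mp_vars q" by (simp add: mp_vars_def)
  thus ?thesis using mp_vars_add[of p "- q"] by simp
qed

lemma mp_vars_const [simp]: "mp_vars (mp_const c) = {}"
  by (simp add: mp_vars_def mp_const_def)

lemma mp_const_1 [simp]: "mp_const 1 = 1"
  by (simp add: mp_const_def)

lemma mp_const_0 [simp]: "mp_const 0 = 0"
  by (simp add: mp_const_def)

lemma mp_vars_1 [simp]: "mp_vars 1 = {}"
  by (simp add: mp_vars_def)

lemma mp_vars_mvar [simp]: "mp_vars (mvar v :: ('v, 'k::zero_neq_one) mpolynomial) = {v}"
  by (simp add: mp_vars_def mvar_def)

lemma finite_mp_vars [simp]: "finite (mp_vars p)"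
  by (simp add: mp_vars_def)

lemma is_subring_polysV: "is_subring (polysV S :: ('v, 'k::comm_ring_1) mpolynomial set)"
proof -
  have "mp_vars (a - b) \<subseteq> S \<and> mp_vars (a * b) \<subseteq> S" if "mp_vars a \<subseteq> S" "mp_vars b \<subseteq> S"
    for a b :: "('v, 'k) mpolynomial"
    using mp_vars_diff[of a b] mp_vars_mult[of a b] that by blast
  thus ?thesis by (simp add: is_subring_def polysV_def)
qed

lemma polys_upto_polysV: "polys_upto n = polysV {1..n}"
  by (simp add: polys_upto_def polysV_def)

section \<open>Constants and substitution homomorphisms\<close>

lemma mp_const_hom: "comm_ring_hom (mp_const :: 'k::comm_ring_1 \<Rightarrow> ('v, 'k) mpolynomial)"
  by unfold_locales (auto simp: mp_const_def single_add mult_single)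

lemma mp_const_eq_0 [simp]: "mp_const c = 0 \<longleftrightarrow> c = 0"
  unfolding mp_const_def by (metis lookup_single_eq lookup_zero single_zero)

lemma mp_const_mult: "mp_const (a * b) = mp_const a * mp_const b"
  for a :: "'k::comm_ring_1"
  by (simp add: mp_const_def mult_single)

lemma wdeg_le_smult: "wdeg_le w e p \<Longrightarrow> wdeg_le w e (mp_const c * p)"
  using wdeg_le_mult[of w 0 "mp_const c" e p] by simp

lemma lookup_const_mult: "lookup (mp_const c * p) m = c * lookup p m"
  for p :: "('v, 'k::comm_ring_1) mpolynomial"
proof -
  have "mp_const c * p = Poly_Mapping.map ((*) c) p"
    unfolding mp_const_def by (rule mult_map_scale_conv_mult[symmetric])
  thus ?thesis by (simp add: Poly_Mapping.map.rep_eq when_def)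
qed

text \<open>An integral domain that is a k-algebra through \<open>\<kappa>\<close>. The same
  arguments serve k itself, k[x] (\<open>mp_const\<close>) and k[x][z]
  (\<open>pconst\<close>).\<close>

locale kalg = comm_ring_hom \<kappa> for \<kappa> :: "'k::field \<Rightarrow> 'r::idom"
begin

lemma subst_superset:
  assumes "finite A" "keys p \<subseteq> A"
  shows "mp_subst \<kappa> y p = (\<Sum>m\<in>A. \<kappa> (lookup p m) * monom_eval y m)"
  unfolding mp_subst_def monom_eval_def using assms
  by (intro sum.mono_neutral_left) (auto simp: in_keys_iff)

lemma subst_mon: "mp_subst \<kappa> y p = (\<Sum>m\<in>keys p. \<kappa> (lookup p m) * monom_eval y m)"
  by (simp add: mp_subst_def monom_eval_def)

lemma subst_single [simp]: "mp_subst \<kappa> y (single m c) = \<kappa> c * monom_eval y m"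
  by (cases "c = 0") (simp_all add: subst_mon)

lemma subst_0 [simp]: "mp_subst \<kappa> y 0 = 0"
  by (simp add: subst_mon)

lemma subst_add: "mp_subst \<kappa> y (p + q) = mp_subst \<kappa> y p + mp_subst \<kappa> y q"
proof -
  let ?A = "keys p \<union> keys q"
  have "mp_subst \<kappa> y (p + q) = (\<Sum>m\<in>?A. \<kappa> (lookup (p + q) m) * monom_eval y m)"
    using Poly_Mapping.keys_add[of p q] by (intro subst_superset) auto
  thus ?thesis
    by (simp add: subst_superset[of ?A] lookup_add hom_add algebra_simps sum.distrib)
qed

lemma subst_sum: "mp_subst \<kappa> y (sum f A) = (\<Sum>i\<in>A. mp_subst \<kappa> y (f i))"
  by (induction A rule: infinite_finite_induct) (auto simp: subst_add)

lemma subst_mult: "mp_subst \<kappa> y (p * q) = mp_subst \<kappa> y p * mp_subst \<kappa> y q"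
proof -
  let ?P = "keys p" and ?Q = "keys q"
  have "p * q = (\<Sum>m\<in>?P. single m (lookup p m)) *
                (\<Sum>m\<in>?Q. single m (lookup q m))"
    using poly_mapping_decomp[of p] poly_mapping_decomp[of q] by simp
  also have "\<dots> = (\<Sum>m\<in>?P. \<Sum>m'\<in>?Q. single (m + m') (lookup p m * lookup q m'))"
    by (simp add: sum_product mult_single)
  finally have "mp_subst \<kappa> y (p * q) = mp_subst \<kappa> y \<dots>" by simp
  also have "\<dots> = (\<Sum>m\<in>?P. \<Sum>m'\<in>?Q. (\<kappa> (lookup p m) * monom_eval y m) * (\<kappa> (lookup q m') * monom_eval y m'))"
    by (simp add: subst_sum monom_eval_add hom_mult ac_simps)
  also have "\<dots> = mp_subst \<kappa> y p * mp_subst \<kappa> y q"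
    by (simp add: subst_mon sum_product)
  finally show ?thesis .
qed

lemma subst_const [simp]: "mp_subst \<kappa> y (mp_const c) = \<kappa> c"
  by (simp add: mp_const_def)

lemma subst_1 [simp]: "mp_subst \<kappa> y 1 = 1"
  using subst_const[of y 1] by simp

lemma subst_mvar [simp]: "mp_subst \<kappa> y (mvar v) = y v"
  by (simp add: mvar_def)

lemma subst_hom: "comm_ring_hom (mp_subst \<kappa> y)"
  by unfold_locales (auto simp: subst_add subst_mult)

lemma subst_cong:
  assumes "\<And>v. v \<in> mp_vars p \<Longrightarrow> y v = y' v"
  shows "mp_subst \<kappa> y p = mp_subst \<kappa> y' p"
  unfolding subst_mon using assms
  by (intro sum.cong refl arg_cong2[of _ _ _ _ "(*)"] monom_eval_cong) (auto simp: mp_vars_def)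

lemma subst_in_subring:
  assumes "is_subring S" "\<And>c. \<kappa> c \<in> S" "\<And>v. v \<in> mp_vars p \<Longrightarrow> y v \<in> S"
  shows "mp_subst \<kappa> y p \<in> S"
  unfolding subst_mon monom_eval_def
  by (intro is_subring_sum is_subringD(5)[OF assms(1)] assms is_subring_prod is_subring_power)
    (auto simp: mp_vars_def assms)

lemma hom_subst:
  assumes "comm_ring_hom h"
  shows "h (mp_subst \<kappa> y p) = mp_subst (\<lambda>c. h (\<kappa> c)) (\<lambda>v. h (y v)) p"
proof -
  interpret h: comm_ring_hom h by fact
  show ?thesis unfolding mp_subst_def by (simp add: h.hom_sum h.hom_mult h.hom_prod h.hom_power)
qed

end

lemma kalg_id: "kalg (\<lambda>c::'k::field. c)"
  by (intro kalg.intro) (unfold_locales, auto)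

lemma kalg_const: "kalg (mp_const :: 'k::field \<Rightarrow> 'k mp)"
  by (intro kalg.intro mp_const_hom)

lemma comm_ring_hom_comp: "comm_ring_hom f \<Longrightarrow> comm_ring_hom g \<Longrightarrow> comm_ring_hom (\<lambda>x. f (g x))"
proof -
  assume "comm_ring_hom f" "comm_ring_hom g"
  then interpret f: comm_ring_hom f + g: comm_ring_hom g .
  show ?thesis by unfold_locales (auto simp: f.hom_add g.hom_add f.hom_mult g.hom_mult)
qed

lemma comm_ring_hom_pCons: "comm_ring_hom (\<lambda>c::'a::comm_ring_1. [:c:])"
  by unfold_locales (auto simp: one_pCons)

lemma comm_ring_hom_map_poly: "comm_ring_hom f \<Longrightarrow> comm_ring_hom (map_poly f)"
proof -
  assume "comm_ring_hom f"
  then interpret f: comm_ring_hom f .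
  show ?thesis by unfold_locales
      (auto intro!: poly_eqI simp: coeff_map_poly f.hom_add f.hom_mult coeff_mult f.hom_sum)
qed

lemma comm_ring_hom_poly: "comm_ring_hom (\<lambda>p. poly p (x::'a::comm_ring_1))"
  by unfold_locales auto

text \<open>k[x][z] is modelled by univariate polynomials over k[x]: z is \<open>[:0, 1:]\<close>,
  and the coefficients of its powers, which carry the final identity, are directly
  accessible.\<close>

abbreviation pconst :: "'k::field \<Rightarrow> 'k mp poly" where
  "pconst c \<equiv> [:mp_const c:]"

lemma kalg_pconst: "kalg (pconst :: 'k::field \<Rightarrow> 'k mp poly)"
  by (intro kalg.intro comm_ring_hom_comp[OF comm_ring_hom_pCons mp_const_hom])

lemma subst_mvar_id: "mp_subst mp_const mvar p = (p :: 'k::field mp)"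
proof -
  interpret kalg "mp_const :: 'k \<Rightarrow> 'k mp" by (rule kalg_const)
  have m: "monom_eval mvar m = (single m 1 :: 'k mp)" for m :: "nat \<Rightarrow>\<^sub>0 nat"
  proof (induction m rule: Poly_Mapping.update_induct)
    case const
    thus ?case by (simp add: one_poly_mapping_def single.abs_eq)
  next
    case (update m v k)
    have e: "Poly_Mapping.update v k m = m + single v k"
      using update(1) by (intro poly_mapping_eqI) (auto simp: lookup_update lookup_add lookup_single when_def in_keys_iff)
    have pwr: "(mvar v :: 'k mp) ^ k = single (single v k) 1" for k
    proof (induction k)
      case (Suc k)
      have "single v (Suc 0) + single v k = single v (Suc k)"
        by (metis plus_1_eq_Suc single_add One_nat_def)
      thus ?case using Suc by (simp add: mvar_def mult_single)
    qed simp
    show ?case unfolding e monom_eval_add update(3) monom_eval_single pwr by (simp add: mult_single)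
  qed
  show ?thesis unfolding subst_mon m mp_const_def mult_single
    using poly_mapping_decomp[of p] by simp
qed

lemma hom_eq_subst:
  fixes h :: "'k::field mp \<Rightarrow> 'r::idom"
  assumes "comm_ring_hom h"
  shows "h p = mp_subst (\<lambda>c. h (mp_const c)) (\<lambda>v. h (mvar v)) p"
  using kalg.hom_subst[OF kalg_const assms, of mvar p] by (simp add: subst_mvar_id)

text \<open>Both sides are determined by their values on constants and variables, so identities
  between composed substitutions reduce to checks on these.\<close>

lemma hom_ext:
  fixes h h' :: "'k::field mp \<Rightarrow> 'r::idom"
  assumes "comm_ring_hom h" "comm_ring_hom h'" "\<And>c. h (mp_const c) = h' (mp_const c)"
    "\<And>v. v \<in> mp_vars p \<Longrightarrow> h (mvar v) = h' (mvar v)"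
  shows "h p = h' p"
proof -
  interpret kalg "\<lambda>c. h' (mp_const c)"
    by (intro kalg.intro comm_ring_hom_comp[OF assms(2) mp_const_hom])
  show ?thesis
    unfolding hom_eq_subst[OF assms(1), of p] hom_eq_subst[OF assms(2), of p] assms(3)
    by (intro subst_cong assms(4))
qed

section \<open>Growth of the span of products\<close>

text \<open>Products of at most \<open>e\<close> factors. Keeping the previous stage makes the sets
  increase with \<open>e\<close>, so that their spans filter the algebra generated by
  \<open>S\<close>.\<close>

primrec products :: "'r::comm_monoid_mult set \<Rightarrow> nat \<Rightarrow> 'r set" where
  "products S 0 = {1}"
| "products S (Suc e) = products S e \<union> {s * p |s p. s \<in> S \<and> p \<in> products S e}"

lemma finite_products: "finite S \<Longrightarrow> finite (products S e)"
  by (induction e) (auto intro: finite_image_set2)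

lemma products_mono: "e \<le> e' \<Longrightarrow> products S e \<subseteq> products S e'"
  by (rule lift_Suc_mono_le[of "products S"]) auto

lemma one_in_products: "1 \<in> products S e"
  using products_mono[of 0 e S] by simp

lemma products_mult: "p \<in> products S e \<Longrightarrow> q \<in> products S e' \<Longrightarrow> p * q \<in> products S (e + e')"
proof (induction e arbitrary: p)
  case (Suc e)
  show ?case
  proof (cases "p \<in> products S e")
    case True
    with Suc.IH[OF True Suc.prems(2)] show ?thesis by simp
  next
    case False
    with Suc.prems obtain s p' where "p = s * p'" "s \<in> S" "p' \<in> products S e" by auto
    with Suc.IH[of p'] Suc.prems show ?thesis by (auto simp: mult.assoc)
  qed
qed simp

lemma products_mono_set: "S \<subseteq> S' \<Longrightarrow> products S e \<subseteq> products S' e"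
  by (induction e) auto

lemma products_base: "s \<in> S \<Longrightarrow> s \<in> products S (Suc e)"
  using one_in_products[of S e] by force

lemma products_power: "s \<in> S \<Longrightarrow> s ^ k \<in> products S k"
  by (induction k) auto

lemma products_insert:
  "x \<in> products (insert u S) e \<Longrightarrow> \<exists>i\<le>e. \<exists>p\<in>products S e. x = u ^ i * p"
proof (induction e arbitrary: x)
  case (Suc e)
  show ?case
  proof (cases "x \<in> products (insert u S) e")
    case True
    from Suc.IH[OF this] obtain i p where "i \<le> e" "p \<in> products S e" "x = u ^ i * p" by auto
    thus ?thesis by (intro exI[of _ i]) auto
  next
    case False
    with Suc.prems obtain s x' where sx: "x = s * x'" "s = u \<or> s \<in> S" "x' \<in> products (insert u S) e" by auto
    from Suc.IH[OF this(3)] obtain i p where ip: "i \<le> e" "p \<in> products S e" "x' = u ^ i * p" by auto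
    show ?thesis
    proof (cases "s = u")
      case True
      hence "x = u ^ Suc i * p" using ip sx by (simp add: mult.assoc)
      thus ?thesis using ip by (intro exI[of _ "Suc i"]) auto
    next
      case False
      hence "s * p \<in> products S (Suc e)" using sx ip by auto
      moreover have "x = u ^ i * (s * p)" using sx ip by (simp add: ac_simps)
      ultimately show ?thesis using ip by (intro exI[of _ i] conjI bexI[of _ "s * p"]) auto
    qed
  qed
qed simp

lemma monom_eval_in_products:
  assumes "keys m \<subseteq> V" "wdeg (\<lambda>_. 1) m \<le> e"
  shows "monom_eval y m \<in> products (y ` V) e"
proof -
  have "(\<Prod>v\<in>A. y v ^ lookup m v) \<in> products (y ` V) (\<Sum>v\<in>A. lookup m v)"
    if "finite A" "A \<subseteq> V" for A
    using that by (induction A rule: finite_induct) (auto intro!: products_mult products_power)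
  from this[OF finite_keys assms(1)] show ?thesis
    using products_mono[OF assms(2)] by (auto simp: monom_eval_def wdeg_def)
qed

text \<open>Exponents are counted as extensional functions, whose number is explicit; this converts
  them into monomials and forgets the default value outside \<open>V\<close>.\<close>

definition monom_of :: "'v set \<Rightarrow> ('v \<Rightarrow> nat) \<Rightarrow> 'v \<Rightarrow>\<^sub>0 nat" where
  "monom_of V f = (\<Sum>v\<in>V. single v (f v))"

lemma lookup_monom_of: "finite V \<Longrightarrow> lookup (monom_of V f) v = (if v \<in> V then f v else 0)"
  by (simp add: monom_of_def lookup_sum lookup_single when_def)

lemma keys_monom_of: "finite V \<Longrightarrow> keys (monom_of V f) \<subseteq> V"
  by (auto simp: in_keys_iff lookup_monom_of split: if_splits)

lemma wdeg_monom_of: "finite V \<Longrightarrow> wdeg w (monom_of V f) = (\<Sum>v\<in>V. w v * f v)"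
  using wdeg_superset[OF _ keys_monom_of, of V w f] by (simp add: lookup_monom_of)

lemma inj_on_monom_of: "finite V \<Longrightarrow> inj_on (monom_of V) (Pi\<^sub>E V A)"
proof (rule inj_onI)
  fix f g assume V: "finite V" "f \<in> Pi\<^sub>E V A" "g \<in> Pi\<^sub>E V A" and eq: "monom_of V f = monom_of V g"
  show "f = g"
  proof (rule PiE_ext[OF V(2,3)])
    fix v assume "v \<in> V"
    thus "f v = g v" using arg_cong[OF eq, of "\<lambda>m. lookup m v"] V(1) by (simp add: lookup_monom_of)
  qed
qed

context kalg
begin

sublocale vs: vector_space "\<lambda>c x. \<kappa> c * x"
  by unfold_locales (auto simp: algebra_simps hom_add hom_mult)

text \<open>Stated for an indexed family: distinct indices may carry equal values, and then the
  difference of two members is already a nontrivial relation.\<close>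

lemma linear_relation_if_card_less:
  assumes "finite U" "finite W" "card W < card U" "\<And>i. i \<in> U \<Longrightarrow> a i \<in> vs.span W"
  shows "\<exists>c. (\<exists>i\<in>U. c i \<noteq> 0) \<and> (\<Sum>i\<in>U. \<kappa> (c i) * a i) = 0"
proof (cases "inj_on a U")
  case True
  have "vs.dependent (a ` U)"
  proof (rule ccontr)
    assume "\<not> vs.dependent (a ` U)"
    from vs.independent_span_bound[OF assms(2) this] have "card (a ` U) \<le> card W"
      using assms(4) by auto
    thus False using card_image[OF True] assms(3) by simp
  qed
  then obtain u where u: "\<exists>v\<in>a ` U. u v \<noteq> 0" "(\<Sum>v\<in>a ` U. \<kappa> (u v) * v) = 0"
    using vs.dependent_finite[of "a ` U"] assms(1) by auto
  show ?thesis using u by (intro exI[of _ "\<lambda>i. u (a i)"]) (auto simp: sum.reindex[OF True])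
next
  case False
  then obtain i j where ij: "i \<in> U" "j \<in> U" "i \<noteq> j" "a i = a j" by (auto simp: inj_on_def)
  let ?c = "\<lambda>k. if k = i then 1 else if k = j then - 1 else 0"
  have "(\<Sum>k\<in>U. \<kappa> (?c k) * a k) = (\<Sum>k\<in>{i,j}. \<kappa> (?c k) * a k)"
    using ij assms(1) by (intro sum.mono_neutral_right) auto
  also have "\<dots> = 0" using ij by (simp add: hom_uminus)
  finally show ?thesis using ij by (intro exI[of _ ?c]) auto
qed

text \<open>The linear relation among the values of the monomials in \<open>U\<close> is read as a
  polynomial supported on \<open>U\<close>; the choice of \<open>U\<close> thus prescribes the shape
  of the algebraic relation.\<close>

lemma algebraic_relation_if_card_less:
  assumes "finite U" "finite W" "card W < card U" "\<And>\<alpha>. \<alpha> \<in> U \<Longrightarrow> monom_eval y \<alpha> \<in> vs.span W"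
  shows "\<exists>F. F \<noteq> 0 \<and> keys F \<subseteq> U \<and> mp_subst \<kappa> y F = 0"
proof -
  from linear_relation_if_card_less[where a = "monom_eval y", OF assms] obtain c where c: "\<exists>i\<in>U. c i \<noteq> 0" "(\<Sum>i\<in>U. \<kappa> (c i) * monom_eval y i) = 0"
    by auto
  define F where "F = (\<Sum>i\<in>U. single i (c i))"
  have l: "lookup F i = (if i \<in> U then c i else 0)" for i
    using assms(1) by (simp add: F_def lookup_sum lookup_single when_def)
  have k: "keys F \<subseteq> U" by (auto simp: in_keys_iff l split: if_splits)
  have "F \<noteq> 0" using c(1) l by (metis lookup_zero)
  moreover have "mp_subst \<kappa> y F = 0"
    unfolding subst_superset[OF assms(1) k] l using c(2) by simp
  ultimately show ?thesis using k by blast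
qed

lemma span_mult:
  assumes "x \<in> vs.span A" "y \<in> vs.span B" "\<And>a b. a \<in> A \<Longrightarrow> b \<in> B \<Longrightarrow> a * b \<in> vs.span C"
  shows "x * y \<in> vs.span C"
proof -
  have 1: "a * y \<in> vs.span C" if "a \<in> A" for a
    using assms(2)
  proof (induction rule: vs.span_induct_alt)
    case (step c b z)
    have "a * (\<kappa> c * b + z) = \<kappa> c * (a * b) + a * z" by (simp add: algebra_simps)
    thus ?case using step assms(3)[OF that step(1)] vs.span_add vs.span_scale by metis
  qed (simp add: vs.span_zero)
  show ?thesis using assms(1)
  proof (induction rule: vs.span_induct_alt)
    case (step c b z)
    have "(\<kappa> c * b + z) * y = \<kappa> c * (b * y) + z * y" by (simp add: algebra_simps)
    thus ?case using step 1[OF step(1)] vs.span_add vs.span_scale by metis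
  qed (simp add: vs.span_zero)
qed

lemma span_products_mult: "x \<in> vs.span (products S e) \<Longrightarrow> y \<in> vs.span (products S e') \<Longrightarrow> x * y \<in> vs.span (products S (e + e'))"
  by (rule span_mult) (auto intro: vs.span_base products_mult)

lemma span_products_power:
  assumes "x \<in> vs.span (products S e)"
  shows "x ^ j \<in> vs.span (products S (j * e))"
proof (induction j)
  case (Suc j)
  from span_products_mult[OF assms Suc] show ?case by simp
qed (simp add: vs.span_base)

lemma span_products_mono: "x \<in> vs.span (products S e) \<Longrightarrow> e \<le> e' \<Longrightarrow> x \<in> vs.span (products S e')"
  using vs.span_mono[OF products_mono] by blast

lemma span_transfer:
  assumes "x \<in> vs.span A" "\<And>a. a \<in> A \<Longrightarrow> a \<in> vs.span B"
  shows "x \<in> vs.span B"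
  using assms vs.span_minimal[of A "vs.span B"] by auto

lemma dim_mono_span:
  assumes "finite Y" "Z \<subseteq> vs.span Y"
  shows "vs.dim Z \<le> vs.dim Y"
proof -
  obtain B where B: "B \<subseteq> Y" "Y \<subseteq> vs.span B" "card B = vs.dim Y"
    using vs.basis_exists[of Y] by metis
  have "Z \<subseteq> vs.span B" using assms(2) B(2) vs.span_minimal[OF B(2)] by auto
  thus ?thesis using vs.dim_le_card[of Z B] B assms(1) finite_subset by metis
qed

text \<open>In a domain, multiplication by a nonzero \<open>c\<close> preserves linear independence.
  This permits clearing denominators before counting.\<close>

lemma dim_le_scaled:
  assumes "finite W" "finite Z" "c \<noteq> 0" "\<And>x. x \<in> Z \<Longrightarrow> c * x \<in> vs.span W"
  shows "vs.dim Z \<le> card W"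
proof (rule ccontr)
  assume neg: "\<not> ?thesis"
  obtain B where B: "B \<subseteq> Z" "Z \<subseteq> vs.span B" "card B = vs.dim Z" "vs.independent B"
    using vs.basis_exists[of Z] by metis
  have fB: "finite B" using B(1) assms(2) finite_subset by auto
  obtain u where u: "\<exists>i\<in>B. u i \<noteq> 0" "(\<Sum>i\<in>B. \<kappa> (u i) * (c * i)) = 0"
    using linear_relation_if_card_less[OF fB assms(1), of "\<lambda>x. c * x"] B(1,3) assms(4) neg by auto
  have "c * (\<Sum>i\<in>B. \<kappa> (u i) * i) = 0" using u(2) by (simp add: sum_distrib_left ac_simps)
  hence "(\<Sum>i\<in>B. \<kappa> (u i) * i) = 0" using assms(3) by simp
  hence "vs.dependent B" using u(1) vs.dependent_finite[OF fB] by auto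
  thus False using B(4) by simp
qed

text \<open>For finite \<open>S\<close> this bounds the Gelfand-Kirillov dimension of the algebra
  generated by \<open>S\<close>, which for such domains equals the transcendence degree. The
  counting form passes directly to linear combinations, polynomial expressions and algebraic
  elements.\<close>

definition growth_le :: "'r set \<Rightarrow> nat \<Rightarrow> bool" where
  "growth_le S s \<longleftrightarrow> (\<exists>C. \<forall>e. vs.dim (products S e) \<le> C * (e + 1) ^ s)"

lemma pow_lin_bound: "(K * e + 1) ^ s \<le> (K + 1) ^ s * (e + 1) ^ s" for K e s :: nat
  unfolding power_mult_distrib[symmetric] by (intro power_mono) auto

lemma growth_basis:
  assumes "growth_le S s" "finite S"
  obtains C where "\<And>e. \<exists>B. finite B \<and> B \<subseteq> products S e \<and> products S e \<subseteq> vs.span B \<and> card B \<le> C * (e + 1) ^ s"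
proof -
  from assms obtain C where C: "\<And>e. vs.dim (products S e) \<le> C * (e + 1) ^ s" by (auto simp: growth_le_def)
  have "\<exists>B. finite B \<and> B \<subseteq> products S e \<and> products S e \<subseteq> vs.span B \<and> card B \<le> C * (e + 1) ^ s" for e
  proof -
    obtain B where B: "B \<subseteq> products S e" "products S e \<subseteq> vs.span B" "card B = vs.dim (products S e)"
      using vs.basis_exists[of "products S e"] by metis
    moreover have "finite B" using B(1) finite_products[OF assms(2)] finite_subset by auto
    ultimately show ?thesis using C[of e] by metis
  qed
  thus ?thesis using that by blast
qed

lemma growth_exp_mono: "growth_le S s \<Longrightarrow> s \<le> s' \<Longrightarrow> growth_le S s'"
  unfolding growth_le_def
proof (elim exE)
  fix C assume a: "\<forall>e. vs.dim (products S e) \<le> C * (e + 1) ^ s" and "s \<le> s'"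
  have "C * (e + 1) ^ s \<le> C * (e + 1) ^ s'" for e
    using \<open>s \<le> s'\<close> by (intro mult_left_mono power_increasing) auto
  thus "\<exists>C. \<forall>e. vs.dim (products S e) \<le> C * (e + 1) ^ s'" using a le_trans by blast
qed

text \<open>Products of \<open>e\<close> elements of \<open>S'\<close> lie in the span of products
  of \<open>K * e\<close> elements of \<open>S\<close>, and stretching \<open>e\<close> by a
  constant changes only the constant \<open>C\<close>.\<close>

lemma growth_span:
  assumes "finite S" "growth_le S s" "S' \<subseteq> vs.span (products S K)"
  shows "growth_le S' s"
proof -
  from assms(2) obtain C where C: "\<And>e. vs.dim (products S e) \<le> C * (e + 1) ^ s" by (auto simp: growth_le_def)
  have sub: "products S' e \<subseteq> vs.span (products S (K * e))" for e
  proof (induction e)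
    case (Suc e)
    have "s * p \<in> vs.span (products S (K * Suc e))" if "s \<in> S'" "p \<in> products S' e" for s p
      using span_products_mult[of s S K p "K * e"] that assms(3) Suc by auto
    moreover have "products S' e \<subseteq> vs.span (products S (K * Suc e))"
      using Suc span_products_mono[of _ S "K * e" "K * Suc e"] by auto
    ultimately show ?case by auto
  qed (auto intro: vs.span_base)
  have "vs.dim (products S' e) \<le> (C * (K + 1) ^ s) * (e + 1) ^ s" for e
  proof -
    have "vs.dim (products S' e) \<le> vs.dim (products S (K * e))"
      by (rule dim_mono_span[OF finite_products[OF assms(1)] sub])
    also have "\<dots> \<le> C * (K * e + 1) ^ s" by (rule C)
    also have "\<dots> \<le> C * ((K + 1) ^ s * (e + 1) ^ s)" using pow_lin_bound by (intro mult_left_mono) auto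
    finally show ?thesis by (simp add: ac_simps)
  qed
  thus ?thesis unfolding growth_le_def by blast
qed

lemma growth_insert:
  assumes "finite S" "growth_le S s"
  shows "growth_le (insert u S) (Suc s)"
proof -
  obtain C where C: "\<And>e. \<exists>B. finite B \<and> B \<subseteq> products S e \<and> products S e \<subseteq> vs.span B \<and> card B \<le> C * (e + 1) ^ s"
    using growth_basis[OF assms(2,1)] by blast
  have "vs.dim (products (insert u S) e) \<le> C * (e + 1) ^ Suc s" for e
  proof -
    obtain B where B: "finite B" "products S e \<subseteq> vs.span B" "card B \<le> C * (e + 1) ^ s" using C[of e] by blast
    let ?W = "(\<lambda>(i, b). u ^ i * b) ` ({..e} \<times> B)"
    have "products (insert u S) e \<subseteq> vs.span ?W"
    proof
      fix x assume "x \<in> products (insert u S) e"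
      from products_insert[OF this] obtain i p where ip: "i \<le> e" "p \<in> products S e" "x = u ^ i * p" by auto
      have "p \<in> vs.span B" using ip B by auto
      with vs.span_base[of "u ^ i" "{u ^ i}"] have "u ^ i * p \<in> vs.span ?W"
        by (rule span_mult) (use ip in \<open>auto intro!: vs.span_base\<close>)
      thus "x \<in> vs.span ?W" using ip by simp
    qed
    hence "vs.dim (products (insert u S) e) \<le> card ?W" using B(1) by (intro vs.dim_le_card) auto
    also have "\<dots> \<le> card ({..e} \<times> B)" using B(1) by (intro card_image_le) auto
    also have "\<dots> = (e + 1) * card B" by (simp add: card_cartesian_product)
    also have "\<dots> \<le> (e + 1) * (C * (e + 1) ^ s)" using B(3) by (intro mult_left_mono) auto
    finally show ?thesis by (simp add: ac_simps)
  qed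
  thus ?thesis unfolding growth_le_def by blast
qed

lemma growth_finite:
  assumes "finite S"
  shows "growth_le S (card S)"
  using assms
proof (induction S rule: finite_induct)
  case empty
  have "products {} e = {1 :: 'r}" for e by (induction e) auto
  hence "vs.dim (products {} e) \<le> 1 * (e + 1) ^ 0" for e
    using vs.dim_le_card[of "{1}" "{1}"] vs.span_superset by simp
  thus ?case unfolding growth_le_def by (metis card.empty)
next
  case (insert x F)
  thus ?case using growth_insert[of F "card F" x] by simp
qed

text \<open>The relation rewrites \<open>q * u ^ N\<close> by lower powers of \<open>u\<close>.
  Multiplying a product of length \<open>e\<close> by \<open>q ^ e\<close> therefore brings all
  powers of \<open>u\<close> below \<open>N\<close>, while the remaining factors have length linear
  in \<open>e\<close>. Only the constant grows, by the \<open>N\<close> possible powers, and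
  \<open>q ^ e\<close> is removed by \<open>dim_le_scaled\<close>.\<close>

lemma growth_algebraic:
  assumes S: "finite S" "growth_le S s" and q: "q \<noteq> 0" "q \<in> vs.span (products S K)"
    and rel: "q * u ^ N \<in> vs.span {a * u ^ i |a i. a \<in> products S K \<and> i < N}"
  shows "growth_le (insert u S) s"
proof -
  \<comment> \<open>For \<open>N = 0\<close> the spanning set would be empty, forcing
    \<open>q = 0\<close>.\<close>
  have N: "N > 0" using rel q(1) by (cases N) auto
  define T where "T j = {a * u ^ i |a i. a \<in> products S j \<and> i < N}" for j
  have T_mult: "b * x \<in> vs.span (T (k + j))" if "b \<in> vs.span (products S k)" "x \<in> vs.span (T j)" for b x k j
    using that
  proof (rule span_mult)
    fix b c assume "b \<in> products S k" "c \<in> T j"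
    then obtain a i where "c = a * u ^ i" "a \<in> products S j" "i < N" by (auto simp: T_def)
    hence "b * c = (b * a) * u ^ i" "b * a \<in> products S (k + j)" "i < N"
      using products_mult \<open>b \<in> products S k\<close> by (auto simp: ac_simps)
    thus "b * c \<in> vs.span (T (k + j))" unfolding T_def by (intro vs.span_base) blast
  qed
  \<comment> \<open>Either the exponent of \<open>u\<close> may still rise below \<open>N\<close>,
    or the relation replaces \<open>q * u ^ N\<close>; both cost at most \<open>K\<close> further
    factors.\<close>
  have step: "(q * u) * x \<in> vs.span (T (K + j))" if "x \<in> vs.span (T j)" for x j
    using vs.span_base[of "q * u" "{q * u}"] that
  proof (rule span_mult)
    fix b c assume "b \<in> {q * u}" "c \<in> T j"
    then obtain a i where c: "c = a * u ^ i" "a \<in> products S j" "i < N" by (auto simp: T_def)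
    show "b * c \<in> vs.span (T (K + j))"
    proof (cases "Suc i < N")
      case True
      have "a * u ^ Suc i \<in> vs.span (T j)" unfolding T_def using c True by (intro vs.span_base) blast
      from T_mult[OF q(2) this] show ?thesis using c \<open>b \<in> {q * u}\<close> by (simp add: ac_simps)
    next
      case False
      hence i: "Suc i = N" using c by simp
      have "a * (q * u ^ N) \<in> vs.span (T (j + K))"
        using T_mult[of a j "q * u ^ N" K] c rel by (auto simp: T_def intro: vs.span_base)
      moreover have "b * c = a * (q * u ^ N)" using c \<open>b \<in> {q * u}\<close> i[symmetric] by (simp add: ac_simps)
      ultimately show ?thesis by (simp add: add.commute)
    qed
  qed simp
  have pow: "q ^ j * u ^ j \<in> vs.span (T (j * K))" for j
  proof (induction j)
    case 0
    have "1 * u ^ 0 \<in> T 0" unfolding T_def using N one_in_products[of S 0] by blast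
    thus ?case by (auto intro: vs.span_base)
  next
    case (Suc j)
    from step[OF this] show ?case by (simp add: ac_simps)
  qed
  \<comment> \<open>Of the \<open>e\<close> factors \<open>q\<close>, each of the \<open>i\<close>
    factors \<open>u\<close> receives one; the others are absorbed by the part without
    \<open>u\<close>.\<close>
  have key: "q ^ e * x \<in> vs.span (T ((K + 1) * e))" if "x \<in> products (insert u S) e" for x e
  proof -
    from products_insert[OF that] obtain i p where ip: "i \<le> e" "p \<in> products S e" "x = u ^ i * p" by auto
    have "q ^ (e - i) * p \<in> vs.span (products S ((e - i) * K + e))"
      using span_products_mult[OF span_products_power[OF q(2)] vs.span_base[OF ip(2)]] .
    from T_mult[OF this pow[of i]]
    have "(q ^ (e - i) * p) * (q ^ i * u ^ i) \<in> vs.span (T ((e - i) * K + e + i * K))" .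
    moreover have "(q ^ (e - i) * p) * (q ^ i * u ^ i) = (q ^ (e - i) * q ^ i) * x"
      using ip(3) by (simp add: ac_simps)
    moreover have "q ^ (e - i) * q ^ i = q ^ e" using ip(1) by (simp flip: power_add)
    moreover have "(e - i) * K + e + i * K = (K + 1) * e"
      using ip(1) by (auto simp: le_iff_add algebra_simps)
    ultimately show ?thesis by simp
  qed
  obtain C where C: "\<And>e. \<exists>B. finite B \<and> B \<subseteq> products S e \<and> products S e \<subseteq> vs.span B \<and> card B \<le> C * (e + 1) ^ s"
    using growth_basis[OF S(2,1)] by blast
  have "vs.dim (products (insert u S) e) \<le> (N * C * (K + 1 + 1) ^ s) * (e + 1) ^ s" for e
  proof -
    obtain B where B: "finite B" "products S ((K + 1) * e) \<subseteq> vs.span B" "card B \<le> C * ((K + 1) * e + 1) ^ s"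
      using C[of "(K + 1) * e"] by blast
    let ?W = "(\<lambda>(b, i). b * u ^ i) ` (B \<times> {..<N})"
    have "T ((K + 1) * e) \<subseteq> vs.span ?W"
    proof
      fix x assume "x \<in> T ((K + 1) * e)"
      then obtain a i where ai: "x = a * u ^ i" "a \<in> products S ((K + 1) * e)" "i < N" by (auto simp: T_def)
      have "a \<in> vs.span B" using ai B by auto
      hence "a * u ^ i \<in> vs.span ?W" using vs.span_base[of "u ^ i" "{u ^ i}"]
        by (rule span_mult) (use ai in \<open>auto intro!: vs.span_base\<close>)
      thus "x \<in> vs.span ?W" using ai by simp
    qed
    hence "q ^ e * x \<in> vs.span ?W" if "x \<in> products (insert u S) e" for x
      using span_transfer[OF key[OF that], of ?W] by blast
    hence "vs.dim (products (insert u S) e) \<le> card ?W"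
      using B(1) q(1) S(1) by (intro dim_le_scaled[of _ _ "q ^ e"]) (auto intro!: finite_products)
    also have "\<dots> \<le> card (B \<times> {..<N})" using B(1) by (intro card_image_le) auto
    also have "\<dots> \<le> C * ((K + 1) * e + 1) ^ s * N" using B(3) by (simp add: card_cartesian_product)
    also have "\<dots> \<le> C * ((K + 1 + 1) ^ s * (e + 1) ^ s) * N"
      using pow_lin_bound[of "K + 1" e s] by (intro mult_right_mono mult_left_mono) auto
    finally show ?thesis by (simp add: ac_simps)
  qed
  thus ?thesis unfolding growth_le_def by blast
qed

text \<open>The value of \<open>e\<close> is chosen such that the accumulated constant
  \<open>C * (k + 1) ^ s\<close> is \<open>e\<close> itself, which the one additional factor
  \<open>e + 1\<close> on the right exceeds.\<close>

lemma growth_gap: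
  fixes C k s :: nat
  defines "e \<equiv> C * (k + 1) ^ s"
  assumes "s + 1 \<le> k'"
  shows "C * (k * e + 1) ^ s < (e + 1) ^ k'"
proof -
  have "C * (k * e + 1) ^ s \<le> C * ((k + 1) ^ s * (e + 1) ^ s)"
    by (intro mult_left_mono pow_lin_bound) auto
  also have "\<dots> = e * (e + 1) ^ s" by (simp add: e_def)
  also have "\<dots> < (e + 1) * (e + 1) ^ s" by simp
  also have "\<dots> = (e + 1) ^ (s + 1)" by simp
  also have "\<dots> \<le> (e + 1) ^ k'" using assms by (intro power_increasing) auto
  finally show ?thesis .
qed

text \<open>Exponents up to \<open>e\<close> in each variable give \<open>(e + 1) ^ card V\<close>
  monomials of degree at most \<open>card V * e\<close>, while the span of their values has
  dimension of order \<open>e ^ s\<close>.\<close>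

lemma growth_relation:
  assumes V: "finite V" "growth_le (y ` V) s" "s + 1 \<le> card V"
  shows "\<exists>F. F \<noteq> 0 \<and> F \<in> polysV V \<and> mp_subst \<kappa> y F = 0"
proof -
  obtain C where C: "\<And>e. \<exists>B. finite B \<and> B \<subseteq> products (y ` V) e \<and> products (y ` V) e \<subseteq> vs.span B \<and> card B \<le> C * (e + 1) ^ s"
    using growth_basis[OF V(2)] V(1) by blast
  define e where "e = C * (card V + 1) ^ s"
  obtain W where W: "finite W" "products (y ` V) (card V * e) \<subseteq> vs.span W" "card W \<le> C * (card V * e + 1) ^ s"
    using C[of "card V * e"] by blast
  let ?U = "monom_of V ` (V \<rightarrow>\<^sub>E {..e})"
  have cU: "card ?U = (e + 1) ^ card V"
    by (subst card_image[OF inj_on_monom_of[OF V(1)]]) (simp add: card_PiE V(1))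
  have "\<exists>F. F \<noteq> 0 \<and> keys F \<subseteq> ?U \<and> mp_subst \<kappa> y F = 0"
  proof (rule algebraic_relation_if_card_less[OF _ W(1)])
    show "finite ?U" using V(1) by (intro finite_imageI finite_PiE) auto
    show "card W < card ?U" using W(3) growth_gap[OF V(3), of C "card V"] cU by (simp add: e_def)
    fix \<alpha> assume "\<alpha> \<in> ?U"
    then obtain f where f: "\<alpha> = monom_of V f" "f \<in> V \<rightarrow>\<^sub>E {..e}" by auto
    have "wdeg (\<lambda>_. 1) \<alpha> = (\<Sum>v\<in>V. f v)" using f V(1) by (simp add: wdeg_monom_of)
    also have "\<dots> \<le> card V * e" using sum_bounded_above[of V f e] f(2) by (auto simp: PiE_def Pi_def)
    finally show "monom_eval y \<alpha> \<in> vs.span W"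
      using W(2) monom_eval_in_products[of \<alpha> V _ y] keys_monom_of[OF V(1)] f(1) by blast
  qed
  moreover have "F \<in> polysV V" if "keys F \<subseteq> ?U" for F :: "(_, 'k) mpolynomial"
    using that keys_monom_of[OF V(1)] by (fastforce simp: polysV_def mp_vars_def)
  ultimately show ?thesis by blast
qed

text \<open>One variable is used to fill all monomials up to a common degree. Only
  \<open>card V - 1\<close> exponents remain free, whence \<open>s + 2\<close> instead of
  \<open>s + 1\<close>.\<close>

lemma growth_relation_homogeneous:
  assumes V: "finite V" "growth_le (y ` V) s" "s + 2 \<le> card V"
  shows "\<exists>F E. F \<noteq> 0 \<and> F \<in> polysV V \<and> (\<forall>m\<in>keys F. wdeg (\<lambda>_. 1) m = E) \<and> mp_subst \<kappa> y F = 0"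
proof -
  obtain C where C: "\<And>e. \<exists>B. finite B \<and> B \<subseteq> products (y ` V) e \<and> products (y ` V) e \<subseteq> vs.span B \<and> card B \<le> C * (e + 1) ^ s"
    using growth_basis[OF V(2)] V(1) by blast
  define e where "e = C * (card V + 1) ^ s"
  define E where "E = card V * e"
  obtain W where W: "finite W" "products (y ` V) E \<subseteq> vs.span W" "card W \<le> C * (E + 1) ^ s"
    using C[of E] by blast
  obtain v0 where v0: "v0 \<in> V" using V(3) by fastforce
  define V' where "V' = V - {v0}"
  have V': "finite V'" "card V' = card V - 1" using V(1) v0 by (auto simp: V'_def)
  \<comment> \<open>The exponent of \<open>v0\<close> is the slack; the free exponents sum to at
    most \<open>card V' * e\<close>, hence to at most \<open>E\<close>, so the subtraction is not
    truncated.\<close>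
  define h where "h f = monom_of V' f + single v0 (E - (\<Sum>v\<in>V'. f v))" for f :: "'a \<Rightarrow> nat"
  let ?P = "V' \<rightarrow>\<^sub>E {..e}"
  let ?U = "h ` ?P"
  have inj: "inj_on h ?P"
  proof (rule inj_onI)
    fix f g assume fg: "f \<in> ?P" "g \<in> ?P" and eq: "h f = h g"
    show "f = g"
    proof (rule PiE_ext[OF fg])
      fix v assume "v \<in> V'"
      moreover from this have "v \<noteq> v0" by (auto simp: V'_def)
      ultimately show "f v = g v" using arg_cong[OF eq, of "\<lambda>m. lookup m v"] V'(1)
        by (simp add: h_def lookup_add lookup_monom_of lookup_single when_def)
    qed
  qed
  have cU: "card ?U = (e + 1) ^ (card V - 1)"
    by (subst card_image[OF inj]) (simp add: card_PiE V')
  have hU: "wdeg (\<lambda>_. 1) \<alpha> = E \<and> keys \<alpha> \<subseteq> V" if "\<alpha> \<in> ?U" for \<alpha>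
  proof -
    from that obtain f where f: "\<alpha> = h f" "f \<in> ?P" by auto
    have "(\<Sum>v\<in>V'. f v) \<le> card V' * e" using sum_bounded_above[of V' f e] f(2) by (auto simp: PiE_def Pi_def)
    also have "\<dots> \<le> E" by (simp add: E_def V')
    finally have "wdeg (\<lambda>_. 1) \<alpha> = E" using f V'(1) by (simp add: h_def wdeg_add wdeg_monom_of)
    moreover have "keys \<alpha> \<subseteq> V"
      using keys_monom_of[OF V'(1), of f] v0 unfolding f(1) h_def keys_add_nat by (auto simp: V'_def split: if_splits)
    ultimately show ?thesis by blast
  qed
  have "\<exists>F. F \<noteq> 0 \<and> keys F \<subseteq> ?U \<and> mp_subst \<kappa> y F = 0"
  proof (rule algebraic_relation_if_card_less[OF _ W(1)])
    show "finite ?U" using V'(1) by (intro finite_imageI finite_PiE) auto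
    have "s + 1 \<le> card V - 1" using V(3) by simp
    from growth_gap[OF this, of C "card V"] show "card W < card ?U" using W(3) cU by (simp add: e_def E_def)
    fix \<alpha> assume "\<alpha> \<in> ?U"
    with hU show "monom_eval y \<alpha> \<in> vs.span W" using W(2) monom_eval_in_products[of \<alpha> V E y] by blast
  qed
  then obtain F where F: "F \<noteq> 0" "keys F \<subseteq> ?U" "mp_subst \<kappa> y F = 0" by blast
  moreover have "F \<in> polysV V" unfolding polysV_def mp_vars_def using hU F(2) by blast
  moreover have "\<forall>m\<in>keys F. wdeg (\<lambda>_. 1) m = E" using hU F(2) by blast
  ultimately show ?thesis by blast
qed

end

section \<open>Integral extensions\<close>

definition coeffs_in :: "'r::comm_ring_1 set \<Rightarrow> 'r poly \<Rightarrow> bool" where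
  "coeffs_in S p \<longleftrightarrow> (\<forall>i. coeff p i \<in> S)"

lemma is_subring_coeffs_in: "is_subring S \<Longrightarrow> is_subring {p. coeffs_in S p}"
proof -
  assume S: "is_subring S"
  have "coeffs_in S (p - q) \<and> coeffs_in S (p * q)" if "coeffs_in S p" "coeffs_in S q" for p q
    using that S by (auto simp: coeffs_in_def coeff_mult is_subringD intro!: is_subring_sum)
  moreover have "coeffs_in S 1" using S by (auto simp: coeffs_in_def coeff_1 is_subringD)
  ultimately show ?thesis unfolding is_subring_def by simp
qed

lemmas coeffs_inD = is_subring_coeffs_in[THEN is_subringD(3), simplified]
  is_subring_coeffs_in[THEN is_subringD(4), simplified]
  is_subring_coeffs_in[THEN is_subringD(5), simplified]

lemma coeffs_in_monom: "is_subring S \<Longrightarrow> a \<in> S \<Longrightarrow> coeffs_in S (monom a k)"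
  by (auto simp: coeffs_in_def is_subringD)

lemma coeffs_in_smult: "is_subring S \<Longrightarrow> a \<in> S \<Longrightarrow> coeffs_in S p \<Longrightarrow> coeffs_in S (smult a p)"
  by (auto simp: coeffs_in_def is_subringD)

lemma coeffs_in_const: "is_subring S \<Longrightarrow> a \<in> S \<Longrightarrow> coeffs_in S [:a:]"
  using coeffs_in_monom[of S a 0] by (simp add: monom_0)

lemma coeffs_in_0: "is_subring S \<Longrightarrow> coeffs_in S 0"
  by (auto simp: coeffs_in_def is_subringD)

lemma coeffs_in_mono: "S \<subseteq> T \<Longrightarrow> coeffs_in S p \<Longrightarrow> coeffs_in T p"
  by (auto simp: coeffs_in_def)

text \<open>Each step multiplies by the leading coefficient of \<open>Q\<close> instead of dividing
  by it, so that quotient and remainder keep their coefficients in \<open>S\<close>. For monic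
  \<open>Q\<close> it is ordinary division.\<close>

lemma pseudo_division_subring:
  fixes P Q :: "'r::idom poly"
  assumes "is_subring S" "coeffs_in S P" "coeffs_in S Q" "Q \<noteq> 0"
  shows "\<exists>a A R. coeffs_in S A \<and> coeffs_in S R \<and> smult (lead_coeff Q ^ a) P = Q * A + R \<and>
           (R = 0 \<or> degree R < degree Q)"
  using assms(2)
proof (induction "degree P" arbitrary: P rule: less_induct)
  case less
  note S = assms(1)
  show ?case
  proof (cases "P = 0 \<or> degree P < degree Q")
    case True
    thus ?thesis using less.prems S
      by (intro exI[of _ 0] exI[of _ P] conjI) (auto simp: coeffs_in_0)
  next
    case False
    let ?q = "lead_coeff Q" and ?p = "lead_coeff P" and ?k = "degree P - degree Q"
    have q: "?q \<in> S" "?p \<in> S" using assms(3) less.prems by (auto simp: coeffs_in_def)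
    define P' where "P' = smult ?q P - Q * monom ?p ?k"
    have cP': "coeffs_in S P'"
      unfolding P'_def using S q assms(3) less.prems
      by (intro coeffs_inD coeffs_in_smult coeffs_in_monom)
    have dk: "degree (Q * monom ?p ?k) = degree P"
      using False assms(4) by (simp add: degree_mult_eq degree_monom_eq)
    have le: "degree P' \<le> degree P"
      unfolding P'_def using dk by (metis degree_diff_le degree_smult_le order.refl)
    have "coeff (Q * monom ?p ?k) (degree P) = ?q * ?p"
      using lead_coeff_mult[of Q "monom ?p ?k"] by (simp only: dk lead_coeff_monom)
    hence z: "coeff P' (degree P) = 0" by (simp add: P'_def)
    have "P' = 0 \<or> degree P' < degree P"
      using le z by (metis le_neq_implies_less leading_coeff_0_iff)
    hence "\<exists>a A R. coeffs_in S A \<and> coeffs_in S R \<and> smult (?q ^ a) P' = Q * A + R \<and>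
           (R = 0 \<or> degree R < degree Q)"
    proof
      assume "P' = 0"
      thus ?thesis using S by (intro exI[of _ 0]) (auto simp: coeffs_in_0)
    qed (use less.hyps cP' in blast)
    then obtain a A R where *: "coeffs_in S A" "coeffs_in S R" "smult (?q ^ a) P' = Q * A + R"
      "R = 0 \<or> degree R < degree Q" by blast
    let ?A = "A + smult (?q ^ a) (monom ?p ?k)"
    have "smult (?q ^ Suc a) P = smult (?q ^ a) P' + smult (?q ^ a) (Q * monom ?p ?k)"
      by (simp add: P'_def smult_diff_right mult.commute)
    also have "\<dots> = Q * ?A + R" by (simp add: *(3) algebra_simps)
    finally have "smult (?q ^ Suc a) P = Q * ?A + R" .
    moreover have "coeffs_in S ?A"
      using S q * by (intro coeffs_inD coeffs_in_smult coeffs_in_monom is_subring_power)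
    ultimately show ?thesis using * by blast
  qed
qed

definition lin_span :: "'r::comm_ring_1 set \<Rightarrow> 'r set \<Rightarrow> 'r set" where
  "lin_span S G = {\<Sum>g\<in>G. s g * g |s. \<forall>g. s g \<in> S}"

definition finite_ext :: "'r::comm_ring_1 set \<Rightarrow> 'r set \<Rightarrow> bool" where
  "finite_ext S B \<longleftrightarrow> is_subring B \<and> S \<subseteq> B \<and> (\<exists>G. finite G \<and> B = lin_span S G)"

definition integral_over :: "'r::comm_ring_1 set \<Rightarrow> 'r \<Rightarrow> bool" where
  "integral_over S b \<longleftrightarrow> (\<exists>p. coeffs_in S p \<and> lead_coeff p = 1 \<and> poly p b = 0)"

lemma integral_over_mono: "S \<subseteq> T \<Longrightarrow> integral_over S b \<Longrightarrow> integral_over T b"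
  unfolding integral_over_def using coeffs_in_mono by blast

lemma lin_span_add: "is_subring S \<Longrightarrow> x \<in> lin_span S G \<Longrightarrow> y \<in> lin_span S G \<Longrightarrow> x + y \<in> lin_span S G"
proof -
  assume S: "is_subring S" and "x \<in> lin_span S G" "y \<in> lin_span S G"
  then obtain s t where "x = (\<Sum>g\<in>G. s g * g)" "y = (\<Sum>g\<in>G. t g * g)" "\<forall>g. s g \<in> S" "\<forall>g. t g \<in> S"
    by (auto simp: lin_span_def)
  thus ?thesis unfolding lin_span_def using S
    by (auto intro!: exI[of _ "\<lambda>g. s g + t g"] simp: is_subringD sum.distrib algebra_simps)
qed

lemma lin_span_mult: "is_subring S \<Longrightarrow> a \<in> S \<Longrightarrow> x \<in> lin_span S G \<Longrightarrow> a * x \<in> lin_span S G"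
proof -
  assume S: "is_subring S" "a \<in> S" and "x \<in> lin_span S G"
  then obtain s where "x = (\<Sum>g\<in>G. s g * g)" "\<forall>g. s g \<in> S" by (auto simp: lin_span_def)
  thus ?thesis unfolding lin_span_def using S
    by (auto intro!: exI[of _ "\<lambda>g. a * s g"] simp: is_subringD sum_distrib_left ac_simps)
qed

lemma lin_span_base: "is_subring S \<Longrightarrow> finite G \<Longrightarrow> g \<in> G \<Longrightarrow> g \<in> lin_span S G"
proof -
  assume S: "is_subring S" and G: "finite G" "g \<in> G"
  have "(\<Sum>g'\<in>G. (if g' = g then 1 else 0) * g') = (\<Sum>g'\<in>{g}. (if g' = g then 1 else 0) * g')"
    using G by (intro sum.mono_neutral_right) auto
  also have "\<dots> = g" by simp
  finally show ?thesis unfolding lin_span_def using is_subringD(1,2)[OF S]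
    by (intro CollectI exI[of _ "\<lambda>g'. if g' = g then 1 else 0"]) auto
qed

lemma lin_span_0: "is_subring S \<Longrightarrow> 0 \<in> lin_span S G"
  unfolding lin_span_def by (auto intro!: exI[of _ "\<lambda>_. 0"] simp: is_subringD)

lemma lin_span_sum: "is_subring S \<Longrightarrow> (\<And>i. i \<in> I \<Longrightarrow> f i \<in> lin_span S G) \<Longrightarrow> sum f I \<in> lin_span S G"
  by (induction I rule: infinite_finite_induct) (auto simp: lin_span_0 intro: lin_span_add)

lemma finite_ext_refl: "is_subring S \<Longrightarrow> finite_ext S S"
proof -
  assume S: "is_subring S"
  have "lin_span S {1} = S" by (auto simp: lin_span_def intro!: exI[of _ "\<lambda>_. _"])
  thus ?thesis unfolding finite_ext_def using S by (metis finite.emptyI finite.insertI order_refl)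
qed

text \<open>Division by the monic equation of \<open>b\<close> leaves remainders of degree below
  \<open>degree p\<close>; so B[b] is generated over \<open>S\<close> by the products
  \<open>g * b ^ i\<close> with \<open>g\<close> a generator of \<open>B\<close> and
  \<open>i\<close> below that degree.\<close>

lemma finite_ext_adjoin:
  fixes b :: "'r::idom"
  assumes S: "is_subring S" and B: "finite_ext S B" and b: "integral_over B b"
  shows "\<exists>B'. finite_ext S B' \<and> B \<subseteq> B' \<and> b \<in> B'"
proof -
  from B obtain G where G: "is_subring B" "S \<subseteq> B" "finite G" "B = lin_span S G" by (auto simp: finite_ext_def)
  from b obtain p where p: "coeffs_in B p" "lead_coeff p = 1" "poly p b = 0" by (auto simp: integral_over_def)
  define B' where "B' = {poly q b |q. coeffs_in B q}"
  define G' where "G' = (\<lambda>(g, i). g * b ^ i) ` (G \<times> {..<degree p})"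
  have fG': "finite G'" using G(3) by (simp add: G'_def)
  have sub: "is_subring B'"
  proof -
    have "poly p b - poly q b \<in> B' \<and> poly p b * poly q b \<in> B'" if "coeffs_in B p" "coeffs_in B q" for p q
      unfolding B'_def using coeffs_inD(2,3)[OF G(1) that] by (metis (mono_tags, lifting) mem_Collect_eq poly_diff poly_mult)
    moreover have "1 \<in> B'" unfolding B'_def using coeffs_in_const[OF G(1) is_subringD(1)[OF G(1)]]
      by (intro CollectI exI[of _ "[:1:]"]) auto
    ultimately show ?thesis unfolding is_subring_def by (auto simp: B'_def)
  qed
  have BB': "B \<subseteq> B'"
  proof
    fix x assume "x \<in> B"
    thus "x \<in> B'" unfolding B'_def using coeffs_in_const[OF G(1)] by (intro CollectI exI[of _ "[:x:]"]) auto
  qed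
  have bB': "b \<in> B'"
    unfolding B'_def using coeffs_in_monom[OF G(1) is_subringD(1)[OF G(1)], of 1]
    by (intro CollectI exI[of _ "monom 1 1"]) (auto simp: poly_monom)
  have "B' \<subseteq> lin_span S G'"
  proof
    fix x assume "x \<in> B'"
    then obtain q where q: "x = poly q b" "coeffs_in B q" by (auto simp: B'_def)
    have "p \<noteq> 0" using p(2) by auto
    from pseudo_division_subring[OF G(1) q(2) p(1) this] obtain A R where
      AR: "coeffs_in B R" "q = p * A + R" "R = 0 \<or> degree R < degree p"
      using p(2) by auto
    have "x = poly R b" using q AR p(3) by simp
    also have "\<dots> = (\<Sum>i<degree p. coeff R i * b ^ i)"
    proof (cases "R = 0")
      case False
      hence "degree R < degree p" using AR(3) by simp
      thus ?thesis unfolding poly_altdef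
        by (intro sum.mono_neutral_left) (auto simp: coeff_eq_0)
    qed simp
    also have "\<dots> \<in> lin_span S G'"
    proof (rule lin_span_sum[OF S])
      fix i assume i: "i \<in> {..<degree p}"
      have "coeff R i \<in> lin_span S G" using AR(1) G(4) by (auto simp: coeffs_in_def)
      then obtain s where s: "coeff R i = (\<Sum>g\<in>G. s g * g)" "\<forall>g. s g \<in> S" by (auto simp: lin_span_def)
      have "coeff R i * b ^ i = (\<Sum>g\<in>G. s g * (g * b ^ i))"
        by (simp add: s(1) sum_distrib_right mult.assoc)
      also have "\<dots> \<in> lin_span S G'"
        using i s(2) by (intro lin_span_sum[OF S] lin_span_mult[OF S] lin_span_base[OF S fG']) (auto simp: G'_def)
      finally show "coeff R i * b ^ i \<in> lin_span S G'" .
    qed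
    finally show "x \<in> lin_span S G'" .
  qed
  moreover have "lin_span S G' \<subseteq> B'"
  proof
    fix x assume "x \<in> lin_span S G'"
    then obtain s where s: "x = (\<Sum>g\<in>G'. s g * g)" "\<forall>g. s g \<in> S" by (auto simp: lin_span_def)
    have "g \<in> B'" if "g \<in> G'" for g
      using that lin_span_base[OF S G(3)] G(4) BB' bB' sub
      by (auto simp: G'_def intro!: is_subringD(5)[OF sub] is_subring_power)
    thus "x \<in> B'" unfolding s(1) using s(2) G(2) BB'
      by (intro is_subring_sum[OF sub] is_subringD(5)[OF sub]) auto
  qed
  ultimately have "finite_ext S B'"
    unfolding finite_ext_def using sub fG' G(2) BB' by blast
  thus ?thesis using BB' bB' by blast
qed

lemma det_in_subring:
  assumes "is_subring S" "A \<in> carrier_mat n n" "\<And>i j. i < n \<Longrightarrow> j < n \<Longrightarrow> A $$ (i, j) \<in> S"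
  shows "det A \<in> S"
proof -
  have "of_int z \<in> S" for z :: int
  proof -
    have "of_nat k \<in> S" for k by (induction k) (auto simp: is_subringD[OF assms(1)])
    thus ?thesis by (cases z rule: int_diff_cases) (auto simp: is_subringD[OF assms(1)])
  qed
  hence s: "signof p \<in> S" for p :: "nat \<Rightarrow> nat" by (simp add: sign_def is_subringD[OF assms(1)])
  show ?thesis
    unfolding det_def'[OF assms(2)]
    by (intro is_subring_sum[OF assms(1)] is_subringD(5)[OF assms(1)] s is_subring_prod[OF assms(1)] assms(3))
      (auto simp: permutes_in_image)
qed

text \<open>The determinant trick: multiplication by \<open>b\<close> acts on the module generators
  through a matrix \<open>A\<close> over \<open>S\<close>, so \<open>b\<close> times the identity
  minus \<open>A\<close> annihilates the vector of generators. Multiplying by the adjugate shows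
  that its determinant annihilates every generator; the characteristic polynomial of
  \<open>A\<close> is the monic equation sought.\<close>

lemma integral_of_finite_ext:
  fixes b :: "'r::idom"
  assumes S: "is_subring S" and B: "finite_ext S B" and b: "b \<in> B"
  shows "integral_over S b"
proof -
  from B obtain G where G: "is_subring B" "S \<subseteq> B" "finite G" "B = lin_span S G" by (auto simp: finite_ext_def)
  define t where "t = card G"
  from ex_bij_betw_nat_finite[OF G(3)] obtain h where h: "bij_betw h {0..<t} G" by (auto simp: t_def)
  have ex: "\<exists>s. (\<forall>j. s j \<in> S) \<and> x = (\<Sum>j = 0..<t. s j * h j)" if x: "x \<in> B" for x
  proof -
    from x obtain s where s: "x = (\<Sum>g\<in>G. s g * g)" "\<forall>g. s g \<in> S" by (auto simp: G(4) lin_span_def)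
    show ?thesis
      using s by (intro exI[of _ "\<lambda>j. s (h j)"]) (auto simp: sum.reindex_bij_betw[OF h, of "\<lambda>g. s g * g"])
  qed
  have "h i \<in> B" if "i < t" for i
    using lin_span_base[OF S G(3)] G(4) bij_betwE[OF h] that by auto
  hence "\<forall>i. \<exists>s. i < t \<longrightarrow> (\<forall>j. s j \<in> S) \<and> b * h i = (\<Sum>j = 0..<t. s j * h j)"
    using ex is_subringD(5)[OF G(1) b] by blast
  then obtain a where a: "\<And>i j. i < t \<Longrightarrow> a i j \<in> S" "\<And>i. i < t \<Longrightarrow> b * h i = (\<Sum>j = 0..<t. a i j * h j)"
    by metis
  define A where "A = mat t t (\<lambda>(i, j). a i j)"
  have A: "A \<in> carrier_mat t t" by (simp add: A_def)
  define D where "D = map_mat (\<lambda>p. poly p b) (char_poly_matrix A)"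
  have D: "D \<in> carrier_mat t t" by (simp add: D_def char_poly_matrix_def A_def)
  have Dij: "D $$ (i, j) = (if i = j then b else 0) - a i j" if "i < t" "j < t" for i j
    using that by (simp add: D_def char_poly_matrix_def A_def)
  have det: "poly (char_poly A) b = det D"
    unfolding char_poly_def D_def by (rule comm_ring_hom.hom_det[OF comm_ring_hom_poly, symmetric])
  define v where "v = vec t h"
  have v: "v \<in> carrier_vec t" by (simp add: v_def)
  have Dv: "D *\<^sub>v v = 0\<^sub>v t"
  proof (rule eq_vecI)
    fix i assume i: "i < dim_vec (0\<^sub>v t :: 'r vec)"
    have "(D *\<^sub>v v) $ i = (\<Sum>j = 0..<t. ((if i = j then b else 0) - a i j) * h j)"
      using i D by (simp add: scalar_prod_def v_def Dij)
    also have "\<dots> = (\<Sum>j = 0..<t. (if i = j then b * h j else 0)) - (\<Sum>j = 0..<t. a i j * h j)"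
      unfolding sum_subtractf[symmetric] by (intro sum.cong) (auto simp: algebra_simps)
    also have "\<dots> = 0" using i a(2)[of i] by simp
    finally show "(D *\<^sub>v v) $ i = 0\<^sub>v t $ i" using i by simp
  qed (use D in auto)
  have "det D \<cdot>\<^sub>v v = (adj_mat D * D) *\<^sub>v v"
    unfolding adj_mat(3)[OF D]
  proof (rule eq_vecI)
    fix i assume i: "i < dim_vec (det D \<cdot>\<^sub>m 1\<^sub>m t *\<^sub>v v)"
    have "(\<Sum>j = 0..<t. det D * (if j = i then 1 else 0) * v $ j) = (\<Sum>j = 0..<t. if j = i then det D * v $ j else 0)"
      by (intro sum.cong) auto
    also have "\<dots> = det D * v $ i" using i by simp
    finally show "(det D \<cdot>\<^sub>v v) $ i = (det D \<cdot>\<^sub>m 1\<^sub>m t *\<^sub>v v) $ i" using i v by (simp add: scalar_prod_def)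
  qed (use v in auto)
  also have "\<dots> = 0\<^sub>v t"
    using adj_mat(1)[OF D] D v Dv by (auto simp: assoc_mult_mat_vec intro!: eq_vecI)
  finally have dv: "det D \<cdot>\<^sub>v v = 0\<^sub>v t" .
  have z: "det D * h i = 0" if "i < t" for i
    using arg_cong[OF dv, of "\<lambda>u. vec_index u i"] that by (simp add: v_def)
  \<comment> \<open>Since 1 is itself a combination of the generators, a scalar that annihilates all
    of them is zero.\<close>
  from ex[OF is_subringD(1)[OF G(1)]] obtain s where s: "1 = (\<Sum>j = 0..<t. s j * h j)" by blast
  have "det D = det D * (\<Sum>j = 0..<t. s j * h j)" using s by simp
  also have "\<dots> = (\<Sum>j = 0..<t. s j * (det D * h j))" by (simp add: sum_distrib_left ac_simps)
  also have "\<dots> = 0" using z by (intro sum.neutral ballI) (simp only: atLeastLessThan_iff mult_zero_right)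
  finally have "poly (char_poly A) b = 0" using det by simp
  moreover have "lead_coeff (char_poly A) = 1"
    using degree_monic_char_poly[OF A] by simp
  moreover have "coeffs_in S (char_poly A)"
  proof -
    have "char_poly_matrix A $$ (i, j) \<in> {p. coeffs_in S p}" if "i < t" "j < t" for i j
    proof -
      have "char_poly_matrix A $$ (i, j) = (if i = j then monom 1 1 else 0) + [:- a i j:]"
        using that by (simp add: char_poly_matrix_def A_def monom_Suc monom_0)
      also have "\<dots> \<in> {p. coeffs_in S p}"
        using S a(1) that by (auto intro!: coeffs_inD(1) coeffs_in_monom coeffs_in_const coeffs_in_0 is_subringD(6) is_subringD(1))
      finally show ?thesis .
    qed
    hence "det (char_poly_matrix A) \<in> {p. coeffs_in S p}"
      by (intro det_in_subring[OF is_subring_coeffs_in[OF S], of _ t]) (auto simp: A)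
    thus ?thesis by (simp add: char_poly_def)
  qed
  ultimately show ?thesis unfolding integral_over_def by blast
qed

section \<open>Monomial orders and complete integral closedness\<close>

text \<open>Monomials are compared by weight first; ties are broken by the integer
  \<open>\<Prod>p\<^sub>v ^ \<alpha>\<^sub>v\<close> with distinct primes \<open>p\<^sub>v\<close>, which makes the order total, additive and well-founded.\<close>

definition monom_key :: "(nat \<Rightarrow> nat) \<Rightarrow> (nat \<Rightarrow>\<^sub>0 nat) \<Rightarrow> nat \<times> nat" where
  "monom_key w \<alpha> = (wdeg w \<alpha>, monom_eval (enumerate {p. prime p}) \<alpha>)"

definition is_lead_monom :: "(nat \<Rightarrow> nat) \<Rightarrow> (nat, 'a::zero) mpolynomial \<Rightarrow> (nat \<Rightarrow>\<^sub>0 nat) \<Rightarrow> bool" where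
  "is_lead_monom w p m \<longleftrightarrow> m \<in> keys p \<and> (\<forall>m'\<in>keys p. m' \<noteq> m \<longrightarrow> monom_key w m' < monom_key w m)"

lemma prime_enum: "prime (enumerate {p::nat. prime p} v)"
  using enumerate_in_set[OF primes_infinite] by blast

lemma inj_enum: "inj (enumerate {p::nat. prime p})"
  using strict_mono_enumerate[OF primes_infinite] strict_mono_imp_inj_on by blast

lemma monom_eval_enum_pos: "monom_eval (enumerate {p::nat. prime p}) \<alpha> > 0"
  unfolding monom_eval_def by (intro prod_pos) (auto simp: prime_gt_0_nat[OF prime_enum])

text \<open>Unique factorization of integers: the exponent of a variable is the multiplicity of its
  prime.\<close>

lemma monom_eval_enum_inj: "monom_eval (enumerate {p::nat. prime p}) \<alpha> = monom_eval (enumerate {p::nat. prime p}) \<beta> \<Longrightarrow> \<alpha> = \<beta>"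
proof (rule poly_mapping_eqI)
  fix v assume eq: "monom_eval (enumerate {p::nat. prime p}) \<alpha> = monom_eval (enumerate {p::nat. prime p}) \<beta>"
  let ?e = "enumerate {p::nat. prime p}"
  have "multiplicity (?e v) (monom_eval ?e \<gamma>) = lookup \<gamma> v" for \<gamma>
  proof -
    let ?K = "keys \<gamma>"
    have "monom_eval ?e \<gamma> = (\<Prod>p\<in>?e ` ?K. p ^ lookup \<gamma> (inv_into UNIV ?e p))"
      unfolding monom_eval_def by (subst prod.reindex) (auto intro: inj_on_subset[OF inj_enum] simp: inv_f_f[OF inj_enum])
    also have "multiplicity (?e v) \<dots> = (if ?e v \<in> ?e ` ?K then lookup \<gamma> (inv_into UNIV ?e (?e v)) else 0)"
      by (rule multiplicity_prod_prime_powers) (auto simp: prime_enum)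
    also have "\<dots> = lookup \<gamma> v"
      using inj_enum by (auto simp: inv_f_f inj_image_mem_iff in_keys_iff)
    finally show ?thesis .
  qed
  thus "lookup \<alpha> v = lookup \<beta> v" using eq by metis
qed

lemma monom_key_inj: "monom_key w \<alpha> = monom_key w \<beta> \<Longrightarrow> \<alpha> = \<beta>"
  by (auto simp: monom_key_def dest: monom_eval_enum_inj)

lemma monom_key_add_mono: "monom_key w \<alpha> < monom_key w \<beta> \<Longrightarrow> monom_key w (\<alpha> + \<gamma>) < monom_key w (\<beta> + \<gamma>)"
  using monom_eval_enum_pos[of \<gamma>] by (auto simp: monom_key_def less_prod_def wdeg_add monom_eval_add)

lemma monom_key_add_less:
  assumes "monom_key w \<alpha> \<le> monom_key w \<alpha>'" "monom_key w \<beta> \<le> monom_key w \<beta>'" "\<alpha> \<noteq> \<alpha>' \<or> \<beta> \<noteq> \<beta>'"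
  shows "monom_key w (\<alpha> + \<beta>) < monom_key w (\<alpha>' + \<beta>')"
proof -
  have a: "\<alpha> = \<alpha>' \<or> monom_key w \<alpha> < monom_key w \<alpha>'" and b: "\<beta> = \<beta>' \<or> monom_key w \<beta> < monom_key w \<beta>'"
    using assms(1,2) monom_key_inj le_neq_trans by metis+
  have 1: "monom_key w (\<alpha> + \<beta>) < monom_key w (\<alpha>' + \<beta>)" if "\<alpha> \<noteq> \<alpha>'"
    using a that monom_key_add_mono by blast
  have 2: "monom_key w (\<alpha>' + \<beta>) < monom_key w (\<alpha>' + \<beta>')" if "\<beta> \<noteq> \<beta>'"
    using b that monom_key_add_mono[of w \<beta> \<beta>' \<alpha>'] by (simp add: add.commute)
  show ?thesis
    using 1 2 assms(3) less_trans[OF 1 2] by (cases "\<alpha> = \<alpha>'"; cases "\<beta> = \<beta>'") simp_all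
qed

lemma finite_arg_max:
  fixes f :: "'a \<Rightarrow> 'b::linorder"
  assumes "finite K" "K \<noteq> {}"
  shows "\<exists>x\<in>K. \<forall>y\<in>K. f y \<le> f x"
proof -
  have "Max (f ` K) \<in> f ` K" using assms by (intro Max_in) auto
  then obtain x where "x \<in> K" "f x = Max (f ` K)" by auto
  thus ?thesis using assms by (intro bexI[of _ x]) auto
qed

lemma is_lead_monom_exists:
  assumes "p \<noteq> 0"
  shows "\<exists>m. is_lead_monom w p m"
proof -
  obtain m where "m \<in> keys p" "\<forall>m'\<in>keys p. monom_key w m' \<le> monom_key w m"
    using finite_arg_max[of "keys p" "monom_key w"] assms by auto
  thus ?thesis unfolding is_lead_monom_def using monom_key_inj le_neq_trans by metis
qed

lemma lookup_mult_sum: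
  "lookup (p * q) k = (\<Sum>m\<in>keys p. \<Sum>m'\<in>keys q.
     (if m + m' = k then lookup p m * lookup q m' else 0))"
proof -
  have "p * q = (\<Sum>m\<in>keys p. single m (lookup p m)) *
                (\<Sum>m\<in>keys q. single m (lookup q m))"
    using poly_mapping_decomp[of p] poly_mapping_decomp[of q] by simp
  also have "\<dots> = (\<Sum>m\<in>keys p. \<Sum>m'\<in>keys q.
      single (m + m') (lookup p m * lookup q m'))"
    by (simp add: sum_product mult_single)
  finally show ?thesis by (simp add: lookup_sum lookup_single when_def)
qed

lemma is_lead_monom_mult:
  fixes p q :: "(nat, 'a::idom) mpolynomial"
  assumes "is_lead_monom w p a" "is_lead_monom w q b"
  shows "is_lead_monom w (p * q) (a + b)" "lookup (p * q) (a + b) = lookup p a * lookup q b"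
proof -
  have le: "monom_key w m \<le> monom_key w a" if "m \<in> keys p" for m
    using assms(1) that by (auto simp: is_lead_monom_def)
  have le': "monom_key w m \<le> monom_key w b" if "m \<in> keys q" for m
    using assms(2) that by (auto simp: is_lead_monom_def)
  have ab: "a \<in> keys p" "b \<in> keys q" using assms by (auto simp: is_lead_monom_def)
  have uniq: "m = a \<and> m' = b" if "m \<in> keys p" "m' \<in> keys q" "m + m' = a + b" for m m'
    using monom_key_add_less[OF le[OF that(1)] le'[OF that(2)]] that(3) by force
  have "lookup (p * q) (a + b) = (\<Sum>m\<in>keys p. \<Sum>m'\<in>keys q.
     (if m = a \<and> m' = b then lookup p m * lookup q m' else 0))"
    unfolding lookup_mult_sum using uniq by (intro sum.cong refl) auto
  also have "\<dots> = (\<Sum>m\<in>keys p. if m = a then lookup p a * lookup q b else 0)"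
    using ab by (intro sum.cong refl) auto
  also have "\<dots> = lookup p a * lookup q b"
    using ab by simp
  finally show l: "lookup (p * q) (a + b) = lookup p a * lookup q b" .
  have "a + b \<in> keys (p * q)" using l ab by (simp add: in_keys_iff)
  moreover have "monom_key w k < monom_key w (a + b)" if k: "k \<in> keys (p * q)" "k \<noteq> a + b" for k
  proof -
    from k(1) obtain m m' where "m \<in> keys p" "m' \<in> keys q" "k = m + m'"
      using Poly_Mapping.keys_mult[of p q] by blast
    thus ?thesis using monom_key_add_less[OF le le', of m m'] k(2) by blast
  qed
  ultimately show "is_lead_monom w (p * q) (a + b)" by (auto simp: is_lead_monom_def)
qed

lemma is_lead_monom_1: "is_lead_monom w (1 :: (nat, 'a::idom) mpolynomial) 0"
  by (simp add: is_lead_monom_def)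

lemma is_lead_monom_power:
  fixes p :: "(nat, 'a::idom) mpolynomial"
  assumes "is_lead_monom w p a"
  shows "\<exists>b. is_lead_monom w (p ^ j) b \<and> (\<forall>v. lookup b v = j * lookup a v)"
proof (induction j)
  case 0
  show ?case using is_lead_monom_1[of w] by (intro exI[of _ 0]) simp
next
  case (Suc j)
  then obtain b where "is_lead_monom w (p ^ j) b" "\<forall>v. lookup b v = j * lookup a v" by blast
  thus ?case using is_lead_monom_mult(1)[OF assms] by (intro exI[of _ "a + b"]) (auto simp: lookup_add)
qed

lemma is_lead_monom_unique: "is_lead_monom w p a \<Longrightarrow> is_lead_monom w p b \<Longrightarrow> a = b"
  unfolding is_lead_monom_def by (metis less_asym)

text \<open>Polynomial rings are completely integrally closed: if all powers of \<open>a / b\<close> have the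
  common denominator \<open>c\<close>, the leading monomial of \<open>b\<close> divides that of \<open>a\<close>, and the quotient of
  the leading terms can be subtracted from \<open>a / b\<close> without affecting the hypothesis.\<close>

lemma completely_integrally_closed:
  fixes a b c :: "'k::field mp"
  assumes "b \<noteq> 0" "c \<noteq> 0" "\<And>j. b ^ j dvd c * a ^ j"
  shows "b dvd a"
proof -
  \<comment> \<open>Weight 0 leaves the comparison to the prime encoding alone, which supplies a
    well-founded order to induct on.\<close>
  define w :: "nat \<Rightarrow> nat" where "w = (\<lambda>_. 0)"
  obtain \<beta> \<gamma> where \<beta>: "is_lead_monom w b \<beta>" and \<gamma>: "is_lead_monom w c \<gamma>" using is_lead_monom_exists assms(1,2) by metis
  have main: "b dvd a" if "a \<noteq> 0" "is_lead_monom w a \<alpha>" "\<And>j. b ^ j dvd c * a ^ j" for a \<alpha>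
    using that
  proof (induction "monom_key w \<alpha>" arbitrary: a \<alpha> rule: less_induct)
    case less
    have le: "lookup \<beta> v \<le> lookup \<alpha> v" for v
    proof -
      \<comment> \<open>Comparing exponents of \<open>v\<close> gives \<open>j * \<beta>\<^sub>v
        \<le> \<gamma>\<^sub>v + j * \<alpha>\<^sub>v\<close>; with \<open>j\<close> larger than
        \<open>\<gamma>\<^sub>v\<close> the excess of \<open>\<beta>\<^sub>v\<close> over
        \<open>\<alpha>\<^sub>v\<close> is less than 1.\<close>
      define j where "j = Suc (lookup \<gamma> v)"
      obtain d where d: "c * a ^ j = b ^ j * d" using less.prems(3)[of j] by (auto elim: dvdE)
      have "d \<noteq> 0" using d assms(2) less.prems(1) by auto
      then obtain \<delta> where \<delta>: "is_lead_monom w d \<delta>" using is_lead_monom_exists by blast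
      obtain \<alpha>j where \<alpha>j: "is_lead_monom w (a ^ j) \<alpha>j" "\<forall>v. lookup \<alpha>j v = j * lookup \<alpha> v"
        using is_lead_monom_power[OF less.prems(2)] by blast
      obtain \<beta>j where \<beta>j: "is_lead_monom w (b ^ j) \<beta>j" "\<forall>v. lookup \<beta>j v = j * lookup \<beta> v"
        using is_lead_monom_power[OF \<beta>] by blast
      have "\<gamma> + \<alpha>j = \<beta>j + \<delta>"
        using is_lead_monom_mult(1)[OF \<gamma> \<alpha>j(1)] is_lead_monom_mult(1)[OF \<beta>j(1) \<delta>] d is_lead_monom_unique by metis
      hence "lookup \<gamma> v + j * lookup \<alpha> v = j * lookup \<beta> v + lookup \<delta> v"
        using \<alpha>j(2) \<beta>j(2) by (metis lookup_add)
      hence *: "j * lookup \<beta> v < j * (lookup \<alpha> v + 1)" by (simp add: j_def)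
      have "lookup \<beta> v < lookup \<alpha> v + 1" using * mult_less_cancel1 by blast
      thus ?thesis by simp
    qed
    define \<mu> where "\<mu> = \<alpha> - \<beta>"
    have \<alpha>: "\<alpha> = \<mu> + \<beta>" by (rule poly_mapping_eqI) (simp add: \<mu>_def lookup_add lookup_minus le)
    define t where "t = single \<mu> (lookup a \<alpha> / lookup b \<beta>)"
    have nz: "lookup a \<alpha> \<noteq> 0" "lookup b \<beta> \<noteq> 0"
      using less.prems(2) \<beta> by (auto simp: is_lead_monom_def in_keys_iff)
    have t: "is_lead_monom w t \<mu>" using nz by (auto simp: is_lead_monom_def t_def)
    note tb = is_lead_monom_mult[OF t \<beta>, folded \<alpha>]
    define a' where "a' = a - t * b"
    have "lookup (t * b) \<alpha> = lookup a \<alpha>" using tb(2) nz by (simp add: t_def)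
    hence a'\<alpha>: "\<alpha> \<notin> keys a'" by (simp add: a'_def in_keys_iff lookup_minus)
    have smaller: "monom_key w k < monom_key w \<alpha>" if "k \<in> keys a'" for k
    proof -
      have "k \<noteq> \<alpha>" using a'\<alpha> that by auto
      moreover have "k \<in> keys a \<or> k \<in> keys (t * b)"
        using that by (auto simp: a'_def in_keys_iff lookup_minus)
      ultimately show ?thesis using less.prems(2) tb(1) by (auto simp: is_lead_monom_def)
    qed
    \<comment> \<open>In the binomial expansion of \<open>(a - t * b) ^ j\<close> the hypothesis
      supplies \<open>b ^ k\<close> from \<open>c * a ^ k\<close>, and the other factor brings
      \<open>b ^ (j - k)\<close> with it.\<close>
    have dv: "b ^ j dvd c * a' ^ j" for j
    proof -
      have "c * a' ^ j = c * (a + (- t * b)) ^ j" by (simp add: a'_def)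
      also have "\<dots> = (\<Sum>k\<le>j. c * (of_nat (j choose k) * a ^ k * (- t * b) ^ (j - k)))"
        by (simp only: binomial_ring sum_distrib_left)
      also have "b ^ j dvd \<dots>"
      proof (rule dvd_sum)
        fix k assume "k \<in> {..j}"
        hence "b ^ j = b ^ k * b ^ (j - k)" by (simp flip: power_add)
        also have "\<dots> dvd (c * a ^ k) * (- t * b) ^ (j - k)"
          by (intro mult_dvd_mono less.prems(3) dvd_power_same) simp
        finally have "b ^ j dvd of_nat (j choose k) * ((c * a ^ k) * (- t * b) ^ (j - k))" by (rule dvd_mult)
        thus "b ^ j dvd c * (of_nat (j choose k) * a ^ k * (- t * b) ^ (j - k))" by (simp only: ac_simps)
      qed
      finally show ?thesis .
    qed
    have "b dvd a'"
    proof (cases "a' = 0")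
      case False
      then obtain \<alpha>' where \<alpha>': "is_lead_monom w a' \<alpha>'" using is_lead_monom_exists by blast
      hence "monom_key w \<alpha>' < monom_key w \<alpha>" using smaller by (auto simp: is_lead_monom_def)
      from less.hyps[OF this False \<alpha>' dv] show ?thesis .
    qed simp
    hence "b dvd a' + t * b" by simp
    thus ?case by (simp add: a'_def)
  qed
  show ?thesis
  proof (cases "a = 0")
    case False
    with main is_lead_monom_exists[of a w] assms(3) show ?thesis by blast
  qed simp
qed

section \<open>Gauss's lemma for monic factors through integrality\<close>

lemma finite_ext_adjoin_finite:
  fixes W :: "'r::idom set"
  assumes "is_subring S" "finite W" "\<And>x. x \<in> W \<Longrightarrow> integral_over S x"
  shows "\<exists>B. finite_ext S B \<and> W \<subseteq> B"
  using assms(2,3)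
proof (induction W rule: finite_induct)
  case empty
  thus ?case using finite_ext_refl[OF assms(1)] by blast
next
  case (insert x F)
  then obtain B where B: "finite_ext S B" "F \<subseteq> B" by blast
  have "integral_over B x" using insert.prems B(1) integral_over_mono by (metis finite_ext_def insertI1)
  from finite_ext_adjoin[OF assms(1) B(1) this] show ?case using B(2) by blast
qed

lemma comm_ring_hom_to_ac: "comm_ring_hom (\<lambda>a::'a::idom. to_ac (to_fract a))"
  by unfold_locales auto

text \<open>Gauss's lemma without unique factorization: the coefficients of a monic factor are
  integral, hence have bounded denominators in all powers.\<close>

lemma monic_factor:
  fixes Q M A :: "'k::field mp poly"
  assumes M: "lead_coeff M = 1" and c: "c \<noteq> 0" and eq: "smult c M = Q * A"
  shows "\<exists>P. Q = smult (lead_coeff Q) P"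
proof -
  define \<iota> where "\<iota> = (\<lambda>a::'k mp. to_ac (to_fract a))"
  interpret \<iota>: comm_ring_hom \<iota> unfolding \<iota>_def by (rule comm_ring_hom_to_ac)
  have inj: "\<iota> a = \<iota> b \<longleftrightarrow> a = b" for a b by (simp add: \<iota>_def)
  have \<iota>0: "\<iota> a = 0 \<longleftrightarrow> a = 0" for a using inj[of a 0] by simp
  interpret mp: comm_ring_hom "map_poly \<iota>" by (rule comm_ring_hom_map_poly) unfold_locales
  define S where "S = range \<iota>"
  have S: "is_subring S" unfolding is_subring_def
  proof (intro conjI ballI)
    have "\<iota> 1 \<in> S" unfolding S_def by (rule rangeI)
    thus "1 \<in> S" by simp
    fix x y assume "x \<in> S" "y \<in> S"
    then obtain a b where ab: "x = \<iota> a" "y = \<iota> b" by (auto simp: S_def)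
    have "x - y = \<iota> (a - b)" "x * y = \<iota> (a * b)" by (simp_all add: ab \<iota>.hom_minus \<iota>.hom_mult)
    thus "x - y \<in> S" "x * y \<in> S" unfolding S_def by auto
  qed
  define q where "q = lead_coeff Q"
  have Q0: "Q \<noteq> 0" using eq c M by auto
  hence q0: "q \<noteq> 0" by (simp add: q_def)
  define H where "H = map_poly \<iota> Q"
  have H: "lead_coeff H = \<iota> q" "degree H = degree Q" "H \<noteq> 0"
  proof -
    show 1: "degree H = degree Q" unfolding H_def by (rule degree_map_poly) (simp add: \<iota>0)
    show "lead_coeff H = \<iota> q" unfolding 1 q_def by (simp add: H_def coeff_map_poly)
    hence "lead_coeff H \<noteq> 0" using q0 \<iota>0[of q] by simp
    thus "H \<noteq> 0" by force
  qed
  \<comment> \<open>\<open>W\<close> holds the roots of \<open>Q\<close> in an algebraic closure of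
    the fraction field. They are also roots of the monic \<open>M\<close>, hence integral.\<close>
  obtain W where W: "H = smult (\<iota> q) (\<Prod>x\<in>#W. [:- x, 1:])"
    using alg_closed_imp_factorization[OF H(3)] H(1) by auto
  have root: "integral_over S x" if "x \<in># W" for x
  proof -
    have "[:- x, 1:] dvd H" unfolding W using that by (intro dvd_smult) (auto intro: dvd_prod_mset)
    hence "poly H x = 0" by (simp add: poly_eq_0_iff_dvd)
    moreover have "smult (\<iota> c) (map_poly \<iota> M) = H * map_poly \<iota> A"
    proof -
      have "map_poly \<iota> (smult c M) = smult (\<iota> c) (map_poly \<iota> M)"
        by (intro poly_eqI) (simp add: coeff_map_poly \<iota>.hom_mult)
      thus ?thesis using arg_cong[OF eq, of "map_poly \<iota>"] by (simp add: mp.hom_mult H_def)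
    qed
    ultimately have "poly (smult (\<iota> c) (map_poly \<iota> M)) x = 0" by simp
    hence "\<iota> c * poly (map_poly \<iota> M) x = 0" by (simp only: poly_smult)
    moreover have "\<iota> c \<noteq> 0" using c \<iota>0[of c] by blast
    ultimately have "poly (map_poly \<iota> M) x = 0" by (metis mult_eq_0_iff)
    moreover have dM: "degree (map_poly \<iota> M) = degree M" by (rule degree_map_poly) (simp add: \<iota>0)
    have "lead_coeff (map_poly \<iota> M) = 1" unfolding dM using M by (simp add: coeff_map_poly)
    moreover have "coeffs_in S (map_poly \<iota> M)" by (auto simp: coeffs_in_def coeff_map_poly S_def)
    ultimately show ?thesis unfolding integral_over_def by blast
  qed
  obtain B where B: "finite_ext S B" "set_mset W \<subseteq> B"
    using finite_ext_adjoin_finite[OF S, of "set_mset W"] root by auto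
  have Bs: "is_subring B" using B(1) by (simp add: finite_ext_def)
  define H' where "H' = (\<Prod>x\<in>#W. [:- x, 1:])"
  have "coeffs_in B (\<Prod>x\<in>#V. [:- x, 1:])" if "set_mset V \<subseteq> B" for V
    using that
  proof (induction V)
    case empty
    show ?case using coeffs_in_const[OF Bs is_subringD(1)[OF Bs]] by (simp add: one_pCons)
  next
    case (add x V)
    have "[:- x, 1:] = monom 1 1 + [:- x:]" by (simp add: monom_Suc monom_0)
    hence "coeffs_in B [:- x, 1:]"
      using add.prems Bs coeffs_inD(1)[OF Bs coeffs_in_monom[OF Bs is_subringD(1)[OF Bs], of 1] coeffs_in_const[OF Bs is_subringD(6)[OF Bs]]] by auto
    from coeffs_inD(3)[OF Bs this add.IH] add.prems show ?case
      by (simp only: image_mset_add_mset prod_mset.add_mset) auto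
  qed
  hence H'B: "coeffs_in B H'" using B(2) by (simp add: H'_def)
  have dvd: "q dvd coeff Q i" for i
  proof -
    define x where "x = coeff H' i"
    define u where "u = coeff Q i"
    have ux: "\<iota> u = \<iota> q * x"
      using arg_cong[OF W, of "\<lambda>p. coeff p i"] by (simp add: H_def coeff_map_poly x_def H'_def u_def)
    have "integral_over S x" unfolding x_def
      using integral_of_finite_ext[OF S B(1)] H'B by (auto simp: coeffs_in_def)
    then obtain p where p: "coeffs_in S p" "lead_coeff p = 1" "poly p x = 0" by (auto simp: integral_over_def)
    define t where "t = degree p"
    have pt: "x ^ t = - (\<Sum>k<t. coeff p k * x ^ k)"
    proof -
      have "0 = (\<Sum>k\<le>t. coeff p k * x ^ k)" using p(3) by (simp add: poly_altdef t_def)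
      also have "\<dots> = (\<Sum>k<t. coeff p k * x ^ k) + x ^ t"
        using p(2) by (simp add: t_def lessThan_Suc_atMost[symmetric])
      finally show ?thesis by (simp add: eq_neg_iff_add_eq_0 add.commute)
    qed
    \<comment> \<open>Up to exponent \<open>t\<close> the factor \<open>q ^ t\<close> clears the
      denominators, because \<open>q * x\<close> comes from a coefficient of \<open>Q\<close>.
      Higher powers are reduced by the monic equation of \<open>x\<close>, so the same denominator
      serves all of them.\<close>
    have bd: "\<iota> q ^ t * x ^ j \<in> S" for j
    proof (induction j rule: less_induct)
      case (less j)
      show ?case
      proof (cases "j \<le> t")
        case True
        hence "\<iota> q ^ t * x ^ j = \<iota> q ^ (t - j) * (\<iota> q * x) ^ j"
          by (simp add: power_mult_distrib mult.assoc[symmetric] flip: power_add)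
        also have "\<dots> = \<iota> (q ^ (t - j) * u ^ j)" by (simp add: ux \<iota>.hom_mult \<iota>.hom_power)
        finally show ?thesis by (simp add: S_def)
      next
        case False
        hence "x ^ j = x ^ (j - t) * x ^ t" by (simp flip: power_add)
        hence "\<iota> q ^ t * x ^ j = - (\<Sum>k<t. coeff p k * (\<iota> q ^ t * x ^ (j - t + k)))"
          by (simp add: pt sum_distrib_left power_add ac_simps)
        also have "\<dots> \<in> S"
        proof (intro is_subringD(6)[OF S] is_subring_sum[OF S])
          fix k assume "k \<in> {..<t}"
          hence "\<iota> q ^ t * x ^ (j - t + k) \<in> S" using False by (intro less.IH) auto
          moreover have "coeff p k \<in> S" using p(1) by (simp add: coeffs_in_def)
          ultimately show "coeff p k * (\<iota> q ^ t * x ^ (j - t + k)) \<in> S"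
            using is_subringD(5)[OF S] by blast
        qed
        finally show ?thesis .
      qed
    qed
    have "q ^ j dvd q ^ t * coeff Q i ^ j" for j
    proof -
      obtain s where s: "\<iota> q ^ t * x ^ j = \<iota> s" using bd[of j] by (auto simp: S_def)
      have "\<iota> (q ^ t * u ^ j) = \<iota> q ^ j * (\<iota> q ^ t * x ^ j)"
        by (simp add: \<iota>.hom_mult \<iota>.hom_power ux power_mult_distrib ac_simps)
      also have "\<dots> = \<iota> (q ^ j * s)" by (simp add: s \<iota>.hom_mult \<iota>.hom_power)
      finally show ?thesis by (simp add: inj u_def)
    qed
    thus ?thesis using completely_integrally_closed[OF q0, of "q ^ t"] q0 by simp
  qed
  hence "[:q:] dvd Q" by (simp add: const_poly_dvd_iff)
  then obtain P where "Q = [:q:] * P" by (elim dvdE)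
  thus ?thesis by (auto simp: q_def)
qed

section \<open>Linear changes of variables\<close>

lemma comm_ring_hom_zero: "comm_ring_hom h \<Longrightarrow> h 0 = 0"
proof -
  assume "comm_ring_hom h"
  then interpret comm_ring_hom h .
  show ?thesis by simp
qed

lemma comm_ring_hom_sum: "comm_ring_hom h \<Longrightarrow> h (sum f A) = (\<Sum>i\<in>A. h (f i))"
proof -
  assume "comm_ring_hom h"
  then interpret comm_ring_hom h .
  show ?thesis by (rule hom_sum)
qed

text \<open>Over a finite field, 1 plus the product of all X - a would have positive degree and no
  root.\<close>

lemma infinite_UNIV_alg_closed: "infinite (UNIV :: 'k::alg_closed_field set)"
proof
  assume fin: "finite (UNIV :: 'k set)"
  define p :: "'k poly" where "p = (\<Prod>a\<in>UNIV. [:- a, 1:])"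
  have dp: "degree p = card (UNIV :: 'k set)"
    unfolding p_def using fin by (simp add: degree_prod_eq_sum_degree)
  hence "degree (p + 1) > 0" using fin finite_UNIV_card_ge_0[where 'a = 'k] by (simp add: degree_add_eq_left)
  then obtain x where x: "poly (p + 1) x = 0" using alg_closed_imp_poly_has_root by blast
  have "poly p x = (\<Prod>a\<in>UNIV. x - a)" by (simp add: p_def poly_prod)
  also have "\<dots> = 0" using fin by (intro prod_zero) auto
  finally have "poly p x = 0" .
  thus False using x by simp
qed

lemma poly_nonzero_at:
  fixes p :: "'k::alg_closed_field poly"
  assumes "p \<noteq> 0"
  shows "\<exists>t. poly p t \<noteq> 0"
  using poly_roots_finite[OF assms] infinite_UNIV_alg_closed by (metis (mono_tags, lifting) Collect_cong UNIV_def)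

lemma mp_eval_hom: "comm_ring_hom (mp_eval a :: 'k::field mp \<Rightarrow> 'k)"
  unfolding mp_eval_def[abs_def] by (rule kalg.subst_hom[OF kalg_id])

lemma mp_eval_const [simp]: "mp_eval a (mp_const c) = (c :: 'k::field)"
  by (simp add: mp_eval_def kalg.subst_const[OF kalg_id])

lemma mp_eval_mvar [simp]: "mp_eval a (mvar v) = (a v :: 'k::field)"
  by (simp add: mp_eval_def kalg.subst_mvar[OF kalg_id])

lemma mp_eval_cong: "(\<And>v. v \<in> mp_vars p \<Longrightarrow> a v = b v) \<Longrightarrow> mp_eval a p = mp_eval b (p :: 'k::field mp)"
  unfolding mp_eval_def by (rule kalg.subst_cong[OF kalg_id])

text \<open>The coordinate change x_v := x_v + c_v x_l for v other than l, with x_l split off as the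
  main variable, so that being monic in x_l is a statement about \<open>lead_coeff\<close>.\<close>

definition shear :: "nat \<Rightarrow> (nat \<Rightarrow> 'k) \<Rightarrow> 'k::field mp \<Rightarrow> 'k mp poly" where
  "shear l c = mp_subst pconst (\<lambda>v. if v = l then [:0, 1:] else [:mvar v, mp_const (c v):])"

lemma shear_hom: "comm_ring_hom (shear l c)"
  unfolding shear_def by (rule kalg.subst_hom[OF kalg_pconst])

lemma shear_const [simp]: "shear l c (mp_const a) = [:mp_const a:]"
  by (simp add: shear_def kalg.subst_const[OF kalg_pconst])

lemma shear_mvar: "shear l c (mvar v) = (if v = l then [:0, 1:] else [:mvar v, mp_const (c v):])"
  by (simp add: shear_def kalg.subst_mvar[OF kalg_pconst])

lemma coeffs_in_shear:
  assumes "p \<in> polysV V"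
  shows "coeffs_in (polysV (V - {l})) (shear l c p)"
proof -
  let ?S = "polysV (V - {l}) :: 'a mp set"
  have S: "is_subring ?S" by (rule is_subring_polysV)
  have "shear l c p \<in> {p. coeffs_in ?S p}"
    unfolding shear_def
  proof (rule kalg.subst_in_subring[OF kalg_pconst is_subring_coeffs_in[OF S]])
    show "pconst a \<in> {p. coeffs_in ?S p}" for a
      using coeffs_in_const[OF S] by (simp add: polysV_def)
    fix v assume "v \<in> mp_vars p"
    hence v: "v \<in> V" using assms by (auto simp: polysV_def)
    show "(if v = l then [:0, 1:] else [:mvar v, mp_const (c v):]) \<in> {p. coeffs_in ?S p}"
      using v is_subringD(1,2)[OF S]
      by (auto simp: coeffs_in_def coeff_pCons polysV_def split: nat.splits)
  qed
  thus ?thesis by simp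
qed

lemma comm_ring_hom_eval2:
  "comm_ring_hom f \<Longrightarrow> comm_ring_hom (\<lambda>p. poly (map_poly f p) (x :: 'b::comm_ring_1))"
  by (rule comm_ring_hom_comp[OF comm_ring_hom_poly comm_ring_hom_map_poly])

lemma map_poly_hom_pCons:
  "comm_ring_hom f \<Longrightarrow> map_poly f (pCons a p) = pCons (f a) (map_poly f p)"
proof -
  assume "comm_ring_hom f"
  then interpret f: comm_ring_hom f .
  show ?thesis by (intro poly_eqI) (simp add: coeff_map_poly coeff_pCons split: nat.split)
qed

text \<open>A sheared polynomial can be evaluated in two stages, coefficients first and x_l last;
  this is how points and algebra elements found for fewer variables are extended to one
  more.\<close>

lemma (in kalg) subst_shear:
  "mp_subst \<kappa> (\<lambda>v. if v = l then t else y v + \<kappa> (c v) * t) p =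
    poly (map_poly (mp_subst \<kappa> y) (shear l c p)) t"
proof (rule hom_ext)
  interpret e: comm_ring_hom "mp_subst \<kappa> y" by (rule subst_hom)
  let ?y = "\<lambda>v. if v = l then t else y v + \<kappa> (c v) * t"
  show "comm_ring_hom (mp_subst \<kappa> ?y)" by (rule subst_hom)
  show "comm_ring_hom (\<lambda>p. poly (map_poly (mp_subst \<kappa> y) (shear l c p)) t)"
    by (rule comm_ring_hom_comp[OF comm_ring_hom_eval2[OF subst_hom] shear_hom])
  show "mp_subst \<kappa> ?y (mp_const x) = poly (map_poly (mp_subst \<kappa> y) (shear l c (mp_const x))) t" for x
    by (simp add: map_poly_hom_pCons[OF subst_hom])
  show "mp_subst \<kappa> ?y (mvar v) = poly (map_poly (mp_subst \<kappa> y) (shear l c (mvar v))) t" for v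
    by (simp add: map_poly_hom_pCons[OF subst_hom] shear_mvar mult.commute)
qed

lemma eval_shear:
  fixes p :: "'k::field mp"
  shows "mp_eval (\<lambda>v. if v = l then t else a v + c v * t) p = poly (map_poly (mp_eval a) (shear l c p)) t"
  unfolding mp_eval_def[abs_def] by (rule kalg.subst_shear[OF kalg_id])

definition unshear :: "nat \<Rightarrow> (nat \<Rightarrow> 'k) \<Rightarrow> 'k::field mp \<Rightarrow> 'k mp" where
  "unshear l c = mp_subst mp_const (\<lambda>v. if v = l then mvar l else mvar v - mp_const (c v) * mvar l)"

lemma unshear_hom: "comm_ring_hom (unshear l c)"
  unfolding unshear_def by (rule kalg.subst_hom[OF kalg_const])

text \<open>An explicit left inverse: shearing is injective, and with \<open>c = 0\<close> merely
  isolating one variable loses nothing.\<close>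

lemma unshear_shear: "poly (map_poly (unshear l c) (shear l c p)) (mvar l) = p"
proof (rule hom_ext[where h' = "\<lambda>p. p"])
  interpret e: comm_ring_hom "unshear l c" by (rule unshear_hom)
  show "comm_ring_hom (\<lambda>p. poly (map_poly (unshear l c) (shear l c p)) (mvar l))"
    by (rule comm_ring_hom_comp[OF comm_ring_hom_eval2[OF unshear_hom] shear_hom])
  show "comm_ring_hom (\<lambda>p. p)" by unfold_locales auto
  have u: "unshear l c (mp_const x) = mp_const x" for x
    by (simp add: unshear_def kalg.subst_const[OF kalg_const])
  have um: "unshear l c (mvar v) = (if v = l then mvar l else mvar v - mp_const (c v) * mvar l)" for v
    by (simp add: unshear_def kalg.subst_mvar[OF kalg_const])
  show "poly (map_poly (unshear l c) (shear l c (mp_const x))) (mvar l) = mp_const x" for x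
    by (simp add: map_poly_hom_pCons[OF unshear_hom] u)
  show "poly (map_poly (unshear l c) (shear l c (mvar v))) (mvar l) = mvar v" for v
    by (simp add: map_poly_hom_pCons[OF unshear_hom] u um shear_mvar)
qed

lemma polysV_empty: "p \<in> polysV {} \<Longrightarrow> \<exists>c. p = mp_const c"
proof -
  assume "p \<in> polysV {}"
  hence "keys p \<subseteq> {0}" by (auto simp: polysV_def mp_vars_def)
  hence "p = mp_const (lookup p 0)"
    by (intro poly_mapping_eqI) (auto simp: mp_const_def lookup_single when_def in_keys_iff)
  thus ?thesis by blast
qed

text \<open>Split off one variable: by induction some coefficient survives at a point
  \<open>a\<close>, and the resulting nonzero univariate polynomial has a non-root since the field
  is infinite.\<close>

lemma mp_nonzero_at:
  fixes F :: "'k::alg_closed_field mp"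
  assumes "F \<noteq> 0"
  shows "\<exists>a. mp_eval a F \<noteq> 0"
proof -
  have "\<exists>a. mp_eval a F \<noteq> 0" if "finite V" "F \<noteq> 0" "F \<in> polysV V" for V and F :: "'k mp"
    using that
  proof (induction V arbitrary: F rule: finite_induct)
    case empty
    thus ?case using polysV_empty[of F] by auto
  next
    case (insert l V)
    let ?c = "\<lambda>_. 0 :: 'k"
    have "shear l ?c F \<noteq> 0" using unshear_shear[of l ?c F] insert.prems(1) by auto
    then obtain i where i: "coeff (shear l ?c F) i \<noteq> 0" by (auto simp: poly_eq_iff)
    have "coeff (shear l ?c F) i \<in> polysV V"
      using coeffs_in_shear[OF insert.prems(2), of l ?c] insert.hyps by (auto simp: coeffs_in_def polysV_def)
    from insert.IH[OF i this] obtain a where a: "mp_eval a (coeff (shear l ?c F) i) \<noteq> 0" by blast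
    interpret e: comm_ring_hom "mp_eval a :: 'k mp \<Rightarrow> 'k" by (rule mp_eval_hom)
    have "map_poly (mp_eval a) (shear l ?c F) \<noteq> 0"
      using a by (auto simp: poly_eq_iff coeff_map_poly)
    then obtain t where "poly (map_poly (mp_eval a) (shear l ?c F)) t \<noteq> 0" using poly_nonzero_at by blast
    thus ?case using eval_shear[of l t a ?c F] by metis
  qed
  from this[of "mp_vars F" F] assms show ?thesis by (simp add: polysV_def)
qed

lemma monom_eval_scale: "monom_eval (\<lambda>v. t * c v) m = t ^ wdeg (\<lambda>_. 1) m * monom_eval c m"
  for t :: "'a::comm_semiring_1"
  by (simp add: monom_eval_def wdeg_def power_mult_distrib prod.distrib power_sum)

lemma mp_eval_homogeneous:
  fixes F :: "'k::field mp"
  assumes "\<forall>m\<in>keys F. wdeg (\<lambda>_. 1) m = E"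
  shows "mp_eval (\<lambda>v. t * c v) F = t ^ E * mp_eval c F"
  unfolding mp_eval_def kalg.subst_mon[OF kalg_id] monom_eval_scale
  using assms by (simp add: sum_distrib_left ac_simps)

text \<open>A point where \<open>F * mvar l\<close> does not vanish has nonzero l-th coordinate;
  homogeneity allows rescaling that coordinate to 1.\<close>

lemma homogeneous_nonzero_at:
  fixes F :: "'k::alg_closed_field mp"
  assumes "F \<noteq> 0" "\<forall>m\<in>keys F. wdeg (\<lambda>_. 1) m = E"
  shows "\<exists>c. c l = 1 \<and> mp_eval c F \<noteq> 0"
proof -
  have "(mvar l :: 'k mp) \<noteq> 0"
  proof
    assume "(mvar l :: 'k mp) = 0"
    hence "mp_eval (\<lambda>_. 1 :: 'k) (mvar l) = mp_eval (\<lambda>_. 1) 0" by simp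
    thus False by (simp add: comm_ring_hom_zero[OF mp_eval_hom])
  qed
  hence "F * mvar l \<noteq> 0" using assms(1) by simp
  then obtain a where a: "mp_eval a (F * mvar l) \<noteq> 0" using mp_nonzero_at by blast
  interpret e: comm_ring_hom "mp_eval a :: 'k mp \<Rightarrow> 'k" by (rule mp_eval_hom)
  have "mp_eval a F \<noteq> 0" "a l \<noteq> 0" using a by (auto simp: e.hom_mult)
  thus ?thesis
    using mp_eval_homogeneous[OF assms(2), of "inverse (a l)" a]
    by (intro exI[of _ "\<lambda>v. inverse (a l) * a v"]) auto
qed

lemma coeff_mult_top:
  fixes p q :: "'a::comm_semiring_0 poly"
  assumes "degree p \<le> a" "degree q \<le> b"
  shows "coeff (p * q) (a + b) = coeff p a * coeff q b"
proof -
  have "coeff (p * q) (a + b) = (\<Sum>i\<in>{a}. coeff p i * coeff q (a + b - i))"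
    unfolding coeff_mult
  proof (rule sum.mono_neutral_right)
    show "\<forall>i\<in>{..a + b} - {a}. coeff p i * coeff q (a + b - i) = 0"
    proof
      fix i assume i: "i \<in> {..a + b} - {a}"
      show "coeff p i * coeff q (a + b - i) = 0"
      proof (cases "i > a")
        case True
        hence "coeff p i = 0" using assms(1) by (intro coeff_eq_0) simp
        thus ?thesis by simp
      next
        case False
        hence "coeff q (a + b - i) = 0" using i assms(2) by (intro coeff_eq_0) auto
        thus ?thesis by simp
      qed
    qed
  qed auto
  thus ?thesis by simp
qed

text \<open>Each variable becomes linear in x_l with leading coefficient \<open>c v\<close>. The
  normalization \<open>c l = 1\<close> makes this true for x_l as well, so the top coefficient of a
  monomial is its value at \<open>c\<close>.\<close>

lemma shear_mon_top:
  assumes "c l = 1"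
  shows "degree (monom_eval (\<lambda>v. if v = l then [:0, 1:] else [:mvar v, mp_const (c v):]) m) \<le> wdeg (\<lambda>_. 1) m \<and>
    coeff (monom_eval (\<lambda>v. if v = l then [:0, 1:] else [:mvar v, mp_const (c v):]) m) (wdeg (\<lambda>_. 1) m) =
      (mp_const (monom_eval c m) :: 'k::field mp)"
proof -
  let ?y = "\<lambda>v. if v = l then [:0, 1:] else [:mvar v, mp_const (c v) :: 'k mp:]"
  have y: "degree (?y v) \<le> 1" "coeff (?y v) 1 = mp_const (c v)" for v using assms by auto
  have pwr: "degree (?y v ^ k) \<le> k \<and> coeff (?y v ^ k) k = mp_const (c v ^ k)" for v k
  proof (induction k)
    case (Suc k)
    have "degree (?y v * ?y v ^ k) \<le> 1 + k"
      using degree_mult_le[of "?y v" "?y v ^ k"] y(1)[of v] Suc by linarith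
    moreover have "coeff (?y v * ?y v ^ k) (1 + k) = mp_const (c v) * mp_const (c v ^ k)"
      using coeff_mult_top[of "?y v" 1 "?y v ^ k" k] y[of v] Suc by simp
    ultimately show ?case by (simp add: mp_const_mult)
  qed simp
  have "degree (\<Prod>v\<in>A. ?y v ^ lookup m v) \<le> (\<Sum>v\<in>A. lookup m v) \<and>
    coeff (\<Prod>v\<in>A. ?y v ^ lookup m v) (\<Sum>v\<in>A. lookup m v) =
      mp_const (\<Prod>v\<in>A. c v ^ lookup m v)" if "finite A" for A
    using that
  proof (induction A rule: finite_induct)
    case (insert v A)
    let ?p = "?y v ^ lookup m v" and ?q = "\<Prod>v\<in>A. ?y v ^ lookup m v"
    have "degree (?p * ?q) \<le> lookup m v + (\<Sum>v\<in>A. lookup m v)"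
      using degree_mult_le[of ?p ?q] pwr[of v "lookup m v"] insert.IH by linarith
    moreover have "coeff (?p * ?q) (lookup m v + (\<Sum>v\<in>A. lookup m v)) =
        mp_const (c v ^ lookup m v) * mp_const (\<Prod>v\<in>A. c v ^ lookup m v)"
      using coeff_mult_top[of ?p "lookup m v" ?q "\<Sum>v\<in>A. lookup m v"]
        pwr[of v "lookup m v"] insert.IH by metis
    ultimately show ?case using insert.hyps by (simp only: prod.insert sum.insert mp_const_mult simp_thms)
  qed simp
  from this[OF finite_keys, of m] show ?thesis by (simp add: monom_eval_def wdeg_def)
qed

text \<open>With E the total degree of \<open>F\<close>, the coefficient of x_l^E after shearing is
  the value at \<open>c\<close> of the top homogeneous part \<open>T\<close>; a point where
  \<open>T\<close> does not vanish makes it a nonzero constant.\<close>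

lemma shear_monic:
  fixes F :: "'k::alg_closed_field mp"
  assumes "F \<noteq> 0"
  shows "\<exists>c \<kappa>. \<kappa> \<noteq> 0 \<and> lead_coeff (shear l c F) = mp_const \<kappa>"
proof -
  define E where "E = Max (wdeg (\<lambda>_. 1) ` keys F)"
  let ?K = "{m\<in>keys F. wdeg (\<lambda>_. 1) m = E}"
  define T where "T = (\<Sum>m\<in>?K. single m (lookup F m))"
  have le: "wdeg (\<lambda>_. 1) m \<le> E" if "m \<in> keys F" for m
    unfolding E_def using that by (intro Max_ge) auto
  have "E \<in> wdeg (\<lambda>_. 1) ` keys F" unfolding E_def using assms by (intro Max_in) auto
  then obtain m0 where m0: "m0 \<in> ?K" by auto
  have lT: "lookup T m = (if m \<in> ?K then lookup F m else 0)" for m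
    by (simp add: T_def lookup_sum lookup_single when_def)
  have kT: "keys T = ?K" by (auto simp: in_keys_iff lT split: if_splits)
  have "T \<noteq> 0" using kT m0 by (metis empty_iff keys_zero)
  then obtain c where c: "c l = 1" "mp_eval c T \<noteq> 0"
    using homogeneous_nonzero_at[of T E l] kT by blast
  let ?y = "\<lambda>v. if v = l then [:0, 1:] else [:mvar v, mp_const (c v) :: 'k mp:]"
  have sh: "shear l c F = (\<Sum>m\<in>keys F. pconst (lookup F m) * monom_eval ?y m)"
    by (simp add: shear_def kalg.subst_mon[OF kalg_pconst])
  have dle: "degree (shear l c F) \<le> E"
    unfolding sh
  proof (rule degree_sum_le)
    fix m assume "m \<in> keys F"
    have "degree (pconst (lookup F m) * monom_eval ?y m) \<le> degree (monom_eval ?y m)"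
      using degree_mult_le[of "pconst (lookup F m)" "monom_eval ?y m"] by simp
    also have "\<dots> \<le> E" using shear_mon_top[of c l m, OF c(1)] le[OF \<open>m \<in> _\<close>] by linarith
    finally show "degree (pconst (lookup F m) * monom_eval ?y m) \<le> E" .
  qed simp
  have "coeff (shear l c F) E = (\<Sum>m\<in>keys F. mp_const (lookup F m) * coeff (monom_eval ?y m) E)"
    unfolding sh coeff_sum by simp
  also have "\<dots> = (\<Sum>m\<in>keys F. if wdeg (\<lambda>_. 1) m = E then mp_const (lookup F m * monom_eval c m) else 0)"
  proof (rule sum.cong[OF refl])
    fix m assume m: "m \<in> keys F"
    note t = shear_mon_top[of c l m, OF c(1)]
    show "mp_const (lookup F m) * coeff (monom_eval ?y m) E =
      (if wdeg (\<lambda>_. 1) m = E then mp_const (lookup F m * monom_eval c m) else 0)"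
    proof (cases "wdeg (\<lambda>_. 1) m = E")
      case True
      thus ?thesis using t by (simp add: mp_const_mult)
    next
      case False
      hence "coeff (monom_eval ?y m) E = 0" using t le[OF m] by (intro coeff_eq_0) linarith
      thus ?thesis using False by simp
    qed
  qed
  also have "\<dots> = (\<Sum>m\<in>?K. mp_const (lookup F m * monom_eval c m))"
    by (simp add: sum.inter_filter)
  also have "\<dots> = mp_const (\<Sum>m\<in>?K. lookup F m * monom_eval c m)"
    by (simp add: comm_ring_hom_sum[OF mp_const_hom])
  also have "(\<Sum>m\<in>?K. lookup F m * monom_eval c m) = mp_eval c T"
    unfolding mp_eval_def kalg.subst_mon[OF kalg_id] kT by (intro sum.cong) (auto simp: lT)
  finally have cE: "coeff (shear l c F) E = mp_const (mp_eval c T)" .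
  hence "degree (shear l c F) = E" using c(2) dle le_degree[of "shear l c F" E] by simp
  thus ?thesis using cE c(2) by blast
qed

section \<open>The weak Nullstellensatz\<close>

definition is_ideal :: "'r::comm_ring_1 set \<Rightarrow> bool" where
  "is_ideal I \<longleftrightarrow> 0 \<in> I \<and> (\<forall>a\<in>I. \<forall>b\<in>I. a + b \<in> I) \<and> (\<forall>a\<in>I. \<forall>x. x * a \<in> I)"

lemma is_idealD:
  assumes "is_ideal I"
  shows "0 \<in> I" "a \<in> I \<Longrightarrow> b \<in> I \<Longrightarrow> a + b \<in> I" "a \<in> I \<Longrightarrow> x * a \<in> I"
    "a \<in> I \<Longrightarrow> b \<in> I \<Longrightarrow> a - b \<in> I"
proof -
  show *: "0 \<in> I" "a \<in> I \<Longrightarrow> b \<in> I \<Longrightarrow> a + b \<in> I" "a \<in> I \<Longrightarrow> x * a \<in> I" for a b x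
    using assms by (auto simp: is_ideal_def)
  assume "a \<in> I" "b \<in> I"
  from *(2)[OF this(1) *(3)[OF this(2), of "- 1"]] show "a - b \<in> I" by simp
qed

lemma is_ideal_sum: "is_ideal I \<Longrightarrow> (\<And>i. i \<in> A \<Longrightarrow> f i \<in> I) \<Longrightarrow> sum f A \<in> I"
  by (induction A rule: infinite_finite_induct) (auto simp: is_idealD)

lemma is_ideal_vimage:
  assumes "comm_ring_hom h" "is_ideal I"
  shows "is_ideal {x. h x \<in> I}"
proof -
  interpret h: comm_ring_hom h by fact
  show ?thesis using assms(2) by (simp add: is_ideal_def h.hom_add h.hom_mult)
qed

text \<open>k[t] is a principal ideal domain: an element of least degree divides all others, and
  being nonconstant it has a root.\<close>

lemma proper_ideal_root:
  fixes K :: "'k::alg_closed_field poly set"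
  assumes "is_ideal K" "1 \<notin> K"
  shows "\<exists>t. \<forall>p\<in>K. poly p t = 0"
proof (cases "K \<subseteq> {0}")
  case True
  thus ?thesis by (intro exI[of _ 0]) auto
next
  case False
  define g where "g = arg_min degree (\<lambda>p. p \<in> K \<and> p \<noteq> 0)"
  have ex: "\<exists>p. p \<in> K \<and> p \<noteq> 0" using False by auto
  hence g: "g \<in> K" "g \<noteq> 0" unfolding g_def by (metis (mono_tags, lifting) arg_min_natI)+
  have min: "degree g \<le> degree p" if "p \<in> K" "p \<noteq> 0" for p
    unfolding g_def using that by (intro arg_min_nat_le) auto
  have dvd: "g dvd p" if "p \<in> K" for p
  proof -
    have "p mod g = p - (p div g) * g" by (simp add: minus_div_mult_eq_mod)
    also have "\<dots> \<in> K" using is_idealD[OF assms(1)] that g(1) by blast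
    finally have "p mod g \<in> K" .
    hence "p mod g = 0" using min[of "p mod g"] degree_mod_less[OF g(2), of p] by force
    thus ?thesis by (simp add: dvd_eq_mod_eq_0)
  qed
  have "degree g > 0"
  proof (rule ccontr)
    assume "\<not> degree g > 0"
    then obtain c where "g = [:c:]" by (metis degree_eq_zeroE gr0I)
    hence "[:inverse c:] * g = 1" using g(2) by (simp add: one_pCons)
    thus False using is_idealD(3)[OF assms(1) g(1)] assms(2) by metis
  qed
  then obtain t where "poly g t = 0" using alg_closed_imp_poly_has_root by blast
  thus ?thesis using dvd by (metis dvdE mult_zero_left poly_mult)
qed

text \<open>If the specialization of \<open>P\<close> is 1, multiplication by \<open>P\<close> modulo the monic \<open>M\<close> has a
  determinant specializing to 1; by Cramer's rule it lies in the ideal generated by \<open>P\<close> and \<open>M\<close>.\<close>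

lemma eliminate_monic:
  fixes P M :: "'a::idom poly" and ev :: "'a \<Rightarrow> 'b::idom"
  assumes S: "is_subring S" and J: "is_ideal J" and ev: "comm_ring_hom ev"
    and M: "M \<in> J" "coeffs_in S M" "lead_coeff M = 1" "degree M > 0"
    and P: "P \<in> J" "coeffs_in S P" "map_poly ev P = 1"
  shows "\<exists>x\<in>S. [:x:] \<in> J \<and> ev x = 1"
proof -
  interpret ev: comm_ring_hom ev by fact
  interpret evp: comm_ring_hom "map_poly ev" by (rule comm_ring_hom_map_poly[OF ev])
  define N where "N = degree M"
  have M0: "M \<noteq> 0" using M(4) by auto
  have "\<exists>A R. coeffs_in S R \<and> monom 1 i * P = M * A + R \<and> (R = 0 \<or> degree R < N)" for i
  proof -
    have "coeffs_in S (monom 1 i * P)"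
      by (intro coeffs_inD(3)[OF S] coeffs_in_monom[OF S] is_subringD(1)[OF S] P(2))
    from pseudo_division_subring[OF S this M(2) M0] show ?thesis
      using M(3) by (auto simp: N_def)
  qed
  then obtain A R where AR: "\<And>i. coeffs_in S (R i)" "\<And>i. monom 1 i * P = M * A i + R i"
    "\<And>i. R i = 0 \<or> degree (R i) < N" by metis
  have RJ: "R i \<in> J" for i
  proof -
    have "R i = monom 1 i * P - A i * M" using AR(2)[of i] by (simp add: mult.commute)
    thus ?thesis using is_idealD(3,4)[OF J] M(1) P(1) by metis
  qed
  have evM: "lead_coeff (map_poly ev M) = 1" "degree (map_poly ev M) = N"
  proof -
    have "coeff (map_poly ev M) N = 1" using M(3) by (simp add: coeff_map_poly N_def)
    moreover have "degree (map_poly ev M) \<le> N" unfolding N_def by (rule degree_map_poly_le)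
    ultimately show "degree (map_poly ev M) = N" using le_degree[of "map_poly ev M" N] by simp
    thus "lead_coeff (map_poly ev M) = 1" using \<open>coeff (map_poly ev M) N = 1\<close> by simp
  qed
  \<comment> \<open>Once \<open>P\<close> specializes to 1, the monomial of degree
    \<open>i < N\<close> is its own remainder modulo the monic specialization of
    \<open>M\<close>.\<close>
  have evR: "map_poly ev (R i) = monom 1 i" if "i < N" for i
  proof -
    have "monom 1 i = map_poly ev (monom 1 i * P)"
      unfolding evp.hom_mult P(3) by (simp add: map_poly_monom)
    also have "\<dots> = map_poly ev M * map_poly ev (A i) + map_poly ev (R i)"
      unfolding AR(2) evp.hom_add evp.hom_mult ..
    finally have eq: "map_poly ev M * map_poly ev (A i) = monom 1 i - map_poly ev (R i)"
      by (simp add: algebra_simps)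
    have "degree (map_poly ev (R i)) < N"
      using AR(3)[of i] degree_map_poly_le[of ev "R i"] M(4) by (auto simp: N_def)
    hence "degree (monom 1 i - map_poly ev (R i)) < N"
      using that by (intro degree_diff_less) (auto simp: degree_monom_eq)
    hence "degree (map_poly ev M * map_poly ev (A i)) < N" using eq by simp
    hence "map_poly ev (A i) = 0" using evM
      by (metis degree_mult_eq leading_coeff_0_iff not_add_less1 zero_neq_one)
    thus ?thesis using eq by simp
  qed
  define G where "G = mat N N (\<lambda>(i, j). coeff (R i) j)"
  have G: "G \<in> carrier_mat N N" by (simp add: G_def)
  have "det G \<in> S"
    using AR(1) by (intro det_in_subring[OF S G]) (auto simp: G_def coeffs_in_def)
  moreover have "ev (det G) = 1"
  proof -
    have "map_mat ev G = 1\<^sub>m N"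
    proof (rule eq_matI)
      fix i j assume "i < dim_row (1\<^sub>m N :: 'b mat)" "j < dim_col (1\<^sub>m N :: 'b mat)"
      hence ij: "i < N" "j < N" by auto
      have "ev (coeff (R i) j) = coeff (map_poly ev (R i)) j" by (simp add: coeff_map_poly)
      also have "\<dots> = (if i = j then 1 else 0)" using evR[OF ij(1)] by simp
      finally show "map_mat ev G $$ (i, j) = 1\<^sub>m N $$ (i, j)" using ij by (simp add: G_def)
    qed (auto simp: G_def)
    thus ?thesis using ev.hom_det[of G] by simp
  qed
  moreover have "[:det G:] \<in> J"
  proof -
    have Rsum: "R i = (\<Sum>j = 0..<N. [:coeff (R i) j:] * monom 1 j)" for i
    proof -
      have "coeff (\<Sum>j = 0..<N. [:coeff (R i) j:] * monom 1 j) k = coeff (R i) k" for k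
      proof -
        have "coeff (\<Sum>j = 0..<N. [:coeff (R i) j:] * monom 1 j) k = (\<Sum>j = 0..<N. if j = k then coeff (R i) k else 0)"
          unfolding coeff_sum by (intro sum.cong) auto
        also have "\<dots> = coeff (R i) k" using AR(3)[of i] by (auto simp: coeff_eq_0)
        finally show ?thesis .
      qed
      thus ?thesis by (simp add: poly_eq_iff)
    qed
    have adj: "adj_mat G \<in> carrier_mat N N" by (rule adj_mat(1)[OF G])
    have N: "0 < N" using M(4) by (simp add: N_def)
    \<comment> \<open>The first row of the adjugate combines the remainders \<open>R i\<close>, all
      in \<open>J\<close>, to a polynomial whose only coefficient is the constant
      \<open>det G\<close>.\<close>
    have ent: "(\<Sum>i = 0..<N. adj_mat G $$ (0, i) * coeff (R i) j) = (if j = 0 then det G else 0)" if "j < N" for j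
    proof -
      have "(\<Sum>i = 0..<N. adj_mat G $$ (0, i) * coeff (R i) j) = (adj_mat G * G) $$ (0, j)"
        using that N adj G by (auto simp: scalar_prod_def G_def intro!: sum.cong)
      also have "\<dots> = (if j = 0 then det G else 0)" unfolding adj_mat(3)[OF G] using that N by auto
      finally show ?thesis .
    qed
    have "(\<Sum>i = 0..<N. [:adj_mat G $$ (0, i):] * R i) \<in> J"
      by (intro is_ideal_sum[OF J] is_idealD(3)[OF J] RJ)
    also have "(\<Sum>i = 0..<N. [:adj_mat G $$ (0, i):] * R i) =
        (\<Sum>i = 0..<N. \<Sum>j = 0..<N. [:adj_mat G $$ (0, i):] * ([:coeff (R i) j:] * monom 1 j))"
      using Rsum by (simp only: sum_distrib_left[symmetric])
    also have "\<dots> = (\<Sum>j = 0..<N. [:\<Sum>i = 0..<N. adj_mat G $$ (0, i) * coeff (R i) j:] * monom 1 j)"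
    proof (subst sum.swap, rule sum.cong[OF refl])
      fix j
      have "(\<Sum>i = 0..<N. [:adj_mat G $$ (0, i):] * ([:coeff (R i) j:] * monom 1 j)) =
        (\<Sum>i = 0..<N. [:adj_mat G $$ (0, i) * coeff (R i) j:]) * monom 1 j"
        unfolding sum_distrib_right by (intro sum.cong refl) (simp add: smult_monom)
      also have "(\<Sum>i = 0..<N. [:adj_mat G $$ (0, i) * coeff (R i) j:]) = [:\<Sum>i = 0..<N. adj_mat G $$ (0, i) * coeff (R i) j:]"
        by (simp add: comm_ring_hom_sum[OF comm_ring_hom_pCons])
      finally show "(\<Sum>i = 0..<N. [:adj_mat G $$ (0, i):] * ([:coeff (R i) j:] * monom 1 j)) =
        [:\<Sum>i = 0..<N. adj_mat G $$ (0, i) * coeff (R i) j:] * monom 1 j" .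
    qed
    also have "\<dots> = (\<Sum>j = 0..<N. if j = 0 then [:det G:] else 0)"
      by (intro sum.cong refl) (simp add: ent smult_monom monom_0 del: mult_pCons_left)
    also have "\<dots> = [:det G:]" using N by simp
    finally show ?thesis .
  qed
  ultimately show ?thesis by blast
qed

text \<open>Induction on the variables. A nonzero member of the ideal becomes monic in x_l after a
  shear, and then a zero \<open>a\<close> in fewer variables extends: specialized at
  \<open>a\<close> the ideal stays proper by \<open>eliminate_monic\<close>, and a proper ideal of
  k[t] has a root. Evaluating only the members in \<open>polysV V\<close> keeps the ambient ring
  fixed during the induction.\<close>

lemma weak_nullstellensatz_ideal:
  fixes I :: "'k::alg_closed_field mp set"
  assumes "finite V" "is_ideal I" "1 \<notin> I"
  shows "\<exists>a. \<forall>p\<in>I \<inter> polysV V. mp_eval a p = 0"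
  using assms
proof (induction V arbitrary: I rule: finite_induct)
  case empty
  have "p = 0" if p: "p \<in> I" "p \<in> polysV {}" for p
  proof (rule ccontr)
    assume "p \<noteq> 0"
    obtain c where c: "p = mp_const c" using polysV_empty[OF p(2)] by blast
    have "mp_const (inverse c) * p = 1" using \<open>p \<noteq> 0\<close> by (simp add: c flip: mp_const_mult)
    thus False using is_idealD(3)[OF empty.prems(1) p(1)] empty.prems(2) by metis
  qed
  thus ?case using comm_ring_hom_zero[OF mp_eval_hom] by blast
next
  case (insert l V)
  show ?case
  proof (cases "I \<inter> polysV (insert l V) \<subseteq> {0}")
    case True
    thus ?thesis using comm_ring_hom_zero[OF mp_eval_hom] by blast
  next
    case False
    then obtain F where F: "F \<in> I" "F \<in> polysV (insert l V)" "F \<noteq> 0" by auto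
    from shear_monic[OF F(3)] obtain c \<kappa> where c: "\<kappa> \<noteq> 0" "lead_coeff (shear l c F) = mp_const \<kappa>" by blast
    let ?S = "polysV V :: 'k mp set"
    have S: "is_subring ?S" by (rule is_subring_polysV)
    define \<psi> where "\<psi> = (\<lambda>P. poly (map_poly (unshear l c) P) (mvar l))"
    have \<psi>: "comm_ring_hom \<psi>" unfolding \<psi>_def by (rule comm_ring_hom_eval2[OF unshear_hom])
    interpret \<psi>: comm_ring_hom \<psi> by (rule \<psi>)
    \<comment> \<open>The sheared ideal is taken as a preimage under the inverse change of
      coordinates, which is an ideal of all of k[x][x_l] at once.\<close>
    define J where "J = {P. \<psi> P \<in> I}"
    have J: "is_ideal J" unfolding J_def by (rule is_ideal_vimage[OF \<psi> insert.prems(1)])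
    have shJ: "shear l c p \<in> J" if "p \<in> I" for p
      using that by (simp add: J_def \<psi>_def unshear_shear)
    have shS: "coeffs_in ?S (shear l c p)" if "p \<in> polysV (insert l V)" for p
      using coeffs_in_shear[OF that, of l c] insert.hyps(2) by simp
    have J1: "1 \<notin> J" using insert.prems(2) by (simp add: J_def)
    define I' where "I' = {p. [:p:] \<in> J}"
    have I': "is_ideal I'" unfolding I'_def by (rule is_ideal_vimage[OF comm_ring_hom_pCons J])
    have "1 \<notin> I'" using J1 by (simp add: I'_def one_pCons)
    from insert.IH[OF I' this] obtain a where a: "\<And>p. p \<in> I' \<Longrightarrow> p \<in> ?S \<Longrightarrow> mp_eval a p = 0" by blast
    let ?ev = "mp_eval a :: 'k mp \<Rightarrow> 'k"
    interpret evp: comm_ring_hom "map_poly ?ev" by (rule comm_ring_hom_map_poly[OF mp_eval_hom])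
    define M where "M = [:mp_const (inverse \<kappa>):] * shear l c F"
    have M: "M \<in> J" "coeffs_in ?S M" "lead_coeff M = 1"
    proof -
      show "M \<in> J" unfolding M_def by (rule is_idealD(3)[OF J shJ[OF F(1)]])
      show "coeffs_in ?S M" unfolding M_def
        by (intro coeffs_inD(3)[OF S] coeffs_in_const[OF S] shS[OF F(2)]) (simp add: polysV_def)
      show "lead_coeff M = 1" unfolding M_def lead_coeff_mult c(2) using c(1)
        by (simp flip: mp_const_mult)
    qed
    have "degree M > 0"
    proof (rule ccontr)
      assume "\<not> degree M > 0"
      then obtain x where "M = [:x:]" by (metis degree_eq_zeroE gr0I)
      hence "M = 1" using M(3) by (simp add: one_pCons)
      thus False using M(1) J1 by simp
    qed
    note Mp = this
    \<comment> \<open>The point \<open>a\<close> controls only polynomials in \<open>V\<close>,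
      hence the restriction on the coefficients; constants satisfy it, so the result is still an
      ideal of k[t].\<close>
    define K where "K = {map_poly ?ev P |P. P \<in> J \<and> coeffs_in ?S P}"
    have "is_ideal K"
      unfolding is_ideal_def
    proof (intro conjI ballI allI)
      show "0 \<in> K" unfolding K_def using is_idealD(1)[OF J] coeffs_in_0[OF S]
        by (intro CollectI exI[of _ 0]) simp
      fix p assume "p \<in> K"
      then obtain P where P: "p = map_poly ?ev P" "P \<in> J" "coeffs_in ?S P" by (auto simp: K_def)
      show "p + q \<in> K" if "q \<in> K" for q
      proof -
        from that obtain Q where Q: "q = map_poly ?ev Q" "Q \<in> J" "coeffs_in ?S Q" by (auto simp: K_def)
        show ?thesis unfolding K_def using P Q is_idealD(2)[OF J] coeffs_inD(1)[OF S]
          by (intro CollectI exI[of _ "P + Q"]) (simp add: evp.hom_add)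
      qed
      fix x
      let ?x = "map_poly mp_const x :: 'k mp poly"
      have "map_poly ?ev ?x = x"
        by (intro poly_eqI) (simp add: coeff_map_poly comm_ring_hom_zero[OF mp_eval_hom])
      moreover have "coeffs_in ?S ?x" by (simp add: coeffs_in_def coeff_map_poly polysV_def)
      ultimately show "x * p \<in> K" unfolding K_def using P is_idealD(3)[OF J] coeffs_inD(3)[OF S]
        by (intro CollectI exI[of _ "?x * P"]) (simp add: evp.hom_mult)
    qed
    moreover have "1 \<notin> K"
    proof
      assume "1 \<in> K"
      then obtain P where P: "P \<in> J" "coeffs_in ?S P" "map_poly ?ev P = 1" by (auto simp: K_def)
      from eliminate_monic[OF S J mp_eval_hom M Mp P] obtain x where "x \<in> ?S" "x \<in> I'" "?ev x = 1"
        by (auto simp: I'_def)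
      thus False using a[of x] by simp
    qed
    ultimately obtain t where t: "\<And>p. p \<in> K \<Longrightarrow> poly p t = 0" using proper_ideal_root by blast
    have "mp_eval (\<lambda>v. if v = l then t else a v + c v * t) p = 0" if "p \<in> I" "p \<in> polysV (insert l V)" for p
      unfolding eval_shear using t[of "map_poly ?ev (shear l c p)"] shJ[OF that(1)] shS[OF that(2)]
      by (auto simp: K_def)
    thus ?thesis by blast
  qed
qed

text \<open>A ring retraction onto \<open>polysV V\<close>. It moves cofactors or quotients into
  \<open>polysV V\<close> without disturbing an identity whose other terms already lie
  there.\<close>

definition restrict_vars :: "nat set \<Rightarrow> 'k::field mp \<Rightarrow> 'k mp" where
  "restrict_vars V = mp_subst mp_const (\<lambda>v. if v \<in> V then mvar v else 0)"

lemma restrict_vars_hom: "comm_ring_hom (restrict_vars V)"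
  unfolding restrict_vars_def by (rule kalg.subst_hom[OF kalg_const])

lemma restrict_vars_in: "restrict_vars V p \<in> polysV V"
  unfolding restrict_vars_def
  by (rule kalg.subst_in_subring[OF kalg_const is_subring_polysV]) (auto simp: polysV_def mp_vars_def[of 0])

lemma restrict_vars_id: "p \<in> polysV V \<Longrightarrow> restrict_vars V p = p"
proof -
  assume "p \<in> polysV V"
  hence "restrict_vars V p = mp_subst mp_const mvar p"
    unfolding restrict_vars_def by (intro kalg.subst_cong[OF kalg_const]) (auto simp: polysV_def)
  thus ?thesis by (simp add: subst_mvar_id)
qed

lemma weak_nullstellensatz:
  fixes f :: "'i \<Rightarrow> 'k::alg_closed_field mp"
  assumes "finite V" "\<And>i. i \<in> A \<Longrightarrow> f i \<in> polysV V" "\<And>a. \<exists>i\<in>A. mp_eval a (f i) \<noteq> 0" "finite A"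
  shows "\<exists>h. (\<forall>i. h i \<in> polysV V) \<and> (\<Sum>i\<in>A. f i * h i) = 1"
proof -
  define I where "I = {\<Sum>i\<in>A. f i * h i |h. True}"
  have I: "is_ideal I"
    unfolding is_ideal_def
  proof (intro conjI ballI allI)
    show "0 \<in> I" unfolding I_def by (intro CollectI exI[of _ "\<lambda>_. 0"]) simp
    fix p assume "p \<in> I"
    then obtain h where h: "p = (\<Sum>i\<in>A. f i * h i)" by (auto simp: I_def)
    show "p + q \<in> I" if "q \<in> I" for q
    proof -
      from that obtain h' where h': "q = (\<Sum>i\<in>A. f i * h' i)" by (auto simp: I_def)
      show ?thesis unfolding I_def h h'
        by (intro CollectI exI[of _ "\<lambda>i. h i + h' i"]) (simp add: sum.distrib distrib_left)
    qed
    show "x * p \<in> I" for x unfolding I_def h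
      by (intro CollectI exI[of _ "\<lambda>i. x * h i"]) (simp add: sum_distrib_left ac_simps)
  qed
  have fI: "f i \<in> I" if "i \<in> A" for i
  proof -
    have "(\<Sum>j\<in>A. f j * (if j = i then 1 else 0)) = (\<Sum>j\<in>A. if j = i then f j else 0)"
      by (intro sum.cong) auto
    also have "\<dots> = f i" using that assms(4) by simp
    finally show ?thesis unfolding I_def by (intro CollectI exI[of _ "\<lambda>j. if j = i then 1 else 0"]) simp
  qed
  have "1 \<in> I"
  proof (rule ccontr)
    assume "1 \<notin> I"
    from weak_nullstellensatz_ideal[OF assms(1) I this] obtain a where "\<forall>p\<in>I \<inter> polysV V. mp_eval a p = 0"
      by blast
    thus False using assms(2,3) fI by (metis IntI)
  qed
  then obtain h where h: "(\<Sum>i\<in>A. f i * h i) = 1" by (auto simp: I_def)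
  interpret r: comm_ring_hom "restrict_vars V" by (rule restrict_vars_hom)
  have "restrict_vars V (\<Sum>i\<in>A. f i * h i) = (\<Sum>i\<in>A. f i * restrict_vars V (h i))"
    unfolding r.hom_sum r.hom_mult using restrict_vars_id assms(2) by (intro sum.cong) auto
  hence "(\<Sum>i\<in>A. f i * restrict_vars V (h i)) = 1" unfolding h by simp
  thus ?thesis using restrict_vars_in by (intro exI[of _ "\<lambda>i. restrict_vars V (h i)"]) blast
qed

section \<open>Transcendence degree and Noether normalization\<close>

lemma wdeg_le_total_degree: "wdeg_le (\<lambda>_. 1) (total_degree p) p"
  using total_degree_le_iff[of p "total_degree p"] by simp

context kalg
begin

lemma subst_in_span:
  assumes "F \<in> polysV V" "wdeg_le (\<lambda>_. 1) K F"
  shows "mp_subst \<kappa> y F \<in> vs.span (products (y ` V) K)"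
  unfolding subst_mon
proof (intro vs.span_sum vs.span_scale vs.span_base monom_eval_in_products)
  fix m assume m: "m \<in> keys F"
  show "keys m \<subseteq> V" using m assms(1) by (auto simp: polysV_def mp_vars_def)
  show "wdeg (\<lambda>_. 1) m \<le> K" using m assms(2) by (auto simp: wdeg_le_def)
qed

text \<open>Read as a polynomial in \<open>u\<close>, the relation has a nonzero leading coefficient
  over the variables in \<open>V\<close>, and independence keeps its value nonzero. This is the
  situation of \<open>growth_algebraic\<close>.\<close>

lemma growth_insert_dependent:
  assumes P: "P \<noteq> 0" "P \<in> polysV (insert u V)" "u \<notin> V" "mp_subst \<kappa> y P = 0"
    and indep: "\<And>Q. Q \<in> polysV V \<Longrightarrow> Q \<noteq> 0 \<Longrightarrow> mp_subst \<kappa> y Q \<noteq> 0"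
    and S: "finite S" "y ` V \<subseteq> S" "growth_le S s"
  shows "growth_le (insert (y u) S) s"
proof -
  let ?k = "\<lambda>m. lookup m u"
  define r where "r m = m - single u (?k m)" for m :: "'a \<Rightarrow>\<^sub>0 nat"
  have mr: "m = r m + single u (?k m)" for m
    by (rule poly_mapping_eqI) (simp add: r_def lookup_add lookup_minus lookup_single when_def)
  define N where "N = Max (?k ` keys P)"
  have le: "?k m \<le> N" if "m \<in> keys P" for m
    unfolding N_def using that by (intro Max_ge) auto
  have "N \<in> ?k ` keys P" unfolding N_def using P(1) by (intro Max_in) auto
  then obtain m0 where m0: "m0 \<in> keys P" "?k m0 = N" by auto
  let ?A = "{m \<in> keys P. ?k m = N}"
  \<comment> \<open>The coefficient of the highest power of \<open>u\<close> in \<open>P\<close>;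
    the map \<open>r\<close> deletes \<open>u\<close> from a monomial.\<close>
  define Q where "Q = (\<Sum>m\<in>?A. single (r m) (lookup P m))"
  have rinj: "m = m'" if "r m = r m'" "?k m = ?k m'" for m m'
    using mr[of m] mr[of m'] that by simp
  have "lookup Q (r m0) = (\<Sum>m\<in>?A. if m = m0 then lookup P m0 else 0)"
    unfolding Q_def lookup_sum lookup_single when_def using rinj m0 by (intro sum.cong) auto
  hence Q0: "Q \<noteq> 0" using m0 by (auto simp: in_keys_iff)
  have rV: "keys (r m) \<subseteq> V" if "m \<in> keys P" for m
  proof
    fix v assume "v \<in> keys (r m)"
    hence "v \<noteq> u" "v \<in> keys m"
      by (auto simp: r_def in_keys_iff lookup_minus lookup_single when_def split: if_splits)
    thus "v \<in> V" using that P(2) by (auto simp: polysV_def mp_vars_def)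
  qed
  have QV: "Q \<in> polysV V"
  proof -
    have "keys Q \<subseteq> r ` ?A"
      unfolding Q_def using Poly_Mapping.keys_sum[of "\<lambda>m. single (r m) (lookup P m)" ?A]
      by (auto split: if_splits)
    thus ?thesis using rV by (fastforce simp: polysV_def mp_vars_def)
  qed
  define q where "q = mp_subst \<kappa> y Q"
  have q0: "q \<noteq> 0" unfolding q_def by (rule indep[OF QV Q0])
  obtain K where K: "K \<ge> total_degree Q" "\<And>m. m \<in> keys P \<Longrightarrow> wdeg (\<lambda>_. 1) (r m) \<le> K"
  proof -
    let ?M = "insert (total_degree Q) ((\<lambda>m. wdeg (\<lambda>_. 1) (r m)) ` keys P)"
    have "finite ?M" by simp
    thus ?thesis using that[of "Max ?M"] by (auto intro: Max_ge)
  qed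
  have pwV: "vs.span (products (y ` V) K) \<subseteq> vs.span (products S K)" by (intro vs.span_mono products_mono_set S(2))
  have qK: "q \<in> vs.span (products S K)"
    using subst_in_span[OF QV, of K y] wdeg_le_mono[OF wdeg_le_total_degree K(1)] pwV by (auto simp: q_def)
  have monom_eval: "monom_eval y m = monom_eval y (r m) * y u ^ ?k m" for m
    by (subst mr[of m]) (simp add: monom_eval_add)
  have qs: "q = (\<Sum>m\<in>?A. \<kappa> (lookup P m) * monom_eval y (r m))"
    by (simp add: q_def Q_def subst_sum)
  have "0 = (\<Sum>m\<in>keys P. \<kappa> (lookup P m) * monom_eval y m)"
    using P(4) by (simp add: subst_mon)
  also have "\<dots> = (\<Sum>m\<in>?A. \<kappa> (lookup P m) * monom_eval y m) +
      (\<Sum>m\<in>keys P - ?A. \<kappa> (lookup P m) * monom_eval y m)"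
    by (subst add.commute, rule sum.subset_diff) auto
  also have "(\<Sum>m\<in>?A. \<kappa> (lookup P m) * monom_eval y m) = q * y u ^ N"
    unfolding qs sum_distrib_right
  proof (rule sum.cong[OF refl])
    fix m assume "m \<in> ?A"
    thus "\<kappa> (lookup P m) * monom_eval y m = \<kappa> (lookup P m) * monom_eval y (r m) * y u ^ N"
      unfolding monom_eval[of m] by (simp only: mem_Collect_eq mult.assoc)
  qed
  finally have eq: "q * y u ^ N = - (\<Sum>m\<in>keys P - ?A. \<kappa> (lookup P m) * monom_eval y m)"
    by (simp add: eq_neg_iff_add_eq_0)
  show ?thesis
  proof (rule growth_algebraic[OF S(1,3) q0 qK])
    show "q * y u ^ N \<in> vs.span {a * y u ^ i |a i. a \<in> products S K \<and> i < N}"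
      unfolding eq
    proof (intro vs.span_neg vs.span_sum vs.span_scale vs.span_base)
      fix m assume "m \<in> keys P - ?A"
      hence m: "m \<in> keys P" "?k m < N" using le[of m] by auto
      have "monom_eval y (r m) \<in> products S K"
        using monom_eval_in_products[OF rV K(2), OF m(1) m(1), of y] products_mono_set[OF S(2)] by auto
      thus "monom_eval y m \<in> {a * y u ^ i |a i. a \<in> products S K \<and> i < N}" unfolding monom_eval[of m] using m(2) by blast
    qed
  qed
qed

text \<open>In a smallest dependent subset \<open>W\<close>, removing any index leaves an
  independent family, so the removed element is algebraic over the others and does not raise the
  growth: one exponent is saved.\<close>

lemma growth_dependent:
  assumes "finite V" "F \<noteq> 0" "F \<in> polysV V" "mp_subst \<kappa> y F = 0"
  shows "growth_le (y ` V) (card V - 1)"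
proof -
  define D where "D W \<longleftrightarrow> W \<subseteq> V \<and> (\<exists>F. F \<noteq> 0 \<and> F \<in> polysV W \<and> mp_subst \<kappa> y F = 0)" for W
  have "D V" using assms by (auto simp: D_def)
  then obtain W where W: "D W" "\<And>W'. D W' \<Longrightarrow> card W \<le> card W'"
    using ex_has_least_nat[of D V card] by blast
  have WV: "W \<subseteq> V" "finite W" using W(1) assms(1) finite_subset by (auto simp: D_def)
  obtain P where P: "P \<noteq> 0" "P \<in> polysV W" "mp_subst \<kappa> y P = 0" using W(1) by (auto simp: D_def)
  have "W \<noteq> {}"
  proof
    assume "W = {}"
    hence "keys P \<subseteq> {0}" using P(2) by (auto simp: polysV_def mp_vars_def)
    hence e: "P = mp_const (lookup P 0)"
      by (intro poly_mapping_eqI) (auto simp: mp_const_def lookup_single when_def in_keys_iff)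
    have "\<kappa> (lookup P 0) = 0" using P(3) subst_const[of y "lookup P 0"] e by simp
    moreover have "\<kappa> x \<noteq> 0" if "x \<noteq> 0" for x
    proof
      assume "\<kappa> x = 0"
      hence "\<kappa> (inverse x * x) = 0" by (simp only: hom_mult mult_zero_right)
      thus False using that by simp
    qed
    ultimately show False using e P(1) by (metis mp_const_0)
  qed
  then obtain u where u: "u \<in> W" by auto
  let ?W = "W - {u}"
  have indep: "mp_subst \<kappa> y Q \<noteq> 0" if "Q \<in> polysV ?W" "Q \<noteq> 0" for Q
  proof
    assume "mp_subst \<kappa> y Q = 0"
    hence "D ?W" using that WV by (auto simp: D_def)
    from W(2)[OF this] show False using u WV(2) card_Diff1_less[of W u] by simp
  qed
  have "growth_le (y ` ?W) (card ?W)"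
    using growth_exp_mono[OF growth_finite[of "y ` ?W"]] WV(2) card_image_le[of ?W y] by simp
  hence "growth_le (insert (y u) (y ` ?W)) (card ?W)"
    using P u WV(2) by (intro growth_insert_dependent[OF P(1) _ _ P(3) indep]) (auto simp: insert_absorb)
  moreover have "insert (y u) (y ` ?W) = y ` W" using u by auto
  ultimately have "growth_le (y ` W) (card W - 1)" using u WV(2) by simp
  \<comment> \<open>Each index outside \<open>W\<close> adds at most one to the exponent, so the
    saving made within \<open>W\<close> survives.\<close>
  moreover have "growth_le (y ` (W \<union> U)) (card W - 1 + card U)" if "finite U" "growth_le (y ` W) (card W - 1)" for U
    using that
  proof (induction U rule: finite_induct)
    case (insert x U)
    have "growth_le (insert (y x) (y ` (W \<union> U))) (Suc (card W - 1 + card U))"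
      using insert WV(2) by (intro growth_insert) auto
    thus ?case using insert.hyps by simp
  qed simp
  ultimately have "growth_le (y ` (W \<union> (V - W))) (card W - 1 + card (V - W))" using assms(1) by blast
  moreover have "W \<union> (V - W) = V" using WV by auto
  moreover have "card W - 1 + card (V - W) = card V - 1"
    using WV u card_Diff_subset[OF WV(2,1)] card_mono[OF assms(1) WV(1)] card_gt_0_iff[of W] by auto
  ultimately show ?thesis by simp
qed

definition subalg :: "('v \<Rightarrow> 'r) \<Rightarrow> 'v set \<Rightarrow> 'r set" where
  "subalg y V = mp_subst \<kappa> y ` polysV V"

lemma is_subring_image:
  assumes "comm_ring_hom h" "is_subring S"
  shows "is_subring (h ` S)"
proof -
  interpret h: comm_ring_hom h by fact
  show ?thesis using assms(2) unfolding is_subring_def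
    by (auto simp flip: h.hom_minus h.hom_mult) (metis h.hom_one image_eqI)
qed

lemma is_subring_subalg: "is_subring (subalg y V)"
  unfolding subalg_def by (rule is_subring_image[OF subst_hom is_subring_polysV])

lemma subalg_const: "\<kappa> c \<in> subalg y V"
  unfolding subalg_def using subst_const[of y c] by (intro image_eqI[of _ _ "mp_const c"]) (auto simp: polysV_def)

lemma subalg_base: "v \<in> V \<Longrightarrow> y v \<in> subalg y V"
  unfolding subalg_def by (intro image_eqI[of _ _ "mvar v"]) (auto simp: polysV_def)

lemma subalg_subset:
  assumes "is_subring B" "\<And>c. \<kappa> c \<in> B" "\<And>v. v \<in> V \<Longrightarrow> y v \<in> B"
  shows "subalg y V \<subseteq> B"
  unfolding subalg_def using assms by (auto intro!: subst_in_subring simp: polysV_def)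

lemma growth_integral:
  assumes S: "finite S" "y ` V \<subseteq> S" "growth_le S s" and b: "integral_over (subalg y V) b"
  shows "growth_le (insert b S) s"
proof -
  from b obtain p where p: "coeffs_in (subalg y V) p" "lead_coeff p = 1" "poly p b = 0"
    by (auto simp: integral_over_def)
  define N where "N = degree p"
  from p(1) have "\<forall>i. \<exists>F. F \<in> polysV V \<and> coeff p i = mp_subst \<kappa> y F" by (auto simp: coeffs_in_def subalg_def)
  then obtain F where F: "\<And>i. F i \<in> polysV V" "\<And>i. coeff p i = mp_subst \<kappa> y (F i)" by metis
  define K where "K = Max ((\<lambda>i. total_degree (F i)) ` {..N})"
  have cK: "coeff p i \<in> vs.span (products S K)" if "i < N" for i
  proof -
    have "total_degree (F i) \<le> K" unfolding K_def using that by (intro Max_ge) auto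
    hence "coeff p i \<in> vs.span (products (y ` V) K)"
      unfolding F(2) by (intro subst_in_span[OF F(1)] wdeg_le_mono[OF wdeg_le_total_degree])
    thus ?thesis using vs.span_mono[OF products_mono_set[OF S(2)]] by auto
  qed
  have "0 = (\<Sum>i\<le>N. coeff p i * b ^ i)" using p(3) by (simp add: poly_altdef N_def)
  also have "\<dots> = (\<Sum>i<N. coeff p i * b ^ i) + b ^ N"
    using p(2) by (simp add: N_def lessThan_Suc_atMost[symmetric])
  finally have eq: "1 * b ^ N = - (\<Sum>i<N. coeff p i * b ^ i)" by (simp add: eq_neg_iff_add_eq_0 add.commute)
  show ?thesis
  proof (rule growth_algebraic[OF S(1,3), where q = 1 and K = K and N = N])
    show "1 \<in> vs.span (products S K)" by (intro vs.span_base one_in_products)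
    show "1 * b ^ N \<in> vs.span {a * b ^ i |a i. a \<in> products S K \<and> i < N}"
      unfolding eq
    proof (intro vs.span_neg vs.span_sum)
      fix i assume i: "i \<in> {..<N}"
      have "coeff p i \<in> vs.span (products S K)" using cK i by auto
      moreover have "b ^ i \<in> vs.span {b ^ i}" by (simp add: vs.span_base)
      ultimately show "coeff p i * b ^ i \<in> vs.span {a * b ^ i |a i. a \<in> products S K \<and> i < N}"
        by (rule span_mult) (use i in \<open>auto intro!: vs.span_base\<close>)
    qed
  qed simp
qed

end

text \<open>In the coordinates \<open>y v - \<kappa> (c v) * y l\<close> the relation becomes the
  sheared polynomial evaluated at \<open>y l\<close>, whose leading coefficient is a nonzero
  constant and can be inverted.\<close>

lemma (in kalg) noether_step:
  fixes F :: "'k mp"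
  assumes F: "F \<in> polysV V" "mp_subst \<kappa> y F = 0" and l: "l \<in> V"
    and lc: "lead_coeff (shear l c F) = mp_const k" "k \<noteq> 0"
  shows "integral_over (subalg (\<lambda>v. y v - \<kappa> (c v) * y l) (V - {l})) (y l)"
proof -
  let ?y = "\<lambda>v. y v - \<kappa> (c v) * y l"
  let ?p = "map_poly (mp_subst \<kappa> ?y) (shear l c F)"
  have hom: "comm_ring_hom (mp_subst \<kappa> ?y)" by (rule subst_hom)
  have S: "is_subring (subalg ?y (V - {l}))" by (rule is_subring_subalg)
  have kk: "\<kappa> (inverse k) * \<kappa> k = 1" using lc(2) by (simp flip: hom_mult)
  hence k0: "\<kappa> k \<noteq> 0" by auto
  have "poly ?p (y l) = mp_subst \<kappa> (\<lambda>v. if v = l then y l else ?y v + \<kappa> (c v) * y l) F"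
    by (rule subst_shear[symmetric])
  also have "\<dots> = mp_subst \<kappa> y F" by (rule subst_cong) auto
  finally have z: "poly ?p (y l) = 0" using F(2) by simp
  have cp: "coeff ?p i = mp_subst \<kappa> ?y (coeff (shear l c F) i)" for i by (simp add: coeff_map_poly)
  have top: "coeff ?p (degree (shear l c F)) = \<kappa> k" unfolding cp lc(1) by simp
  have deg: "degree ?p = degree (shear l c F)"
    using top k0 le_degree[of ?p] degree_map_poly_le[of "mp_subst \<kappa> ?y" "shear l c F"] by (simp add: antisym)
  let ?q = "smult (\<kappa> (inverse k)) ?p"
  have "lead_coeff ?q = \<kappa> (inverse k) * lead_coeff ?p" by (rule lead_coeff_smult)
  hence "lead_coeff ?q = 1" unfolding deg top kk .
  moreover have "coeffs_in (subalg ?y (V - {l})) ?q"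
  proof (rule coeffs_in_smult[OF S subalg_const])
    show "coeffs_in (subalg ?y (V - {l})) ?p"
      using coeffs_in_shear[OF F(1), of l c] by (auto simp: coeffs_in_def cp subalg_def)
  qed
  moreover have "poly ?q (y l) = 0" using z by simp
  ultimately show ?thesis unfolding integral_over_def by blast
qed

text \<open>The last element is eliminated repeatedly. Only multiples of later elements are ever
  subtracted, whence the control of \<open>y' i - y i\<close>: in \<open>psi_exists\<close> these
  later elements are variables, so each z g_i is altered by a linear form in x alone.\<close>

lemma noether_normalization:
  fixes \<kappa> :: "'k::alg_closed_field \<Rightarrow> 'r::idom" and y :: "nat \<Rightarrow> 'r"
  assumes "kalg \<kappa>" "kalg.growth_le \<kappa> (y ` {1..l}) s" "s \<le> l"
  shows "\<exists>y' B. (\<forall>i. y' i - y i \<in> module.span (\<lambda>c x. \<kappa> c * x) (y ` {s<..l})) \<and>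
    finite_ext (kalg.subalg \<kappa> y' {1..s}) B \<and> y ` {1..l} \<subseteq> B"
proof -
  interpret kalg \<kappa> by fact
  have "\<exists>y' B. (\<forall>i. y' i - y i \<in> vs.span (y ` {s<..l})) \<and> finite_ext (subalg y' {1..s}) B \<and> y ` {1..l} \<subseteq> B"
    using assms(3,2)
  proof (induction l arbitrary: y rule: dec_induct)
    case base
    have 1: "finite_ext (subalg y {1..s}) (subalg y {1..s})" by (rule finite_ext_refl[OF is_subring_subalg])
    have 2: "y ` {1..s} \<subseteq> subalg y {1..s}" by (intro image_subsetI subalg_base)
    have 3: "\<forall>i. y i - y i \<in> vs.span (y ` {s<..s})" by (simp add: vs.span_zero)
    show ?case by (rule exI[of _ y], rule exI[of _ "subalg y {1..s}"]) (intro conjI 1 2 3)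
  next
    case (step l)
    let ?L = "Suc l"
    have "s + 1 \<le> card {1..?L}" using step.hyps by simp
    from growth_relation[OF _ step.prems this] obtain F where F: "F \<noteq> 0" "F \<in> polysV {1..?L}" "mp_subst \<kappa> y F = 0"
      by auto
    from shear_monic[OF F(1)] obtain c k where ck: "k \<noteq> 0" "lead_coeff (shear ?L c F) = mp_const k" by blast
    define y1 where "y1 v = y v - \<kappa> (c v) * y ?L" for v
    have int: "integral_over (subalg y1 {1..l}) (y ?L)"
    proof -
      have "{1..?L} - {?L} = {1..l}" by auto
      thus ?thesis using noether_step[OF F(2,3) _ ck(2,1)] by (simp add: y1_def[abs_def])
    qed
    have y1span: "y1 v \<in> vs.span (y ` W)" if "v \<in> W" "?L \<in> W" for v W
      unfolding y1_def using that by (intro vs.span_diff vs.span_scale vs.span_base) auto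
    have "growth_le (y1 ` {1..l}) s"
    proof (rule growth_span[OF _ step.prems])
      have "y ` {1..?L} \<subseteq> vs.span (products (y ` {1..?L}) 1)" using products_base[of _ "y ` {1..?L}" 0] vs.span_base by force
      hence "vs.span (y ` {1..?L}) \<subseteq> vs.span (products (y ` {1..?L}) 1)" by (intro vs.span_minimal) auto
      moreover have "y1 v \<in> vs.span (y ` {1..?L})" if "v \<in> {1..l}" for v
        using that by (intro y1span) auto
      ultimately show "y1 ` {1..l} \<subseteq> vs.span (products (y ` {1..?L}) 1)" by blast
    qed simp
    from step.IH[OF this] obtain y' B where y': "\<And>i. y' i - y1 i \<in> vs.span (y1 ` {s<..l})"
      "finite_ext (subalg y' {1..s}) B" "y1 ` {1..l} \<subseteq> B" by blast
    have B: "is_subring B" "subalg y' {1..s} \<subseteq> B" using y'(2) by (auto simp: finite_ext_def)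
    have "subalg y1 {1..l} \<subseteq> B" using B subalg_const[of _ y' "{1..s}"] y'(3) by (intro subalg_subset) auto
    from finite_ext_adjoin[OF is_subring_subalg y'(2) integral_over_mono[OF this int]]
    obtain B' where B': "finite_ext (subalg y' {1..s}) B'" "B \<subseteq> B'" "y ?L \<in> B'" by blast
    have sB': "is_subring B'" using B'(1) by (simp add: finite_ext_def)
    have "y v \<in> B'" if v: "v \<in> {1..?L}" for v
    proof (cases "v = ?L")
      case False
      hence "v \<in> {1..l}" using v by auto
      hence "y1 v \<in> B'" using y'(3) B'(2) by blast
      moreover have "\<kappa> (c v) \<in> B'" using subalg_const[of "c v" y' "{1..s}"] B(2) B'(2) by blast
      moreover have "y v = y1 v + \<kappa> (c v) * y ?L" by (simp add: y1_def)
      ultimately show ?thesis using is_subringD(3,5)[OF sB'] B'(3) by metis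
    qed (use B' in simp)
    moreover have "y' i - y i \<in> vs.span (y ` {s<..?L})" for i
    proof -
      have "y1 ` {s<..l} \<subseteq> vs.span (y ` {s<..?L})" using step.hyps by (auto intro!: y1span)
      hence "vs.span (y1 ` {s<..l}) \<subseteq> vs.span (y ` {s<..?L})" by (intro vs.span_minimal) auto
      hence "y' i - y1 i \<in> vs.span (y ` {s<..?L})" using y'(1) by blast
      moreover have "y1 i - y i \<in> vs.span (y ` {s<..?L})"
        unfolding y1_def using step.hyps by (simp add: vs.span_neg vs.span_scale vs.span_base)
      ultimately show ?thesis using vs.span_add by fastforce
    qed
    ultimately show ?case using B'(1) by blast
  qed
  thus ?thesis .
qed

text \<open>By maximality every element outside the independent set \<open>B\<close> is algebraic
  over it, so adjoining it keeps the growth exponent \<open>card B\<close>.\<close>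

lemma trdeg_growth:
  fixes S :: "'k::field mp set"
  assumes "finite S"
  shows "kalg.growth_le mp_const S (trdeg S)"
proof -
  interpret kalg "mp_const :: 'k \<Rightarrow> 'k mp" by (rule kalg_const)
  define B where "B = (SOME B. max_alg_independent_subset S B)"
  have "\<exists>B. max_alg_independent_subset S B"
  proof -
    let ?I = "{B. B \<subseteq> S \<and> alg_independent B}"
    have "alg_independent ({} :: 'k mp set)"
      unfolding alg_independent_def
    proof (intro allI impI)
      fix P :: "('k mp, 'k) mpolynomial"
      assume "mp_vars P \<subseteq> {}" and z: "mp_subst mp_const (\<lambda>g. g) P = 0"
      hence "keys P \<subseteq> {0}" by (auto simp: mp_vars_def)
      hence e: "P = mp_const (lookup P 0)"
        by (intro poly_mapping_eqI) (auto simp: mp_const_def lookup_single when_def in_keys_iff)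
      have "mp_const (lookup P 0) = (0 :: 'k mp)"
        using z subst_const[of "\<lambda>g. g" "lookup P 0"] e by simp
      thus "P = 0" using e by simp
    qed
    hence "{} \<in> ?I" by simp
    moreover have "finite ?I" using assms by simp
    ultimately obtain B where "B \<in> ?I" "\<forall>C\<in>?I. B \<subseteq> C \<longrightarrow> B = C"
      using finite_has_maximal[of ?I] by blast
    thus ?thesis unfolding max_alg_independent_subset_def by blast
  qed
  hence B: "max_alg_independent_subset S B" unfolding B_def by (rule someI_ex)
  have fB: "finite B" using B assms finite_subset by (auto simp: max_alg_independent_subset_def)
  have indep: "mp_subst mp_const (\<lambda>g. g) Q \<noteq> 0" if "Q \<in> polysV B" "Q \<noteq> 0" for Q
    using B that by (auto simp: max_alg_independent_subset_def alg_independent_def polysV_def)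
  have main: "growth_le (B \<union> U) (card B)" if "finite U" "U \<subseteq> S" for U
    using that
  proof (induction U rule: finite_induct)
    case empty
    thus ?case using growth_finite[OF fB] by simp
  next
    case (insert u U)
    hence IH: "growth_le (B \<union> U) (card B)" by simp
    show ?case
    proof (cases "u \<in> B")
      case True
      thus ?thesis using IH by (simp add: insert_absorb)
    next
      case False
      hence "\<not> alg_independent (insert u B)"
        using B insert.prems by (auto simp: max_alg_independent_subset_def)
      then obtain P where P: "P \<noteq> 0" "P \<in> polysV (insert u B)" "mp_subst mp_const (\<lambda>g. g) P = 0"
        by (auto simp: alg_independent_def polysV_def)
      have "growth_le (insert u (B \<union> U)) (card B)"
        by (rule growth_insert_dependent[OF P(1,2) False P(3) indep _ _ IH]) (use fB insert.hyps in auto)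
      thus ?thesis by simp
    qed
  qed
  have "B \<union> S = S" using B by (auto simp: max_alg_independent_subset_def)
  hence "growth_le S (card B)" using main[OF assms order_refl] by simp
  thus ?thesis unfolding trdeg_def B_def .
qed

text \<open>The degree of \<open>p\<close> is at most \<open>D - e\<close>, phrased additively to
  avoid truncated subtraction; the zero cofactor satisfies it even when \<open>e\<close> exceeds
  \<open>D\<close>. In use, \<open>e\<close> is the degree bound of the generator that
  \<open>p\<close> multiplies.\<close>

definition cofactor_le :: "nat \<Rightarrow> nat \<Rightarrow> 'k::zero mp \<Rightarrow> bool" where
  "cofactor_le D e p \<longleftrightarrow> (\<forall>m\<in>keys p. wdeg (\<lambda>_. 1) m + e \<le> D)"

lemma cofactor_le_0 [simp]: "cofactor_le D e 0"
  by (simp add: cofactor_le_def)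

lemma cofactor_le_add: "cofactor_le D e p \<Longrightarrow> cofactor_le D e q \<Longrightarrow> cofactor_le D e (p + q)"
  unfolding cofactor_le_def using Poly_Mapping.keys_add[of p q] by blast

lemma cofactor_le_sum: "(\<And>i. i \<in> A \<Longrightarrow> cofactor_le D e (f i)) \<Longrightarrow> cofactor_le D e (sum f A)"
  by (induction A rule: infinite_finite_induct) (auto intro: cofactor_le_add)

lemma cofactor_le_mult: "cofactor_le D e p \<Longrightarrow> wdeg_le (\<lambda>_. 1) k q \<Longrightarrow> cofactor_le (D + k) e (p * q)"
  unfolding cofactor_le_def wdeg_le_def using Poly_Mapping.keys_mult[of p q] by (fastforce simp: wdeg_add)

lemma cofactor_le_smult: "cofactor_le D e p \<Longrightarrow> cofactor_le D e (mp_const c * p)"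
  for p :: "'k::field mp"
  using cofactor_le_mult[of D e p 0 "mp_const c"] by (simp add: mult.commute)

lemma cofactor_le_mono: "cofactor_le D e p \<Longrightarrow> e' \<le> e \<Longrightarrow> D \<le> D' \<Longrightarrow> cofactor_le D' e' p"
  unfolding cofactor_le_def by fastforce

text \<open>A homogeneous relation between more than \<open>s + 1\<close> polynomials allows to drop the last one:
  after a triangular change, its powers lie in the ideal of the others. The triangular shape keeps
  the degree bounds, and \<open>cofactor_le\<close> keeps track of the degrees of the cofactors.\<close>

lemma reduce_generators:
  fixes f :: "nat \<Rightarrow> 'k::alg_closed_field mp"
  assumes "\<forall>i\<in>{1..m}. f i \<in> polysV V \<and> wdeg_le (\<lambda>_. 1) (d i) (f i)"
    and "\<forall>i\<in>{1..m}. \<forall>j\<in>{1..m}. i \<le> j \<longrightarrow> d j \<le> (d i :: nat)"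
    and "kalg.growth_le mp_const (f ` {1..m}) s"
    and "\<forall>a. \<exists>i\<in>{1..m}. mp_eval a (f i) \<noteq> 0"
  shows "\<exists>m' g. m' \<le> m \<and> m' \<le> s + 1 \<and>
    (\<forall>i\<in>{1..m'}. g i \<in> polysV V \<and> wdeg_le (\<lambda>_. 1) (d i) (g i)) \<and>
    (\<forall>a. \<exists>i\<in>{1..m'}. mp_eval a (g i) \<noteq> 0) \<and>
    (\<forall>D h. (\<forall>i\<in>{1..m'}. h i \<in> polysV V \<and> cofactor_le D (d i) (h i)) \<longrightarrow>
      (\<exists>h'. (\<forall>i\<in>{1..m}. h' i \<in> polysV V \<and> cofactor_le D (d i) (h' i)) \<and>
        (\<Sum>i\<in>{1..m}. f i * h' i) = (\<Sum>i\<in>{1..m'}. g i * h i)))"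
  using assms
proof (induction m arbitrary: f)
  case 0
  thus ?case by (intro exI[of _ 0]) auto
next
  case (Suc m)
  interpret kalg "mp_const :: 'k \<Rightarrow> 'k mp" by (rule kalg_const)
  have V: "is_subring (polysV V :: 'k mp set)" by (rule is_subring_polysV)
  show ?case
  proof (cases "Suc m \<le> s + 1")
    case True
    thus ?thesis using Suc.prems by (intro exI[of _ "Suc m"] exI[of _ f]) blast
  next
    case False
    let ?L = "Suc m"
    have "s + 2 \<le> card {1..?L}" using False by simp
    from growth_relation_homogeneous[OF _ Suc.prems(3) this] obtain F E where
      F: "F \<noteq> 0" "F \<in> polysV {1..?L}" "\<forall>m\<in>keys F. wdeg (\<lambda>_. 1) m = E" "mp_subst mp_const f F = 0"
      by auto
    from homogeneous_nonzero_at[OF F(1,3)] obtain c where c: "c ?L = 1" "mp_eval c F \<noteq> 0" by blast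
    \<comment> \<open>Multiples of the last generator are subtracted from the earlier ones; it has
      the smallest degree bound, so none of the bounds \<open>d i\<close> is violated.\<close>
    define f1 where "f1 i = f i - mp_const (c i) * f ?L" for i
    have f1: "f1 i \<in> polysV V \<and> wdeg_le (\<lambda>_. 1) (d i) (f1 i)" if i: "i \<in> {1..m}" for i
    proof -
      have fi: "f i \<in> polysV V" "wdeg_le (\<lambda>_. 1) (d i) (f i)" "f ?L \<in> polysV V" "wdeg_le (\<lambda>_. 1) (d ?L) (f ?L)"
        using Suc.prems(1)[rule_format, of i] Suc.prems(1)[rule_format, of ?L] i by auto
      have "d ?L \<le> d i" using Suc.prems(2)[rule_format, of i ?L] i by auto
      hence "wdeg_le (\<lambda>_. 1) (d i) (f ?L)" using wdeg_le_mono[OF fi(4)] by blast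
      moreover have "mp_const (c i) \<in> polysV V" by (simp add: polysV_def)
      ultimately show ?thesis unfolding f1_def
        using fi by (intro conjI is_subringD(4)[OF V] is_subringD(5)[OF V] wdeg_le_diff wdeg_le_smult)
    qed
    have fspan: "f i \<in> vs.span (products (f ` {1..?L}) 1)" if "i \<in> {1..?L}" for i
      using products_base[of "f i" "f ` {1..?L}" 0] that by (intro vs.span_base) auto
    have grf1: "growth_le (f1 ` {1..m}) s"
    proof (rule growth_span[OF _ Suc.prems(3)])
      show "f1 ` {1..m} \<subseteq> vs.span (products (f ` {1..?L}) 1)"
      proof (intro image_subsetI)
        fix i assume "i \<in> {1..m}"
        thus "f1 i \<in> vs.span (products (f ` {1..?L}) 1)"
          unfolding f1_def by (intro vs.span_diff vs.span_scale fspan) auto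
      qed
    qed simp
    \<comment> \<open>At a common zero of \<open>f1\<close> the values of all \<open>f i\<close> are
      proportional to \<open>c i\<close> with factor \<open>t\<close>. The homogeneous relation then
      reads \<open>t ^ E * mp_eval c F = 0\<close>, which forces \<open>t = 0\<close>.\<close>
    have nz: "\<exists>i\<in>{1..m}. mp_eval a (f1 i) \<noteq> 0" for a
    proof (rule ccontr)
      interpret e: comm_ring_hom "mp_eval a :: 'k mp \<Rightarrow> 'k" by (rule mp_eval_hom)
      assume neg: "\<not> ?thesis"
      define t where "t = mp_eval a (f ?L)"
      have ft: "mp_eval a (f i) = t * c i" if "i \<in> {1..?L}" for i
      proof (cases "i = ?L")
        case False
        hence "mp_eval a (f1 i) = 0" using neg that by auto
        thus ?thesis by (simp add: f1_def e.hom_minus e.hom_mult t_def)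
      qed (simp add: t_def c)
      have "0 = mp_eval a (mp_subst mp_const f F)" using F(4) by simp
      also have "\<dots> = mp_subst (\<lambda>x. x) (\<lambda>i. mp_eval a (f i)) F"
        using hom_subst[OF mp_eval_hom, of a f F] by simp
      also have "\<dots> = mp_subst (\<lambda>x. x) (\<lambda>i. t * c i) F"
        by (rule kalg.subst_cong[OF kalg_id]) (use F(2) ft in \<open>auto simp: polysV_def\<close>)
      also have "\<dots> = t ^ E * mp_eval c F" using mp_eval_homogeneous[OF F(3), of t c] by (simp add: mp_eval_def)
      finally have "t = 0" using c(2) by auto
      hence "\<forall>i\<in>{1..?L}. mp_eval a (f i) = 0" using ft by auto
      thus False using Suc.prems(4) by blast
    qed
    have f1': "\<forall>i\<in>{1..m}. f1 i \<in> polysV V \<and> wdeg_le (\<lambda>_. 1) (d i) (f1 i)" using f1 by blast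
    have dd: "\<forall>i\<in>{1..m}. \<forall>j\<in>{1..m}. i \<le> j \<longrightarrow> d j \<le> d i"
      using Suc.prems(2) by simp
    have nz': "\<forall>a. \<exists>i\<in>{1..m}. mp_eval a (f1 i) \<noteq> 0" using nz by blast
    from Suc.IH[of f1, OF f1' dd grf1 nz'] obtain m' g where g: "m' \<le> m" "m' \<le> s + 1"
      "\<forall>i\<in>{1..m'}. g i \<in> polysV V \<and> wdeg_le (\<lambda>_. 1) (d i) (g i)" "\<forall>a. \<exists>i\<in>{1..m'}. mp_eval a (g i) \<noteq> 0"
      "\<forall>D h. (\<forall>i\<in>{1..m'}. h i \<in> polysV V \<and> cofactor_le D (d i) (h i)) \<longrightarrow>
        (\<exists>h'. (\<forall>i\<in>{1..m}. h' i \<in> polysV V \<and> cofactor_le D (d i) (h' i)) \<and>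
          (\<Sum>i\<in>{1..m}. f1 i * h' i) = (\<Sum>i\<in>{1..m'}. g i * h i))"
      by (elim exE conjE) (rule that)
    have "\<exists>h'. (\<forall>i\<in>{1..?L}. h' i \<in> polysV V \<and> cofactor_le D (d i) (h' i)) \<and>
          (\<Sum>i\<in>{1..?L}. f i * h' i) = (\<Sum>i\<in>{1..m'}. g i * h i)"
      if h: "\<forall>i\<in>{1..m'}. h i \<in> polysV V \<and> cofactor_le D (d i) (h i)" for D h
    proof -
      from g(5)[rule_format, of h D] h obtain h1 where h1: "\<forall>i\<in>{1..m}. h1 i \<in> polysV V \<and> cofactor_le D (d i) (h1 i)"
        "(\<Sum>i\<in>{1..m}. f1 i * h1 i) = (\<Sum>i\<in>{1..m'}. g i * h i)" by blast
      \<comment> \<open>Undoing the subtraction collects this cofactor on the last generator. It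
        inherits the degree bound because \<open>d\<close> is smallest there.\<close>
      define k where "k = - (\<Sum>i\<in>{1..m}. mp_const (c i) * h1 i)"
      have k: "k = (\<Sum>i\<in>{1..m}. mp_const (- c i) * h1 i)"
        by (simp add: k_def sum_negf[symmetric] hom_uminus)
      define h' where "h' i = (if i = ?L then k else h1 i)" for i
      have "(\<Sum>i\<in>{1..?L}. f i * h' i) = (\<Sum>i\<in>{1..m}. f i * h1 i) + f ?L * k"
        by (simp add: h'_def)
      also have "\<dots> = (\<Sum>i\<in>{1..m}. f1 i * h1 i)"
        by (simp add: k_def f1_def sum_distrib_left algebra_simps sum_subtractf)
      finally have "(\<Sum>i\<in>{1..?L}. f i * h' i) = (\<Sum>i\<in>{1..m'}. g i * h i)" using h1(2) by simp
      moreover have "k \<in> polysV V" unfolding k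
        using h1(1) by (intro is_subring_sum[OF V] is_subringD(5)[OF V]) (auto simp: polysV_def)
      moreover have "cofactor_le D (d ?L) k" unfolding k
      proof (intro cofactor_le_sum cofactor_le_smult)
        fix i assume "i \<in> {1..m}"
        thus "cofactor_le D (d ?L) (h1 i)" using h1(1) Suc.prems(2)[rule_format, of i ?L] cofactor_le_mono[of D "d i" "h1 i" "d ?L" D] by auto
      qed
      ultimately show ?thesis using h1(1) by (intro exI[of _ h']) (auto simp: h'_def)
    qed
    hence "\<forall>D h. (\<forall>i\<in>{1..m'}. h i \<in> polysV V \<and> cofactor_le D (d i) (h i)) \<longrightarrow>
        (\<exists>h'. (\<forall>i\<in>{1..?L}. h' i \<in> polysV V \<and> cofactor_le D (d i) (h' i)) \<and>
          (\<Sum>i\<in>{1..?L}. f i * h' i) = (\<Sum>i\<in>{1..m'}. g i * h i))" by blast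
    with g(1-4) show ?thesis by (intro exI[of _ m'] exI[of _ g] conjI) simp_all
  qed
qed

section \<open>The degree bound by counting monomials\<close>

definition weighted_exps :: "nat \<Rightarrow> (nat \<Rightarrow> nat) \<Rightarrow> nat \<Rightarrow> (nat \<Rightarrow> nat) set" where
  "weighted_exps k w e = {f \<in> {1..k} \<rightarrow>\<^sub>E UNIV. (\<Sum>i\<in>{1..k}. w i * f i) \<le> e}"

lemma weighted_exps_le:
  assumes "\<forall>i\<in>{1..k}. w i \<ge> 1" "f \<in> weighted_exps k w e"
  shows "f \<in> {1..k} \<rightarrow>\<^sub>E {..e}"
proof (rule PiE_I)
  fix i assume i: "i \<in> {1..k}"
  have "1 * f i \<le> w i * f i" using assms(1) i by (intro mult_right_mono) auto
  also have "\<dots> \<le> (\<Sum>i\<in>{1..k}. w i * f i)" by (rule member_le_sum[OF i]) auto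
  finally show "f i \<in> {..e}" using assms(2) by (simp add: weighted_exps_def)
next
  fix i assume "i \<notin> {1..k}"
  thus "f i = undefined" using assms(2) by (auto simp: weighted_exps_def PiE_def extensional_def)
qed

lemma finite_weighted_exps: "\<forall>i\<in>{1..k}. w i \<ge> 1 \<Longrightarrow> finite (weighted_exps k w e)"
  using weighted_exps_le[of k w _ e] by (intro finite_subset[of "weighted_exps k w e" "{1..k} \<rightarrow>\<^sub>E {..e}"] finite_PiE subsetI) simp_all

lemma card_weighted_exps_le: "card (weighted_exps k (\<lambda>_. 1) e) \<le> (e + 1) ^ k"
proof -
  have "card (weighted_exps k (\<lambda>_. 1) e) \<le> card ({1..k} \<rightarrow>\<^sub>E {..e})"
    using weighted_exps_le[of k "\<lambda>_. 1" _ e] by (intro card_mono finite_PiE subsetI) simp_all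
  thus ?thesis by (simp add: card_PiE)
qed

lemma weighted_exps_mono: "e \<le> e' \<Longrightarrow> weighted_exps k w e \<subseteq> weighted_exps k w e'"
  by (auto simp: weighted_exps_def)

text \<open>The new exponent records the slack \<open>E - e\<close>: a vector counted at level
  \<open>e\<close> becomes one in \<open>Suc n\<close> variables of degree at most \<open>E\<close>,
  and \<open>e\<close> can be recovered.\<close>

lemma sum_card_weighted_exps_le: "(\<Sum>e\<le>E. card (weighted_exps n (\<lambda>_. 1) e)) \<le> card (weighted_exps (Suc n) (\<lambda>_. 1) E)"
proof -
  let ?S = "SIGMA e:{..E}. weighted_exps n (\<lambda>_. 1) e"
  let ?h = "\<lambda>(e, f). f(Suc n := E - e)"
  have "(\<Sum>e\<le>E. card (weighted_exps n (\<lambda>_. 1) e)) = card ?S"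
    by (simp add: card_SigmaI finite_weighted_exps)
  also have "\<dots> \<le> card (weighted_exps (Suc n) (\<lambda>_. 1) E)"
  proof (rule card_inj_on_le)
    show "inj_on ?h ?S"
    proof (rule inj_onI)
      fix a b assume ab: "a \<in> ?S" "b \<in> ?S" and eq: "?h a = ?h b"
      obtain e f e' f' where *: "a = (e, f)" "b = (e', f')" by (cases a, cases b) auto
      have "E - e = E - e'" using fun_cong[OF eq, of "Suc n"] by (simp add: *)
      hence "e = e'" using ab by (auto simp: *)
      moreover have "f = f'"
      proof (rule PiE_ext[of f "{1..n}" "\<lambda>_. UNIV" f'])
        fix i assume "i \<in> {1..n}"
        thus "f i = f' i" using fun_cong[OF eq, of i] by (simp add: *)
      qed (use ab in \<open>auto simp: * weighted_exps_def\<close>)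
      ultimately show "a = b" by (simp add: *)
    qed
    show "?h ` ?S \<subseteq> weighted_exps (Suc n) (\<lambda>_. 1) E"
    proof
      fix x assume "x \<in> ?h ` ?S"
      then obtain e f where ef: "x = f(Suc n := E - e)" "e \<le> E" "f \<in> weighted_exps n (\<lambda>_. 1) e" by auto
      have "(\<Sum>i\<in>{1..Suc n}. x i) = (\<Sum>i\<in>{1..n}. f i) + (E - e)"
        by (simp add: ef(1))
      also have "\<dots> \<le> E"
      proof -
        have "(\<Sum>i\<in>{1..n}. f i) \<le> e" using ef(3) by (simp add: weighted_exps_def)
        thus ?thesis using ef(2) by simp
      qed
      finally have "(\<Sum>i\<in>{1..Suc n}. 1 * x i) \<le> E" by (simp only: mult_1)
      moreover have "x \<in> {1..Suc n} \<rightarrow>\<^sub>E UNIV"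
        using ef by (auto simp: weighted_exps_def PiE_def extensional_def)
      ultimately show "x \<in> weighted_exps (Suc n) (\<lambda>_. 1) E" unfolding weighted_exps_def by blast
    qed
    show "finite (weighted_exps (Suc n) (\<lambda>_. 1) E)" by (simp add: finite_weighted_exps)
  qed
  finally show ?thesis .
qed

text \<open>Divide each exponent by its weight with remainder: the quotients have weight at most
  \<open>e\<close>, and there are \<open>\<Prod>w i\<close> vectors of remainders.\<close>

lemma card_weighted_exps_weights:
  assumes "\<forall>i\<in>{1..k}. w i \<ge> 1"
  shows "card (weighted_exps k (\<lambda>_. 1) e) \<le> (\<Prod>i\<in>{1..k}. w i) * card (weighted_exps k w e)"
proof -
  let ?R = "Pi\<^sub>E {1..k} (\<lambda>i. {..<w i})"
  let ?h = "\<lambda>f. (restrict (\<lambda>i. f i div w i) {1..k}, restrict (\<lambda>i. f i mod w i) {1..k})"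
  have "card (weighted_exps k (\<lambda>_. 1) e) \<le> card (weighted_exps k w e \<times> ?R)"
  proof (rule card_inj_on_le)
    show "inj_on ?h (weighted_exps k (\<lambda>_. 1) e)"
    proof (rule inj_onI)
      fix f g assume fg: "f \<in> weighted_exps k (\<lambda>_. 1) e" "g \<in> weighted_exps k (\<lambda>_. 1) e" and eq: "?h f = ?h g"
      show "f = g"
      proof (rule PiE_ext[of f "{1..k}" "\<lambda>_. UNIV" g])
        fix i assume i: "i \<in> {1..k}"
        have r: "restrict (\<lambda>i. f i div w i) {1..k} = restrict (\<lambda>i. g i div w i) {1..k}"
          "restrict (\<lambda>i. f i mod w i) {1..k} = restrict (\<lambda>i. g i mod w i) {1..k}"
          using eq by (simp_all only: prod.inject)
        have "f i div w i = g i div w i" "f i mod w i = g i mod w i"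
          using fun_cong[OF r(1), of i] fun_cong[OF r(2), of i] i by simp_all
        thus "f i = g i" by (metis div_mult_mod_eq)
      qed (use fg in \<open>auto simp: weighted_exps_def\<close>)
    qed
    show "?h ` weighted_exps k (\<lambda>_. 1) e \<subseteq> weighted_exps k w e \<times> ?R"
    proof
      fix x assume "x \<in> ?h ` weighted_exps k (\<lambda>_. 1) e"
      then obtain f where f: "x = ?h f" "f \<in> weighted_exps k (\<lambda>_. 1) e" by auto
      have "(\<Sum>i\<in>{1..k}. w i * (f i div w i)) \<le> (\<Sum>i\<in>{1..k}. f i)"
        by (intro sum_mono) simp
      also have "\<dots> \<le> e" using f(2) by (simp add: weighted_exps_def)
      finally have "(\<Sum>i\<in>{1..k}. w i * (f i div w i)) \<le> e" .
      hence "restrict (\<lambda>i. f i div w i) {1..k} \<in> weighted_exps k w e" by (simp add: weighted_exps_def)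
      moreover have "restrict (\<lambda>i. f i mod w i) {1..k} \<in> ?R"
        using assms by (auto simp: Suc_le_eq)
      ultimately show "x \<in> weighted_exps k w e \<times> ?R" using f(1) by simp
    qed
    show "finite (weighted_exps k w e \<times> ?R)" using finite_weighted_exps[OF assms] by (simp add: finite_PiE)
  qed
  also have "\<dots> = (\<Prod>i\<in>{1..k}. w i) * card (weighted_exps k w e)"
    by (simp add: card_cartesian_product card_PiE mult.commute)
  finally show ?thesis .
qed

text \<open>The hypothesis multiplies \<open>N\<close> by at least (D + 1) / D over each stretch of
  length \<open>w\<close>, which contradicts a polynomial bound.\<close>

lemma no_geometric_growth:
  fixes N :: "nat \<Rightarrow> nat"
  assumes "D \<ge> 1" "N 0 \<ge> 1" "\<And>e. (D + 1) * N e \<le> D * N (e + w)" "\<And>e. N e \<le> (e + 1) ^ k"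
  shows False
proof -
  have pow: "(D + 1) ^ j \<le> D ^ j * N (j * w)" for j
  proof (induction j)
    case (Suc j)
    have "(D + 1) ^ Suc j \<le> (D + 1) * (D ^ j * N (j * w))"
      using mult_le_mono2[OF Suc, of "D + 1"] by (simp only: power_Suc)
    also have "\<dots> = D ^ j * ((D + 1) * N (j * w))" by (simp only: ac_simps)
    also have "\<dots> \<le> D ^ j * (D * N (j * w + w))" using assms(3) by (intro mult_left_mono) auto
    finally show ?case by (simp add: ac_simps)
  qed (use assms(2) in simp)
  \<comment> \<open>A division-free Bernoulli inequality: after \<open>i\<close> stretches the gain
    is at least \<open>i / D\<close>.\<close>
  have bern: "i * D ^ i \<le> D * (D + 1) ^ i" for i
  proof (induction i)
    case (Suc i)
    have "D ^ i \<le> (D + 1) ^ i" by (intro power_mono) auto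
    hence "D * (i * D ^ i) + D * D ^ i \<le> D * (D * (D + 1) ^ i) + D * (D + 1) ^ i"
      using Suc by (intro add_mono mult_left_mono) auto
    thus ?case by (simp add: algebra_simps)
  qed simp
  \<comment> \<open>Taking \<open>k + 1\<close> blocks of \<open>i\<close> stretches gives a gain of
    order \<open>i ^ (k + 1)\<close> against a bound of order \<open>i ^ k\<close>; the later choice
    of \<open>i\<close> just exceeds the constants.\<close>
  define s where "s = k + 1"
  define C where "C = (s * w + 1) ^ k"
  define i where "i = D ^ s * C + 1"
  have i1: "i \<ge> 1" by (simp add: i_def)
  have "i ^ s * D ^ (i * s) = (i * D ^ i) ^ s" by (simp add: power_mult_distrib power_mult)
  also have "\<dots> \<le> (D * (D + 1) ^ i) ^ s" by (intro power_mono bern) auto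
  also have "\<dots> = D ^ s * (D + 1) ^ (i * s)" by (simp add: power_mult_distrib power_mult)
  also have "\<dots> \<le> D ^ s * (D ^ (i * s) * N (i * s * w))" by (intro mult_left_mono pow) auto
  also have "\<dots> \<le> D ^ s * (D ^ (i * s) * (C * i ^ k))"
  proof (intro mult_left_mono)
    have "N (i * s * w) \<le> (i * s * w + 1) ^ k" by (rule assms(4))
    also have "\<dots> \<le> ((s * w + 1) * i) ^ k" using i1 by (intro power_mono) (auto simp: algebra_simps)
    also have "\<dots> = C * i ^ k" by (simp only: C_def power_mult_distrib)
    finally show "N (i * s * w) \<le> C * i ^ k" .
  qed auto
  finally have "D ^ (i * s) * (i ^ k * i) \<le> D ^ (i * s) * (i ^ k * (D ^ s * C))"
    by (simp add: s_def ac_simps)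
  hence "i ^ k * i \<le> i ^ k * (D ^ s * C)" using assms(1) by simp
  hence "i \<le> D ^ s * C" using i1 by simp
  thus False by (simp add: i_def)
qed

text \<open>The counting core of Perron's bound; \<open>\<gamma>\<close> will be the leading exponent of an algebraic relation.\<close>

lemma weight_le_prod:
  assumes w1: "\<forall>i\<in>{1..Suc n}. w i \<ge> 1"
    and few: "\<And>e. card {f \<in> weighted_exps (Suc n) w e. \<not> (\<forall>i\<in>{1..Suc n}. \<gamma> i \<le> f i)} \<le> card (weighted_exps n (\<lambda>_. 1) e)"
  shows "(\<Sum>i\<in>{1..Suc n}. w i * \<gamma> i) \<le> (\<Prod>i\<in>{1..Suc n}. w i)"
proof (rule ccontr)
  let ?k = "Suc n"
  define W where "W = (\<Sum>i\<in>{1..?k}. w i * \<gamma> i)"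
  define D where "D = (\<Prod>i\<in>{1..?k}. w i)"
  assume "\<not> ?thesis"
  hence WD: "W \<ge> D + 1" by (simp add: W_def D_def)
  have D1: "D \<ge> 1" unfolding D_def using w1 by (intro prod_ge_1) auto
  define P where "P e = card (weighted_exps ?k w e)" for e
  define N where "N e = card (weighted_exps n (\<lambda>_. 1) e)" for e
  define N1 where "N1 e = card (weighted_exps ?k (\<lambda>_. 1) e)" for e
  have Pmono: "P e \<le> P e'" if "e \<le> e'" for e e'
    unfolding P_def by (intro card_mono finite_weighted_exps[OF w1] weighted_exps_mono that)
  \<comment> \<open>Exponent vectors of weight at most \<open>e\<close> that dominate
    \<open>\<gamma>\<close> correspond by translation to those of weight at most
    \<open>e - W\<close>; the others are limited by \<open>few\<close>.\<close>
  have step: "P e \<le> N e + (if W \<le> e then P (e - W) else 0)" for e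
  proof -
    let ?A = "{f \<in> weighted_exps ?k w e. \<not> (\<forall>i\<in>{1..?k}. \<gamma> i \<le> f i)}"
    let ?B = "{f \<in> weighted_exps ?k w e. \<forall>i\<in>{1..?k}. \<gamma> i \<le> f i}"
    have fin: "finite ?A" "finite ?B" using finite_weighted_exps[OF w1] by auto
    have eq: "weighted_exps ?k w e = ?A \<union> ?B" by auto
    have "P e = card (?A \<union> ?B)" unfolding P_def by (rule arg_cong[OF eq])
    hence "P e \<le> card ?A + card ?B" using card_Un_le[of ?A ?B] by linarith
    moreover have "card ?B \<le> (if W \<le> e then P (e - W) else 0)"
    proof (cases "W \<le> e")
      case True
      let ?h = "\<lambda>f. restrict (\<lambda>i. f i - \<gamma> i) {1..?k}"
      have "card ?B \<le> P (e - W)"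
        unfolding P_def
      proof (rule card_inj_on_le)
        show "inj_on ?h ?B"
        proof (rule inj_onI)
          fix f g assume fg: "f \<in> ?B" "g \<in> ?B" and eq: "?h f = ?h g"
          show "f = g"
          proof (rule PiE_ext[of f "{1..?k}" "\<lambda>_. UNIV" g])
            fix i assume i: "i \<in> {1..?k}"
            have "f i - \<gamma> i = g i - \<gamma> i" using fun_cong[OF eq, of i] i by simp
            moreover have "\<gamma> i \<le> f i" "\<gamma> i \<le> g i" using fg i by auto
            ultimately show "f i = g i" by linarith
          qed (use fg in \<open>auto simp: weighted_exps_def\<close>)
        qed
        show "?h ` ?B \<subseteq> weighted_exps ?k w (e - W)"
        proof
          fix x assume "x \<in> ?h ` ?B"
          then obtain f where f: "x = ?h f" "f \<in> ?B" by auto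
          have "(\<Sum>i\<in>{1..?k}. w i * (f i - \<gamma> i)) + W = (\<Sum>i\<in>{1..?k}. w i * f i)"
            unfolding W_def sum.distrib[symmetric] using f(2)
            by (intro sum.cong refl) (auto simp: distrib_left[symmetric])
          also have "\<dots> \<le> e" using f(2) by (simp add: weighted_exps_def)
          finally have "(\<Sum>i\<in>{1..?k}. w i * (f i - \<gamma> i)) \<le> e - W" by simp
          hence "(\<Sum>i\<in>{1..?k}. w i * x i) \<le> e - W" by (simp add: f(1))
          thus "x \<in> weighted_exps ?k w (e - W)" using f(1) by (simp add: weighted_exps_def)
        qed
        show "finite (weighted_exps ?k w (e - W))" by (rule finite_weighted_exps[OF w1])
      qed
      thus ?thesis using True by simp
    next
      case False
      have "f \<notin> ?B" for f
      proof
        assume f: "f \<in> ?B"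
        hence "W \<le> (\<Sum>i\<in>{1..?k}. w i * f i)" unfolding W_def by (intro sum_mono mult_left_mono) auto
        also have "\<dots> \<le> e" using f by (simp add: weighted_exps_def)
        finally show False using False by simp
      qed
      hence e: "?B = {}" by blast
      show ?thesis unfolding e by simp
    qed
    moreover have "card ?A \<le> N e" unfolding N_def by (rule few)
    ultimately show ?thesis by linarith
  qed
  \<comment> \<open>Summing the recursion telescopes in steps of \<open>W\<close>, so that exactly
    the last \<open>W\<close> values of \<open>P\<close> remain on the left. The case distinctions
    cut off negative arguments.\<close>
  have tel: "(\<Sum>j<W. if j \<le> E then P (E - j) else 0) \<le> (\<Sum>e\<le>E. N e)" for E
  proof (induction E)
    case 0
    have "(\<Sum>j<W. if j \<le> 0 then P (0 - j) else 0) = P 0"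
      using WD by (subst sum.mono_neutral_right[of _ "{0}"]) auto
    also have "\<dots> \<le> N 0" using step[of 0] WD by simp
    finally show ?case by simp
  next
    case (Suc E)
    obtain W' where W': "W = Suc W'" using WD by (cases W) auto
    have "(\<Sum>j<W. if j \<le> Suc E then P (Suc E - j) else 0) =
        P (Suc E) + (\<Sum>j<W'. if j \<le> E then P (E - j) else 0)"
      unfolding W' by (subst sum.lessThan_Suc_shift) (simp cong: if_cong)
    also have "\<dots> \<le> N (Suc E) + (if W' \<le> E then P (E - W') else 0) + (\<Sum>j<W'. if j \<le> E then P (E - j) else 0)"
    proof -
      have "(if W \<le> Suc E then P (Suc E - W) else 0) = (if W' \<le> E then P (E - W') else 0)"
        by (simp add: W' cong: if_cong)
      thus ?thesis using step[of "Suc E"] by linarith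
    qed
    also have "\<dots> = N (Suc E) + (\<Sum>j<W. if j \<le> E then P (E - j) else 0)"
      by (simp add: W')
    also have "\<dots> \<le> N (Suc E) + (\<Sum>e\<le>E. N e)" using Suc by simp
    finally show ?case by simp
  qed
  \<comment> \<open>The window of \<open>W\<close> values of \<open>P\<close> ending at
    \<open>e + W\<close> is bounded below by \<open>W * P e\<close> and above by
    \<open>N1 (e + W)\<close>. Since \<open>D * P e\<close> is at least \<open>N1 e\<close>, a
    weight \<open>W > D\<close> makes \<open>N1\<close> grow geometrically.\<close>
  have main: "(D + 1) * N1 e \<le> D * N1 (e + W)" for e
  proof -
    have "W * P e = (\<Sum>j<W. P e)" by simp
    also have "\<dots> \<le> (\<Sum>j<W. if j \<le> e + W then P (e + W - j) else 0)"
      by (intro sum_mono) (auto intro!: Pmono)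
    also have "\<dots> \<le> (\<Sum>e\<le>e + W. N e)" by (rule tel)
    also have "\<dots> \<le> N1 (e + W)" unfolding N_def N1_def by (rule sum_card_weighted_exps_le)
    finally have 1: "W * P e \<le> N1 (e + W)" .
    have "(D + 1) * N1 e \<le> W * (D * P e)"
      using WD card_weighted_exps_weights[OF w1, of e] unfolding N1_def D_def P_def by (intro mult_mono) auto
    also have "\<dots> = D * (W * P e)" by simp
    also have "\<dots> \<le> D * N1 (e + W)" by (intro mult_left_mono 1) simp
    finally show ?thesis .
  qed
  have "N1 0 \<ge> 1"
  proof -
    have "restrict (\<lambda>_. 0) {1..?k} \<in> weighted_exps ?k (\<lambda>_. 1) 0" by (simp add: weighted_exps_def)
    hence "weighted_exps ?k (\<lambda>_. 1) 0 \<noteq> {}" by blast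
    moreover have "finite (weighted_exps ?k (\<lambda>_. 1) 0)" by (simp add: finite_weighted_exps)
    ultimately show ?thesis unfolding N1_def by (simp add: Suc_le_eq card_gt_0_iff)
  qed
  from no_geometric_growth[OF D1 this main] card_weighted_exps_le show False unfolding N1_def by blast
qed

text \<open>Specializing z to a constant reduces the claim to leading monomials of products in k[x].
  The constant avoids the roots of two univariate polynomials, so that \<open>\<gamma>\<close>
  survives in \<open>P\<close> and \<open>S\<close> stays nonzero.\<close>

lemma leading_monomial_of_multiple:
  fixes P S :: "'k::alg_closed_field mp poly"
  assumes \<gamma>: "\<gamma> \<in> keys (coeff P b)"
    "\<And>i m. m \<in> keys (coeff P i) \<Longrightarrow> m \<noteq> \<gamma> \<Longrightarrow> monom_key w m < monom_key w \<gamma>"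
    and S: "S \<noteq> 0"
  shows "\<exists>i \<sigma>. \<gamma> + \<sigma> \<in> keys (coeff (P * S) i)"
proof -
  define cf where "cf Q \<alpha> = map_poly (\<lambda>q. lookup q \<alpha>) Q" for Q :: "'k mp poly" and \<alpha>
  have at: "lookup (poly Q (mp_const t)) \<alpha> = poly (cf Q \<alpha>) t" for Q :: "'k mp poly" and t \<alpha>
  proof (induction Q)
    case (pCons a Q)
    have "lookup (poly (pCons a Q) (mp_const t)) \<alpha> = lookup a \<alpha> + t * poly (cf Q \<alpha>) t"
      by (simp add: lookup_add lookup_const_mult pCons)
    moreover have "cf (pCons a Q) \<alpha> = pCons (lookup a \<alpha>) (cf Q \<alpha>)"
      unfolding cf_def by (intro poly_eqI) (simp add: coeff_map_poly coeff_pCons split: nat.split)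
    ultimately show ?case by simp
  qed (simp add: cf_def)
  have ccf: "coeff (cf Q \<alpha>) i = lookup (coeff Q i) \<alpha>" for Q \<alpha> i
    by (simp add: cf_def coeff_map_poly)
  have keys_at: "\<exists>i. m \<in> keys (coeff Q i)" if "m \<in> keys (poly Q (mp_const t))" for Q :: "'k mp poly" and t m
  proof (rule ccontr)
    assume "\<not> ?thesis"
    hence "cf Q m = 0" by (intro poly_eqI) (simp add: ccf in_keys_iff)
    thus False using that at[of Q t m] by (simp add: in_keys_iff)
  qed
  obtain j where "coeff S j \<noteq> 0" using S by (auto simp: poly_eq_iff)
  then obtain \<sigma>0 where "lookup (coeff S j) \<sigma>0 \<noteq> 0" by (metis poly_mapping_eqI lookup_zero)
  hence "cf S \<sigma>0 \<noteq> 0" using ccf[of S \<sigma>0 j] by auto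
  moreover have "cf P \<gamma> \<noteq> 0" using \<gamma>(1) ccf[of P \<gamma> b] by (auto simp: in_keys_iff)
  ultimately have "cf P \<gamma> * cf S \<sigma>0 \<noteq> 0" by simp
  then obtain t where "poly (cf P \<gamma> * cf S \<sigma>0) t \<noteq> 0" using poly_nonzero_at by blast
  hence t: "poly (cf P \<gamma>) t \<noteq> 0" "poly (cf S \<sigma>0) t \<noteq> 0" by auto
  have "poly S (mp_const t) \<noteq> 0" using t(2) at[of S t \<sigma>0] by auto
  then obtain \<sigma> where \<sigma>: "is_lead_monom w (poly S (mp_const t)) \<sigma>" using is_lead_monom_exists by blast
  have "is_lead_monom w (poly P (mp_const t)) \<gamma>"
    unfolding is_lead_monom_def
  proof (intro conjI ballI impI)
    show "\<gamma> \<in> keys (poly P (mp_const t))" using t(1) at[of P t \<gamma>] by (simp add: in_keys_iff)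
    fix m assume "m \<in> keys (poly P (mp_const t))" "m \<noteq> \<gamma>"
    with keys_at[of m P t] \<gamma>(2) show "monom_key w m < monom_key w \<gamma>" by blast
  qed
  from is_lead_monom_mult(1)[OF this \<sigma>] have "\<gamma> + \<sigma> \<in> keys (poly (P * S) (mp_const t))"
    by (simp add: is_lead_monom_def)
  thus ?thesis using keys_at by blast
qed

text \<open>The degree in x and the degree in z are kept apart: the first is matched with the
  weight, while the second only has to grow by at most 1 with each factor.\<close>

definition bidegree_le :: "nat set \<Rightarrow> nat \<Rightarrow> nat \<Rightarrow> 'k::field mp poly \<Rightarrow> bool" where
  "bidegree_le V e c Q \<longleftrightarrow> degree Q \<le> c \<and> (\<forall>i. coeff Q i \<in> polysV V \<and> wdeg_le (\<lambda>_. 1) e (coeff Q i))"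

lemma bidegree_le_mult: "bidegree_le V e c Q \<Longrightarrow> bidegree_le V e' c' Q' \<Longrightarrow> bidegree_le V (e + e') (c + c') (Q * Q')"
  unfolding bidegree_le_def coeff_mult
  by (auto intro!: is_subring_sum[OF is_subring_polysV] is_subringD(5)[OF is_subring_polysV] wdeg_le_sum wdeg_le_mult
      intro: order_trans[OF degree_mult_le] add_mono)

lemma bidegree_le_1: "bidegree_le V e c 1"
  by (auto simp: bidegree_le_def coeff_1 polysV_def mp_vars_def)

lemma bidegree_le_mono: "bidegree_le V e c Q \<Longrightarrow> e \<le> e' \<Longrightarrow> c \<le> c' \<Longrightarrow> bidegree_le V e' c' Q"
  unfolding bidegree_le_def using wdeg_le_mono by fastforce

lemma bidegree_le_power: "bidegree_le V e c Q \<Longrightarrow> bidegree_le V (e * k) (c * k) (Q ^ k)"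
proof (induction k)
  case (Suc k)
  from bidegree_le_mult[OF Suc.prems Suc.IH[OF Suc.prems]] show ?case by simp
qed (simp add: bidegree_le_1)

lemma bidegree_le_mon:
  assumes "\<And>i. i \<in> keys m \<Longrightarrow> bidegree_le V (w i) 1 (y i)"
  shows "bidegree_le V (wdeg w m) (wdeg (\<lambda>_. 1) m) (monom_eval y m)"
proof -
  have "bidegree_le V (\<Sum>i\<in>A. w i * lookup m i) (\<Sum>i\<in>A. 1 * lookup m i)
     (\<Prod>i\<in>A. y i ^ lookup m i)" if "finite A" "A \<subseteq> keys m" for A
    using that
  proof (induction A rule: finite_induct)
    case (insert i A)
    have "bidegree_le V (w i * lookup m i) (1 * lookup m i) (y i ^ lookup m i)"
      using insert.prems by (intro bidegree_le_power assms) auto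
    from bidegree_le_mult[OF this insert.IH] insert.prems insert.hyps show ?case by simp
  qed (simp add: bidegree_le_1)
  from this[OF finite_keys order_refl] show ?thesis by (simp add: wdeg_def monom_eval_def)
qed

lemma bidegree_le_in_span:
  fixes Q :: "'k::field mp poly"
  assumes "bidegree_le {1..n} e c Q"
  shows "Q \<in> module.span (\<lambda>c x. pconst c * x)
    ((\<lambda>(f, i). monom (single (monom_of {1..n} f) 1) i) ` (weighted_exps n (\<lambda>_. 1) e \<times> {..c}))"
proof -
  interpret kalg "pconst :: 'k \<Rightarrow> 'k mp poly" by (rule kalg_pconst)
  let ?W = "(\<lambda>(f, i). monom (single (monom_of {1..n} f) (1 :: 'k)) i) ` (weighted_exps n (\<lambda>_. 1) e \<times> {..c})"
  have "Q = (\<Sum>i\<le>c. monom (coeff Q i) i)"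
    using poly_as_sum_of_monoms'[of Q c] assms by (simp add: bidegree_le_def)
  also have "\<dots> \<in> vs.span ?W"
  proof (rule vs.span_sum)
    fix i assume i: "i \<in> {..c}"
    let ?q = "coeff Q i"
    have "monom ?q i = monom (\<Sum>m\<in>keys ?q. single m (lookup ?q m)) i"
      using poly_mapping_decomp[of ?q] by simp
    also have "\<dots> = (\<Sum>m\<in>keys ?q. monom (single m (lookup ?q m)) i)"
      by (induction "keys ?q" rule: infinite_finite_induct) (simp_all add: monom_hom.hom_sum)
    also have "\<dots> \<in> vs.span ?W"
    proof (rule vs.span_sum)
      fix m assume m: "m \<in> keys ?q"
      have km: "keys m \<subseteq> {1..n}" "wdeg (\<lambda>_. 1) m \<le> e"
        using assms m by (auto simp: bidegree_le_def polysV_def mp_vars_def wdeg_le_def)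
      define f where "f = restrict (lookup m) {1..n}"
      have mf: "m = monom_of {1..n} f"
        using km(1) by (intro poly_mapping_eqI) (auto simp: lookup_monom_of f_def in_keys_iff)
      have "wdeg (\<lambda>_. 1) m = (\<Sum>i\<in>{1..n}. f i)" unfolding mf by (simp add: wdeg_monom_of)
      hence "f \<in> weighted_exps n (\<lambda>_. 1) e" using km(2) by (auto simp: weighted_exps_def f_def)
      hence "monom (single m 1) i \<in> ?W" using i mf by force
      hence "pconst (lookup ?q m) * monom (single m 1) i \<in> vs.span ?W"
        by (intro vs.span_scale vs.span_base)
      moreover have "pconst (lookup ?q m) * monom (single m 1) i =
          monom (single m (lookup ?q m)) i"
        by (simp add: smult_monom mp_const_def mult_single)
      ultimately show "monom (single m (lookup ?q m)) i \<in> vs.span ?W" by simp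
    qed
    finally show "monom ?q i \<in> vs.span ?W" .
  qed
  finally show ?thesis .
qed

text \<open>This supplies the hypothesis \<open>few\<close> of \<open>weight_le_prod\<close>. If too
  many monomials avoided \<open>\<gamma>\<close>, those monomials times powers of z would satisfy a
  linear relation at \<open>\<Psi>\<close>. By minimality \<open>P\<close> divides it, so one of its
  monomials is a multiple of \<open>\<gamma>\<close>, a contradiction.\<close>

lemma weight_bound:
  fixes P :: "'k::alg_closed_field mp poly" and \<Psi> :: "nat \<Rightarrow> 'k mp poly"
  assumes w1: "\<forall>i\<in>{1..Suc n}. w i \<ge> 1"
    and \<Psi>: "\<And>i. i \<in> {1..Suc n} \<Longrightarrow> bidegree_le {1..n} (w i) 1 (\<Psi> i)"
    and P: "coeffs_in (polysV {1..Suc n}) P" "P \<noteq> 0"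
    and min: "\<And>R. coeffs_in (polysV {1..Suc n}) R \<Longrightarrow>
      poly (map_poly (mp_subst pconst \<Psi>) R) [:0, 1:] = 0 \<Longrightarrow> P dvd R"
  shows "wdeg_le w (\<Prod>i\<in>{1..Suc n}. w i) (coeff P b)"
proof -
  interpret kalg "pconst :: 'k \<Rightarrow> 'k mp poly" by (rule kalg_pconst)
  let ?V = "{1..Suc n}" and ?z = "[:0, 1:] :: 'k mp poly"
  define K where "K = (\<Union>i\<le>degree P. keys (coeff P i))"
  have K: "m \<in> K" if "m \<in> keys (coeff P i)" for m i
  proof (cases "i \<le> degree P")
    case False
    hence "coeff P i = 0" by (intro coeff_eq_0) simp
    thus ?thesis using that by simp
  qed (use that in \<open>auto simp: K_def\<close>)
  have "finite K" by (simp add: K_def)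
  moreover have "K \<noteq> {}"
  proof -
    have "lead_coeff P \<noteq> 0" using P(2) by simp
    then obtain m where "m \<in> keys (lead_coeff P)" by (metis ex_in_conv keys_eq_empty)
    thus ?thesis using K by blast
  qed
  ultimately obtain \<gamma> where \<gamma>: "\<gamma> \<in> K" "\<And>m. m \<in> K \<Longrightarrow> monom_key w m \<le> monom_key w \<gamma>"
    using finite_arg_max[of K "monom_key w"] by blast
  have \<gamma>lt: "monom_key w m < monom_key w \<gamma>" if "m \<in> keys (coeff P i)" "m \<noteq> \<gamma>" for m i
    using \<gamma>(2)[OF K[OF that(1)]] monom_key_inj that(2) le_neq_trans by metis
  obtain b0 where b0: "\<gamma> \<in> keys (coeff P b0)" using \<gamma>(1) by (auto simp: K_def)
  have \<gamma>V: "keys \<gamma> \<subseteq> ?V" using P(1) b0 by (auto simp: coeffs_in_def polysV_def mp_vars_def)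
  let ?g = "lookup \<gamma>"
  have "(\<Sum>i\<in>?V. w i * ?g i) \<le> (\<Prod>i\<in>?V. w i)"
  proof (rule weight_le_prod[OF w1], rule ccontr)
    fix e
    let ?B = "{f \<in> weighted_exps (Suc n) w e. \<not> (\<forall>i\<in>?V. ?g i \<le> f i)}"
    define N where "N = card (weighted_exps n (\<lambda>_. 1) e)"
    assume "\<not> card ?B \<le> card (weighted_exps n (\<lambda>_. 1) e)"
    hence big: "N + 1 \<le> card ?B" by (simp add: N_def)
    have finB: "finite ?B" using finite_weighted_exps[OF w1] by simp
    \<comment> \<open>There are at least (N + 1)(c + 1) unknowns and at most N(e + c + 1)
      dimensions, because the monomials in \<open>\<Psi>\<close> may raise the z-degree by up to
      \<open>e\<close>. With \<open>c = N * e\<close> the first number is larger by 1.\<close>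
    define c where "c = N * e"
    let ?U = "?B \<times> {..c}"
    let ?W = "(\<lambda>(f, i). monom (single (monom_of {1..n} f) (1 :: 'k)) i) ` (weighted_exps n (\<lambda>_. 1) e \<times> {..e + c})"
    define a where "a = (\<lambda>(f, j). monom_eval \<Psi> (monom_of ?V f) * ?z ^ j)"
    have "card ?W \<le> N * (e + c + 1)"
      using card_image_le[of "weighted_exps n (\<lambda>_. 1) e \<times> {..e + c}"
          "\<lambda>(f, i). monom (single (monom_of {1..n} f) (1 :: 'k)) i"] finite_weighted_exps[of n "\<lambda>_. 1" e]
      by (simp add: card_cartesian_product N_def)
    also have "\<dots> < (N + 1) * (c + 1)" by (simp add: c_def algebra_simps)
    also have "\<dots> \<le> card ?B * (c + 1)" by (rule mult_le_mono1[OF big])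
    also have "\<dots> = card ?U" by (simp only: card_cartesian_product card_atMost Suc_eq_plus1)
    finally have less: "card ?W < card ?U" .
    have aspan: "a u \<in> vs.span ?W" if u_in: "u \<in> ?U" for u
    proof -
      obtain f j where u: "u = (f, j)" "f \<in> weighted_exps (Suc n) w e" "j \<le> c" using u_in by auto
      let ?m = "monom_of ?V f"
      have "bidegree_le {1..n} (wdeg w ?m) (wdeg (\<lambda>_. 1) ?m) (monom_eval \<Psi> ?m)"
        using keys_monom_of[of ?V f] by (intro bidegree_le_mon \<Psi>) auto
      moreover have we: "wdeg w ?m \<le> e" using u(2) by (simp add: wdeg_monom_of weighted_exps_def)
      moreover have "wdeg (\<lambda>_. 1) ?m \<le> e"
      proof -
        have "wdeg (\<lambda>_. 1) ?m \<le> wdeg w ?m" using w1 by (simp add: wdeg_monom_of del: sum.cl_ivl_Suc) (intro sum_mono, force)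
        thus ?thesis using we by simp
      qed
      ultimately have "bidegree_le {1..n} e e (monom_eval \<Psi> ?m)" using bidegree_le_mono by blast
      moreover have "bidegree_le {1..n} 0 c (?z ^ j)"
      proof -
        have "bidegree_le {1..n} 0 1 ?z" by (auto simp: bidegree_le_def polysV_def mp_vars_def coeff_pCons split: nat.splits)
        from bidegree_le_power[OF this, of j] show ?thesis using u(3) bidegree_le_mono by fastforce
      qed
      ultimately have "bidegree_le {1..n} (e + 0) (e + c) (monom_eval \<Psi> ?m * ?z ^ j)" by (rule bidegree_le_mult)
      from bidegree_le_in_span[OF this] show ?thesis by (simp add: u(1) a_def)
    qed
    from linear_relation_if_card_less[of ?U ?W a, OF _ _ less aspan] finB obtain x where
      x: "\<exists>u\<in>?U. x u \<noteq> 0" "(\<Sum>u\<in>?U. pconst (x u) * a u) = 0"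
      using finite_weighted_exps[of n "\<lambda>_. 1" e] by auto
    define R where "R = (\<Sum>(f, j)\<in>?U. monom (single (monom_of ?V f) (x (f, j))) j)"
    have Rc: "lookup (coeff R j) m = (\<Sum>(f, i)\<in>?U. if i = j \<and> monom_of ?V f = m then x (f, i) else 0)" for j m
      unfolding R_def coeff_sum lookup_sum by (intro sum.cong refl) (auto simp: lookup_single when_def)
    have Rkeys: "\<exists>f\<in>?B. m = monom_of ?V f" if "m \<in> keys (coeff R j)" for m j
    proof (rule ccontr)
      assume "\<not> ?thesis"
      hence "lookup (coeff R j) m = 0" unfolding Rc by (intro sum.neutral) auto
      thus False using that by (simp add: in_keys_iff)
    qed
    have "R \<noteq> 0"
    proof -
      obtain f0 j0 where fj: "(f0, j0) \<in> ?U" "x (f0, j0) \<noteq> 0" using x(1) by auto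
      have injp: "f = f0" if "f \<in> ?B" "monom_of ?V f = monom_of ?V f0" for f
        using inj_onD[OF inj_on_monom_of[of ?V "\<lambda>_. UNIV"], of f f0] that fj(1) by (auto simp: weighted_exps_def)
      have "lookup (coeff R j0) (monom_of ?V f0) = (\<Sum>u\<in>?U. if u = (f0, j0) then x (f0, j0) else 0)"
        unfolding Rc using injp by (intro sum.cong refl) (auto split: prod.splits)
      also have "\<dots> = x (f0, j0)" using fj(1) finB by (simp add: sum.delta)
      finally show ?thesis using fj(2) by auto
    qed
    have RV: "coeffs_in (polysV ?V) R"
      unfolding coeffs_in_def polysV_def mp_vars_def using Rkeys keys_monom_of[of ?V] by fastforce
    have ev: "comm_ring_hom (\<lambda>Q. poly (map_poly (mp_subst pconst \<Psi>) Q) ?z)"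
      by (rule comm_ring_hom_eval2[OF subst_hom])
    have mm: "map_poly (mp_subst pconst \<Psi>) (monom q j) = monom (mp_subst pconst \<Psi> q) j" for q j
      by (rule map_poly_monom) simp
    have "poly (map_poly (mp_subst pconst \<Psi>) R) ?z = (\<Sum>u\<in>?U. pconst (x u) * a u)"
      unfolding R_def comm_ring_hom_sum[OF ev]
    proof (rule sum.cong[OF refl])
      fix u assume "u \<in> ?U"
      obtain f j where u: "u = (f, j)" by (cases u)
      show "poly (map_poly (mp_subst pconst \<Psi>) (case u of (f, j) \<Rightarrow> monom (single (monom_of ?V f) (x (f, j))) j)) ?z =
        pconst (x u) * a u"
        unfolding u a_def by (simp only: prod.case mm poly_monom subst_single mult.assoc)
    qed
    hence "P dvd R" using min[OF RV] x(2) by simp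
    then obtain S where S: "R = P * S" by (elim dvdE)
    hence "S \<noteq> 0" using \<open>R \<noteq> 0\<close> by auto
    have "\<exists>i \<sigma>. \<gamma> + \<sigma> \<in> keys (coeff (P * S) i)"
      by (rule leading_monomial_of_multiple[OF b0 \<gamma>lt \<open>S \<noteq> 0\<close>])
    then obtain i \<sigma> where "\<gamma> + \<sigma> \<in> keys (coeff R i)" by (auto simp: S)
    from Rkeys[OF this] obtain f where f: "f \<in> ?B" "\<gamma> + \<sigma> = monom_of ?V f" by blast
    have "?g i \<le> f i" if "i \<in> ?V" for i
      using arg_cong[OF f(2), of "\<lambda>m. lookup m i"] that by (simp add: lookup_add lookup_monom_of)
    thus False using f(1) by blast
  qed
  moreover have "wdeg w \<gamma> = (\<Sum>i\<in>?V. w i * ?g i)" by (rule wdeg_superset[OF _ \<gamma>V]) simp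
  moreover have "wdeg w m \<le> wdeg w \<gamma>" if "m \<in> keys (coeff P b)" for m
    using \<gamma>(2)[OF K[OF that]] by (auto simp: monom_key_def less_eq_prod_def)
  ultimately show ?thesis unfolding wdeg_le_def using order_trans by metis
qed

section \<open>The effective Nullstellensatz\<close>

text \<open>A relation \<open>Q\<close> of least degree divides every other up to powers of its
  leading coefficient. Applied to a monic relation, this lets \<open>monic_factor\<close> strip that
  coefficient off, and the resulting monic \<open>P\<close> divides without multipliers.\<close>

lemma (in kalg) minimal_relation:
  fixes \<Psi> :: "nat \<Rightarrow> 'r" and z :: 'r
  assumes inj: "\<And>F. F \<in> polysV V \<Longrightarrow> F \<noteq> 0 \<Longrightarrow> mp_subst \<kappa> \<Psi> F \<noteq> 0"
    and int: "integral_over (subalg \<Psi> V) z"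
  shows "\<exists>P. coeffs_in (polysV V) P \<and> lead_coeff P = 1 \<and> poly (map_poly (mp_subst \<kappa> \<Psi>) P) z = 0 \<and>
    (\<forall>R. coeffs_in (polysV V) R \<longrightarrow> poly (map_poly (mp_subst \<kappa> \<Psi>) R) z = 0 \<longrightarrow> P dvd R)"
proof -
  let ?S = "polysV V :: 'k mp set"
  have S: "is_subring ?S" by (rule is_subring_polysV)
  define \<phi> where "\<phi> = mp_subst \<kappa> \<Psi>"
  have \<phi>hom: "comm_ring_hom \<phi>" unfolding \<phi>_def by (rule subst_hom)
  interpret \<phi>: comm_ring_hom \<phi> by (rule \<phi>hom)
  define ev where "ev R = poly (map_poly \<phi> R) z" for R
  interpret ev: comm_ring_hom ev
    unfolding ev_def[abs_def] by (rule comm_ring_hom_eval2[OF \<phi>hom])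
  have ev_smult: "ev (smult a R) = \<phi> a * ev R" for a R
  proof -
    have "smult a R = [:a:] * R" by simp
    hence "ev (smult a R) = ev [:a:] * ev R" by (simp only: ev.hom_mult)
    thus ?thesis by (simp add: ev_def map_poly_hom_pCons[OF \<phi>hom])
  qed
  from int obtain p where p: "coeffs_in (subalg \<Psi> V) p" "lead_coeff p = 1" "poly p z = 0"
    by (auto simp: integral_over_def)
  from p(1) have "\<forall>i. \<exists>F. F \<in> ?S \<and> coeff p i = \<phi> F" by (auto simp: coeffs_in_def subalg_def \<phi>_def)
  then obtain F where F: "\<And>i. F i \<in> ?S" "\<And>i. coeff p i = \<phi> (F i)" by metis
  \<comment> \<open>The integral equation of \<open>z\<close> is lifted to coefficients in the
    polynomial ring; the top coefficient is set to 1 explicitly so that the lift is again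
    monic.\<close>
  define M where "M = (\<Sum>i<degree p. monom (F i) i) + monom 1 (degree p)"
  have cM: "coeff M i = (if i < degree p then F i else if i = degree p then 1 else 0)" for i
    by (auto simp: M_def coeff_sum)
  have dM: "degree M = degree p"
    by (rule antisym[OF degree_le le_degree]) (auto simp: cM)
  have M: "coeffs_in ?S M" "lead_coeff M = 1" "ev M = 0"
  proof -
    show "coeffs_in ?S M" using F(1) is_subringD[OF S] by (auto simp: coeffs_in_def cM)
    show "lead_coeff M = 1" by (simp add: dM cM)
    have "map_poly \<phi> M = p"
    proof (rule poly_eqI)
      fix i show "coeff (map_poly \<phi> M) i = coeff p i"
      proof (cases "i < degree p")
        case True
        thus ?thesis using F(2)[of i] by (simp add: coeff_map_poly cM)
      next
        case False
        thus ?thesis using p(2) by (cases "i = degree p") (simp_all add: coeff_map_poly cM coeff_eq_0)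
      qed
    qed
    thus "ev M = 0" using p(3) by (simp add: ev_def)
  qed
  define I where "I = {R. coeffs_in ?S R \<and> ev R = 0}"
  define Q where "Q = arg_min degree (\<lambda>R. R \<in> I \<and> R \<noteq> 0)"
  have "M \<in> I \<and> M \<noteq> 0" using M by (auto simp: I_def)
  hence Q: "Q \<in> I" "Q \<noteq> 0" unfolding Q_def by (metis (mono_tags, lifting) arg_min_natI)+
  have min: "degree Q \<le> degree R" if "R \<in> I" "R \<noteq> 0" for R
    unfolding Q_def using that by (intro arg_min_nat_le) auto
  define q where "q = lead_coeff Q"
  have q: "q \<in> ?S" "q \<noteq> 0" "\<phi> q \<noteq> 0"
    using Q inj by (auto simp: q_def I_def coeffs_in_def \<phi>_def)
  have div: "\<exists>a A. smult (lead_coeff T ^ a) R = T * A"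
    if R: "R \<in> I" and T: "T \<in> I" "T \<noteq> 0" "degree T = degree Q" for R T
  proof -
    have cT: "coeffs_in ?S T" "coeffs_in ?S R" using T R by (auto simp: I_def)
    from pseudo_division_subring[OF S cT(2,1) T(2)] obtain a A R' where
      *: "coeffs_in ?S R'" "smult (lead_coeff T ^ a) R = T * A + R'" "R' = 0 \<or> degree R' < degree T"
      by blast
    have "ev (smult (lead_coeff T ^ a) R) = 0" using R by (simp add: ev_smult I_def)
    hence "ev R' = 0" using T(1) by (simp add: *(2) ev.hom_add ev.hom_mult I_def)
    hence "R' \<in> I" using *(1) by (simp add: I_def)
    hence "R' = 0" using *(3) min[of R'] T(3) by fastforce
    thus ?thesis using *(2) by auto
  qed
  obtain a A where aA: "smult (q ^ a) M = Q * A"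
    using div[of M Q] Q \<open>M \<in> I \<and> M \<noteq> 0\<close> by (auto simp: q_def)
  have "q ^ a \<noteq> 0" using q(2) by simp
  from monic_factor[OF M(2) this aA] obtain P where P: "Q = smult q P" by (auto simp: q_def)
  have P0: "P \<noteq> 0" using P Q(2) by auto
  have dP: "degree P = degree Q" using P q(2) by simp
  have lP: "lead_coeff P = 1"
  proof -
    have "lead_coeff Q = lead_coeff (smult q P)" by (rule arg_cong[OF P, of lead_coeff])
    also have "\<dots> = q * lead_coeff P" by (rule lead_coeff_smult)
    finally have "lead_coeff Q = q * lead_coeff P" .
    with q_def have "q = q * lead_coeff P" by (rule trans)
    thus ?thesis using q(2) by simp
  qed
  \<comment> \<open>\<open>monic_factor\<close> yields coefficients in the full polynomial ring; the
    retraction shows that they involve only \<open>V\<close>, since \<open>q\<close> and its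
    products with them do.\<close>
  have cP: "coeffs_in ?S P"
    unfolding coeffs_in_def
  proof
    fix i
    interpret r: comm_ring_hom "restrict_vars V :: 'k mp \<Rightarrow> 'k mp" by (rule restrict_vars_hom)
    have "q * coeff P i \<in> ?S" using Q(1) P by (auto simp: I_def coeffs_in_def)
    hence "restrict_vars V (q * coeff P i) = q * coeff P i" by (rule restrict_vars_id)
    hence "q * restrict_vars V (coeff P i) = q * coeff P i" by (simp add: r.hom_mult restrict_vars_id[OF q(1)])
    hence "restrict_vars V (coeff P i) = coeff P i" using q(2) by simp
    thus "coeff P i \<in> ?S" using restrict_vars_in by metis
  qed
  have evP: "ev P = 0"
  proof -
    have "\<phi> q * ev P = 0" using Q(1) P by (simp add: I_def ev_smult)
    thus ?thesis using q(3) by simp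
  qed
  have "P dvd R" if "coeffs_in ?S R" "ev R = 0" for R
  proof -
    have "\<exists>a A. smult (lead_coeff P ^ a) R = P * A"
      by (rule div) (use that cP evP P0 dP in \<open>auto simp: I_def\<close>)
    thus ?thesis unfolding lP by auto
  qed
  thus ?thesis using cP lP evP unfolding ev_def \<phi>_def by blast
qed

text \<open>The n + 1 normalized elements are independent since z and the x_i are integral over
  them: a relation would lower the growth of k[x][z] to n.\<close>

lemma psi_exists:
  fixes g h :: "nat \<Rightarrow> 'k::alg_closed_field mp"
  assumes m: "1 \<le> m" "m \<le> n + 1" and g: "\<forall>i\<in>{1..m}. g i \<in> polysV {1..n}"
    and h: "\<forall>i. h i \<in> polysV {1..n}" "(\<Sum>i\<in>{1..m}. g i * h i) = 1"
  shows "\<exists>\<Psi>. (\<forall>i\<in>{1..n + 1}. \<exists>l. l \<in> polysV {1..n} \<and> wdeg_le (\<lambda>_. 1) 1 l \<and>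
        \<Psi> i = [:l, if i \<le> m then g i else 0:]) \<and>
      (\<forall>F\<in>polysV {1..n + 1}. F \<noteq> 0 \<longrightarrow> mp_subst pconst \<Psi> F \<noteq> 0) \<and>
      integral_over (kalg.subalg pconst \<Psi> {1..n + 1}) [:0, 1:]"
proof -
  interpret kalg "pconst :: 'k \<Rightarrow> 'k mp poly" by (rule kalg_pconst)
  let ?V = "{1..n}" and ?z = "[:0, 1:] :: 'k mp poly"
  have V: "is_subring (polysV ?V :: 'k mp set)" by (rule is_subring_polysV)
  \<comment> \<open>Index 0, which does not occur among the x_i, names z. This places z and the x_i
    in one family to which the growth lemmas apply.\<close>
  define u :: "nat \<Rightarrow> 'k mp poly" where "u v = (if v = 0 then ?z else [:mvar v:])" for v
  have u_subst: "mp_subst pconst u p = [:p:]" if "p \<in> polysV ?V" for p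
  proof (rule hom_ext[OF subst_hom comm_ring_hom_pCons])
    fix v assume "v \<in> mp_vars p"
    hence "v \<noteq> 0" using that by (auto simp: polysV_def)
    thus "mp_subst pconst u (mvar v) = [:mvar v:]" by (simp add: u_def)
  qed simp
  have gru: "growth_le (u ` {0..n}) (n + 1)"
    using growth_exp_mono[OF growth_finite[of "u ` {0..n}"], of "n + 1"] card_image_le[of "{0..n}" u] by simp
  define y where "y i = (if i \<le> m then ?z * [:g i:] else [:mvar (i - m):])" for i
  define G where "G i = (if i \<le> m then mvar 0 * g i else mvar (i - m))" for i
  have G: "G i \<in> polysV {0..n} \<and> y i = mp_subst pconst u (G i)" if "i \<in> {1..m + n}" for i
  proof (cases "i \<le> m")
    case True
    hence gi: "g i \<in> polysV ?V" using g that by auto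
    hence "g i \<in> polysV {0..n}" unfolding polysV_def by force
    hence "mvar 0 * g i \<in> polysV {0..n}"
      by (intro is_subringD(5)[OF is_subring_polysV]) (auto simp: polysV_def)
    thus ?thesis using True u_subst[OF gi] by (simp add: G_def y_def subst_mult u_def)
  next
    case False
    thus ?thesis using that by (auto simp: G_def y_def polysV_def u_def)
  qed
  define K where "K = Max ((\<lambda>i. total_degree (G i)) ` {1..m + n})"
  have "y ` {1..m + n} \<subseteq> vs.span (products (u ` {0..n}) K)"
  proof (rule image_subsetI)
    fix i assume i: "i \<in> {1..m + n}"
    have "total_degree (G i) \<le> K" unfolding K_def using i by (intro Max_ge) auto
    hence "wdeg_le (\<lambda>_. 1) K (G i)" by (rule wdeg_le_mono[OF wdeg_le_total_degree])
    thus "y i \<in> vs.span (products (u ` {0..n}) K)" using subst_in_span[of "G i" "{0..n}" K u] G[OF i] by simp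
  qed
  hence "growth_le (y ` {1..m + n}) (n + 1)" by (intro growth_span[OF _ gru]) auto
  \<comment> \<open>Because \<open>m \<le> n + 1\<close>, the eliminated elements, with index above
    \<open>n + 1\<close>, are all variables x_v; none is a z g_i.\<close>
  from noether_normalization[OF kalg_pconst this] m obtain \<Psi> B where
    \<Psi>: "\<And>i. \<Psi> i - y i \<in> vs.span (y ` {n + 1<..m + n})"
    and B: "finite_ext (subalg \<Psi> {1..n + 1}) B" "y ` {1..m + n} \<subseteq> B" by auto
  have sB: "is_subring B" "subalg \<Psi> {1..n + 1} \<subseteq> B" using B(1) by (auto simp: finite_ext_def)
  define L where "L = {[:l:] |l :: 'k mp. l \<in> polysV ?V \<and> wdeg_le (\<lambda>_. 1) 1 l}"
  have L: "vs.subspace L"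
  proof (rule vs.subspaceI)
    show "0 \<in> L" unfolding L_def using is_subringD(2)[OF V] by (intro CollectI exI[of _ 0]) auto
    show "x + x' \<in> L" if "x \<in> L" "x' \<in> L" for x x'
    proof -
      from that obtain l l' where "x = [:l:]" "x' = [:l':]" "l \<in> polysV ?V" "l' \<in> polysV ?V"
        "wdeg_le (\<lambda>_. 1) 1 l" "wdeg_le (\<lambda>_. 1) 1 l'" by (auto simp: L_def)
      thus ?thesis unfolding L_def using is_subringD(3)[OF V] wdeg_le_add
        by (intro CollectI exI[of _ "l + l'"]) auto
    qed
    show "pconst c * x \<in> L" if "x \<in> L" for c x
    proof -
      from that obtain l where "x = [:l:]" "l \<in> polysV ?V" "wdeg_le (\<lambda>_. 1) 1 l" by (auto simp: L_def)
      moreover have "mp_const c \<in> polysV ?V" by (simp add: polysV_def)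
      ultimately show ?thesis unfolding L_def using is_subringD(5)[OF V] wdeg_le_smult
        by (intro CollectI exI[of _ "mp_const c * l"]) auto
    qed
  qed
  have xL: "[:mvar v:] \<in> L" if "v \<in> ?V" for v
    unfolding L_def using that by (intro CollectI exI[of _ "mvar v"]) (auto simp: polysV_def wdeg_le_mvar)
  have "y ` {n + 1<..m + n} \<subseteq> L"
  proof (rule image_subsetI)
    fix i assume "i \<in> {n + 1<..m + n}"
    hence "i - m \<in> {1..n}" "\<not> i \<le> m" using m by auto
    thus "y i \<in> L" using xL by (simp add: y_def)
  qed
  hence "vs.span (y ` {n + 1<..m + n}) \<subseteq> L" by (rule vs.span_minimal[OF _ L])
  hence \<Psi>L: "\<Psi> i - y i \<in> L" for i using \<Psi> by blast
  have form: "\<exists>l. l \<in> polysV ?V \<and> wdeg_le (\<lambda>_. 1) 1 l \<and> \<Psi> i = [:l, if i \<le> m then g i else 0:]"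
    if i: "i \<in> {1..n + 1}" for i
  proof (cases "i \<le> m")
    case True
    from \<Psi>L[of i] obtain l where "l \<in> polysV ?V" "wdeg_le (\<lambda>_. 1) 1 l" "\<Psi> i - y i = [:l:]" by (auto simp: L_def)
    moreover from this(3) have "\<Psi> i = [:l:] + y i" by (simp add: algebra_simps)
    hence "\<Psi> i = [:l, g i:]" using True by (simp add: y_def)
    ultimately show ?thesis using True by auto
  next
    case False
    moreover from this have "i - m \<in> {1..n}" using i m by auto
    ultimately have "y i \<in> L" using xL by (simp add: y_def)
    hence "\<Psi> i \<in> L" using vs.subspace_add[OF L \<Psi>L[of i], of "y i"] by simp
    thus ?thesis using False by (auto simp: L_def)
  qed
  have cB: "pconst c \<in> B" for c using sB(2) subalg_const by blast
  have xB: "[:mvar v:] \<in> B" if "v \<in> ?V" for v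
  proof -
    have "y (m + v) \<in> B" using B(2) that by auto
    thus ?thesis using that by (simp add: y_def)
  qed
  have pB: "[:p:] \<in> B" if "p \<in> polysV ?V" for p
  proof -
    have "mp_subst pconst u p \<in> B"
      using that by (intro subst_in_subring[OF sB(1) cB]) (auto simp: u_def polysV_def intro!: xB)
    thus ?thesis using u_subst[OF that] by simp
  qed
  \<comment> \<open>Here the identity \<open>\<Sum>g i * h i = 1\<close> enters: multiplied by z, it
    writes z through the elements z g_i and polynomials in x, all of which lie in
    \<open>B\<close>.\<close>
  have zB: "?z \<in> B"
  proof -
    have "(\<Sum>i\<in>{1..m}. (?z * [:g i:]) * [:h i:]) = ?z * (\<Sum>i\<in>{1..m}. [:g i * h i:])"
      unfolding sum_distrib_left by (intro sum.cong refl) (simp add: mult.commute)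
    also have "(\<Sum>i\<in>{1..m}. [:g i * h i:]) = [:\<Sum>i\<in>{1..m}. g i * h i:]"
      by (rule comm_ring_hom_sum[OF comm_ring_hom_pCons, symmetric])
    also have "?z * \<dots> = ?z" unfolding h(2) by simp
    finally have "?z = (\<Sum>i\<in>{1..m}. (?z * [:g i:]) * [:h i:])" by simp
    also have "\<dots> \<in> B"
    proof (rule is_subring_sum[OF sB(1)])
      fix i assume i: "i \<in> {1..m}"
      have "y i \<in> B" using B(2) i by auto
      hence "?z * [:g i:] \<in> B" using i by (simp add: y_def)
      from is_subringD(5)[OF sB(1) this pB] h(1) show "(?z * [:g i:]) * [:h i:] \<in> B" by blast
    qed
    finally show ?thesis .
  qed
  have int: "integral_over (subalg \<Psi> {1..n + 1}) b" if "b \<in> B" for b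
    by (rule integral_of_finite_ext[OF is_subring_subalg B(1) that])
  have uB: "u v \<in> B" if "v \<in> {0..n}" for v
    using that zB xB by (auto simp: u_def)
  have "mp_subst pconst \<Psi> F \<noteq> 0" if F: "F \<in> polysV {1..n + 1}" "F \<noteq> 0" for F
  proof
    assume "mp_subst pconst \<Psi> F = 0"
    from growth_dependent[OF _ F(2,1) this] have growth_le\<Psi>: "growth_le (\<Psi> ` {1..n + 1}) n" by simp
    have "growth_le (u ` U \<union> \<Psi> ` {1..n + 1}) n" if "finite U" "U \<subseteq> {0..n}" for U
      using that
    proof (induction U rule: finite_induct)
      case (insert v U)
      have "growth_le (insert (u v) (u ` U \<union> \<Psi> ` {1..n + 1})) n"
        by (rule growth_integral[OF _ _ _ int[OF uB]]) (use insert in auto)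
      thus ?case by simp
    qed (use growth_le\<Psi> in simp)
    from this[of "{0..n}"] have all: "growth_le (u ` {0..n} \<union> \<Psi> ` {1..n + 1}) n" by simp
    have "growth_le (u ` {0..n}) n"
    proof (rule growth_span[OF _ all])
      show "u ` {0..n} \<subseteq> vs.span (products (u ` {0..n} \<union> \<Psi> ` {1..n + 1}) (Suc 0))"
        using products_base[of _ "u ` {0..n} \<union> \<Psi> ` {1..n + 1}" 0] vs.span_base by blast
    qed simp
    from growth_relation[OF _ this] obtain F' where F': "F' \<noteq> 0" "mp_subst pconst u F' = 0" by auto
    \<comment> \<open>Renaming variable 0 to z is a shear with \<open>c = 0\<close>, hence
      injective; so z and the x_i satisfy no relation.\<close>
    have "shear 0 (\<lambda>_. 0) F' = mp_subst pconst u F'"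
      unfolding shear_def by (rule subst_cong) (simp add: u_def)
    hence "F' = 0" using unshear_shear[of 0 "\<lambda>_. 0" F'] F'(2) by simp
    thus False using F'(1) by simp
  qed
  thus ?thesis using form int[OF zB] by (intro exI[of _ \<Psi>] conjI ballI impI) auto
qed

lemma cofactor_le_wdeg_le_mult: "cofactor_le D e p \<Longrightarrow> wdeg_le (\<lambda>_. 1) e q \<Longrightarrow> wdeg_le (\<lambda>_. 1) D (q * p)"
  unfolding cofactor_le_def wdeg_le_def
proof
  fix k assume *: "\<forall>m\<in>keys p. wdeg (\<lambda>_. 1) m + e \<le> D"
    "\<forall>m\<in>keys q. wdeg (\<lambda>_. 1) m \<le> e" "k \<in> keys (q * p)"
  then obtain a b where "a \<in> keys q" "b \<in> keys p" "k = a + b"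
    using Poly_Mapping.keys_mult[of q p] by blast
  thus "wdeg (\<lambda>_. 1) k \<le> D" using *(1,2) by (fastforce simp: wdeg_add)
qed

lemma power_z: "[:0, 1:] ^ b = (monom 1 b :: 'a::comm_semiring_1 poly)"
  by (induction b) (auto simp: monom_Suc monom_0 one_pCons)

text \<open>The coefficient of \<open>z ^ j\<close>, \<open>j \<ge> 1\<close>, in a monomial in the \<open>\<Psi>\<^sub>i = z g\<^sub>i + l\<^sub>i\<close> contains
  a factor \<open>g\<^sub>i\<close>. Comparing coefficients of \<open>z ^ N\<close> in the minimal equation of \<open>z\<close>, of degree \<open>N\<close>,
  therefore writes 1 as a combination of the \<open>g\<^sub>i\<close>.\<close>

lemma extract_combination:
  fixes g l :: "nat \<Rightarrow> 'k::field mp" and P :: "'k mp poly"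
  assumes \<Psi>: "\<And>i. i \<in> W \<Longrightarrow> l i \<in> polysV V \<and> wdeg_le (\<lambda>_. 1) (w i) (l i) \<and>
        \<Psi> i = [:l i, if i \<in> A then g i else 0:]"
    and g: "\<And>i. i \<in> A \<Longrightarrow> g i \<in> polysV V \<and> wdeg_le (\<lambda>_. 1) (w i) (g i)" and A: "finite A"
    and P: "coeffs_in (polysV W) P" "lead_coeff P = 1" "\<And>b. wdeg_le w D (coeff P b)"
    and zero: "poly (map_poly (mp_subst pconst \<Psi>) P) [:0, 1:] = 0"
  shows "\<exists>h. (\<forall>i\<in>A. h i \<in> polysV V \<and> cofactor_le D (w i) (h i)) \<and> (\<Sum>i\<in>A. g i * h i) = 1"
proof -
  interpret kalg "pconst :: 'k \<Rightarrow> 'k mp poly" by (rule kalg_pconst)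
  let ?S = "polysV V :: 'k mp set" and ?z = "[:0, 1:] :: 'k mp poly"
  have S: "is_subring ?S" by (rule is_subring_polysV)
  \<comment> \<open>Combinations of the g_i with all terms bounded by \<open>e\<close>; closed under
    sums, and multiplication by a polynomial of degree \<open>k\<close> shifts the bound by
    \<open>k\<close>.\<close>
  define H where "H e = {\<Sum>i\<in>A. g i * h i |h. \<forall>i\<in>A. h i \<in> ?S \<and> cofactor_le e (w i) (h i)}" for e
  have H0: "0 \<in> H e" for e
    unfolding H_def using is_subringD(2)[OF S] by (intro CollectI exI[of _ "\<lambda>_. 0"]) auto
  have Hadd: "x + x' \<in> H e" if "x \<in> H e" "x' \<in> H e" for x x' e
  proof -
    from that obtain h h' where "x = (\<Sum>i\<in>A. g i * h i)" "\<forall>i\<in>A. h i \<in> ?S \<and> cofactor_le e (w i) (h i)"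
      "x' = (\<Sum>i\<in>A. g i * h' i)" "\<forall>i\<in>A. h' i \<in> ?S \<and> cofactor_le e (w i) (h' i)" by (auto simp: H_def)
    moreover from this have "\<forall>i\<in>A. h i + h' i \<in> ?S \<and> cofactor_le e (w i) (h i + h' i)"
      using is_subringD(3)[OF S] by (blast intro: cofactor_le_add)
    ultimately show ?thesis unfolding H_def
      by (intro CollectI exI[of _ "\<lambda>i. h i + h' i"]) (simp add: distrib_left sum.distrib)
  qed
  have Hmult: "q * x \<in> H (e + k)" if "x \<in> H e" "q \<in> ?S" "wdeg_le (\<lambda>_. 1) k q" for x q e k
  proof -
    from that(1) obtain h where h: "x = (\<Sum>i\<in>A. g i * h i)" "\<forall>i\<in>A. h i \<in> ?S \<and> cofactor_le e (w i) (h i)"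
      by (auto simp: H_def)
    have "q * x = (\<Sum>i\<in>A. g i * (h i * q))" by (simp add: h(1) sum_distrib_left ac_simps)
    moreover have "\<forall>i\<in>A. h i * q \<in> ?S \<and> cofactor_le (e + k) (w i) (h i * q)"
      using h(2) that is_subringD(5)[OF S] cofactor_le_mult by blast
    ultimately show ?thesis unfolding H_def by (intro CollectI exI[of _ "\<lambda>i. h i * q"] conjI)
  qed
  have Hg: "g i * q \<in> H (e + w i)" if "i \<in> A" "q \<in> ?S" "wdeg_le (\<lambda>_. 1) e q" for i q e
  proof -
    have "(\<Sum>j\<in>A. g j * (if j = i then q else 0)) = (\<Sum>j\<in>A. if j = i then g i * q else 0)"
      by (intro sum.cong) auto
    also have "\<dots> = g i * q" using that A by simp
    finally have "g i * q = (\<Sum>j\<in>A. g j * (if j = i then q else 0))" by simp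
    moreover have "\<forall>j\<in>A. (if j = i then q else 0) \<in> ?S \<and> cofactor_le (e + w i) (w j) (if j = i then q else 0)"
      using that is_subringD(2)[OF S] by (auto simp: cofactor_le_def wdeg_le_def)
    ultimately show ?thesis unfolding H_def by (intro CollectI exI[of _ "\<lambda>j. if j = i then q else 0"] conjI)
  qed
  have Hmono: "x \<in> H e'" if "x \<in> H e" "e \<le> e'" for x e e'
    using that cofactor_le_mono unfolding H_def by blast
  have Hsum: "sum F U \<in> H e" if "\<And>x. x \<in> U \<Longrightarrow> F x \<in> H e" for F :: "'x \<Rightarrow> 'k mp" and U e
    using that by (induction U rule: infinite_finite_induct) (auto simp: H0 Hadd)
  have Hsum': "sum F U \<in> H e" if "\<And>x. x \<in> U \<Longrightarrow> F x \<in> H e" for F :: "nat \<Rightarrow> 'k mp" and U e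
    using that by (induction U rule: infinite_finite_induct) (auto simp: H0 Hadd)
  \<comment> \<open>The invariant preserved by multiplication with a \<open>\<Psi> i\<close>: a
    positive power of z receives either l_i times a coefficient already in \<open>H\<close>, or g_i
    times an arbitrary coefficient.\<close>
  define ext where "ext e Q \<longleftrightarrow> (\<forall>j. coeff Q j \<in> ?S \<and> wdeg_le (\<lambda>_. 1) e (coeff Q j)) \<and> (\<forall>j>0. coeff Q j \<in> H e)"
    for e and Q :: "'k mp poly"
  have ext1: "ext 0 1" using is_subringD(1,2)[OF S] H0 by (auto simp: ext_def coeff_1)
  have ext_step: "ext (e + w i) (\<Psi> i * Q)" if Q: "ext e Q" and i: "i \<in> W" for e i Q
  proof -
    let ?\<gamma> = "if i \<in> A then g i else 0"
    have li: "l i \<in> ?S" "wdeg_le (\<lambda>_. 1) (w i) (l i)" using \<Psi>[OF i] by auto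
    have \<gamma>: "?\<gamma> \<in> ?S" "wdeg_le (\<lambda>_. 1) (w i) ?\<gamma>" using g is_subringD(2)[OF S] by auto
    have c: "coeff (\<Psi> i * Q) j = l i * coeff Q j + (case j of 0 \<Rightarrow> 0 | Suc j' \<Rightarrow> ?\<gamma> * coeff Q j')" for j
      using \<Psi>[OF i] by (auto split: nat.split)
    have Qj: "coeff Q j \<in> ?S" "wdeg_le (\<lambda>_. 1) e (coeff Q j)" for j using Q by (auto simp: ext_def)
    have "wdeg_le (\<lambda>_. 1) (e + w i) (p * coeff Q j)" if "wdeg_le (\<lambda>_. 1) (w i) p" for p j
      using wdeg_le_mult[OF that Qj(2), of j] by (simp add: add.commute)
    hence "coeff (\<Psi> i * Q) j \<in> ?S \<and> wdeg_le (\<lambda>_. 1) (e + w i) (coeff (\<Psi> i * Q) j)" for j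
      unfolding c using li \<gamma> Qj
      by (cases j) (auto intro!: is_subringD(3)[OF S] is_subringD(5)[OF S] wdeg_le_add)
    moreover have "coeff (\<Psi> i * Q) j \<in> H (e + w i)" if j0: "j > 0" for j
    proof -
      obtain j' where j: "j = Suc j'" using j0 by (cases j) auto
      have "l i * coeff Q j \<in> H (e + w i)" using Q j0 by (intro Hmult li) (auto simp: ext_def)
      moreover have "?\<gamma> * coeff Q j' \<in> H (e + w i)" using Hg[of i "coeff Q j'" e] Qj[of j'] H0 by auto
      ultimately show ?thesis unfolding c by (simp only: j nat.case Hadd)
    qed
    ultimately show ?thesis by (auto simp: ext_def)
  qed
  have ext_mon: "ext (wdeg w \<alpha>) (monom_eval \<Psi> \<alpha>)" if \<alpha>: "keys \<alpha> \<subseteq> W" for \<alpha>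
  proof -
    have pwr: "ext (e + w i * k) (\<Psi> i ^ k * Q)" if "ext e Q" "i \<in> W" for e i k Q
      using that
    proof (induction k)
      case (Suc k)
      from ext_step[OF Suc.IH[OF Suc.prems] Suc.prems(2)] show ?case by (simp add: algebra_simps)
    qed simp
    have "ext (\<Sum>i\<in>U. w i * lookup \<alpha> i) (\<Prod>i\<in>U. \<Psi> i ^ lookup \<alpha> i)"
      if "finite U" "U \<subseteq> W" for U
      using that
    proof (induction U rule: finite_induct)
      case (insert i U)
      hence "ext (\<Sum>i\<in>U. w i * lookup \<alpha> i) (\<Prod>i\<in>U. \<Psi> i ^ lookup \<alpha> i)" "i \<in> W"
        by auto
      from pwr[OF this, of "lookup \<alpha> i"] insert.hyps show ?case by (simp add: add.commute)
    qed (simp add: ext1)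
    from this[OF finite_keys \<alpha>] show ?thesis by (simp add: wdeg_def monom_eval_def)
  qed
  let ?\<phi> = "mp_subst pconst \<Psi>"
  have \<phi>H: "coeff (?\<phi> (coeff P b)) j \<in> H D" if "j > 0" for b j
  proof -
    have "coeff (?\<phi> (coeff P b)) j =
        (\<Sum>\<alpha>\<in>keys (coeff P b). mp_const (lookup (coeff P b) \<alpha>) * coeff (monom_eval \<Psi> \<alpha>) j)"
      by (simp add: subst_mon coeff_sum)
    also have "\<dots> \<in> H D"
    proof (rule Hsum)
      fix \<alpha> assume \<alpha>: "\<alpha> \<in> keys (coeff P b)"
      have "keys \<alpha> \<subseteq> W" using P(1) \<alpha> by (auto simp: coeffs_in_def polysV_def mp_vars_def)
      from ext_mon[OF this] have "coeff (monom_eval \<Psi> \<alpha>) j \<in> H (wdeg w \<alpha>)" using that by (simp add: ext_def)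
      moreover have "wdeg w \<alpha> \<le> D" using P(3)[of b] \<alpha> by (simp add: wdeg_le_def)
      ultimately have "coeff (monom_eval \<Psi> \<alpha>) j \<in> H D" by (rule Hmono)
      from Hmult[OF this, of "mp_const (lookup (coeff P b) \<alpha>)" 0]
      show "mp_const (lookup (coeff P b) \<alpha>) * coeff (monom_eval \<Psi> \<alpha>) j \<in> H D"
        by (simp add: polysV_def)
    qed
    finally show ?thesis .
  qed
  define N where "N = degree P"
  have "map_poly ?\<phi> P = (\<Sum>b\<le>N. monom (?\<phi> (coeff P b)) b)"
    using poly_as_sum_of_monoms'[of "map_poly ?\<phi> P" N] degree_map_poly_le[of ?\<phi> P]
    by (simp add: coeff_map_poly N_def)
  hence "0 = (\<Sum>b\<le>N. ?\<phi> (coeff P b) * ?z ^ b)"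
    using zero by (simp add: poly_sum poly_monom)
  hence "0 = coeff (\<Sum>b\<le>N. ?\<phi> (coeff P b) * ?z ^ b) N" by (metis coeff_0)
  also have "\<dots> = (\<Sum>b\<le>N. coeff (?\<phi> (coeff P b)) (N - b))"
    unfolding coeff_sum power_z by (intro sum.cong refl) (simp add: mult.commute[of _ "monom 1 _"] coeff_monom_mult)
  also have "\<dots> = (\<Sum>b<N. coeff (?\<phi> (coeff P b)) (N - b)) + 1"
    using P(2) by (simp add: N_def lessThan_Suc_atMost[symmetric])
  \<comment> \<open>In z^N only the term \<open>b = N\<close> can contribute from z^0 of its
    coefficient, and that coefficient is 1. All terms with \<open>b < N\<close> use positive powers
    of z and so lie in \<open>H D\<close>.\<close>
  finally have one: "1 = mp_const (- 1) * (\<Sum>b<N. coeff (?\<phi> (coeff P b)) (N - b))"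
    by (simp add: mp_const_def single_uminus eq_neg_iff_add_eq_0 add.commute)
  have "(\<Sum>b<N. coeff (?\<phi> (coeff P b)) (N - b)) \<in> H D"
    by (rule Hsum') (auto intro!: \<phi>H)
  from Hmult[OF this, of "mp_const (- 1)" 0] have "1 \<in> H D"
    unfolding one[symmetric] by (simp add: polysV_def)
  thus ?thesis by (auto simp: H_def)
qed

lemma effective_nullstellensatz_few:
  fixes g :: "nat \<Rightarrow> 'k::alg_closed_field mp"
  assumes m: "m \<le> n + 1" and g: "\<forall>i\<in>{1..m}. g i \<in> polysV {1..n} \<and> wdeg_le (\<lambda>_. 1) (d i) (g i)"
    and d: "\<forall>i\<in>{1..m}. d i \<ge> 1" and nz: "\<forall>a. \<exists>i\<in>{1..m}. mp_eval a (g i) \<noteq> 0"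
  shows "\<exists>h. (\<forall>i\<in>{1..m}. h i \<in> polysV {1..n} \<and> cofactor_le (\<Prod>i\<in>{1..m}. d i) (d i) (h i)) \<and>
    (\<Sum>i\<in>{1..m}. g i * h i) = 1"
proof -
  interpret kalg "pconst :: 'k \<Rightarrow> 'k mp poly" by (rule kalg_pconst)
  let ?V = "{1..n}" and ?W = "{1..Suc n}"
  have m1: "1 \<le> m" using nz by fastforce
  obtain h where h: "\<forall>i. h i \<in> polysV ?V" "(\<Sum>i\<in>{1..m}. g i * h i) = 1"
    using weak_nullstellensatz[of ?V "{1..m}" g] g nz by blast
  have gV: "\<forall>i\<in>{1..m}. g i \<in> polysV ?V" using g by blast
  from psi_exists[OF m1 m gV h] obtain \<Psi> where
    "\<forall>i\<in>{1..n + 1}. \<exists>l. l \<in> polysV ?V \<and> wdeg_le (\<lambda>_. 1) 1 l \<and> \<Psi> i = [:l, if i \<le> m then g i else 0:]"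
    "\<forall>F\<in>polysV {1..n + 1}. F \<noteq> 0 \<longrightarrow> mp_subst pconst \<Psi> F \<noteq> 0"
    "integral_over (subalg \<Psi> {1..n + 1}) [:0, 1:]" by blast
  hence \<Psi>: "\<And>i. i \<in> ?W \<Longrightarrow> \<exists>l. l \<in> polysV ?V \<and> wdeg_le (\<lambda>_. 1) 1 l \<and>
        \<Psi> i = [:l, if i \<le> m then g i else 0:]"
      "\<And>F. F \<in> polysV ?W \<Longrightarrow> F \<noteq> 0 \<Longrightarrow> mp_subst pconst \<Psi> F \<noteq> 0"
      "integral_over (subalg \<Psi> ?W) [:0, 1:]"
    by (simp_all only: Suc_eq_plus1) blast+
  from \<Psi>(1) obtain l where l: "\<And>i. i \<in> ?W \<Longrightarrow> l i \<in> polysV ?V \<and> wdeg_le (\<lambda>_. 1) 1 (l i) \<and>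
        \<Psi> i = [:l i, if i \<le> m then g i else 0:]" by metis
  \<comment> \<open>Weight 1 for the purely linear \<open>\<Psi> i\<close> with \<open>i > m\<close>
    leaves the product of all weights equal to that of the \<open>d i\<close>.\<close>
  define w where "w i = (if i \<in> {1..m} then d i else 1)" for i
  have w1: "\<forall>i\<in>?W. w i \<ge> 1" using d by (simp add: w_def)
  have lw: "wdeg_le (\<lambda>_. 1) (w i) (l i)" if "i \<in> ?W" for i
    using l[OF that] wdeg_le_mono w1 that by blast
  have "(\<Prod>i\<in>?W. w i) = (\<Prod>i\<in>{1..m}. w i)"
    using m by (intro prod.mono_neutral_right) (auto simp: w_def)
  also have "\<dots> = (\<Prod>i\<in>{1..m}. d i)" by (intro prod.cong) (auto simp: w_def)
  finally have D: "(\<Prod>i\<in>?W. w i) = (\<Prod>i\<in>{1..m}. d i)" .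
  obtain P where P: "coeffs_in (polysV ?W) P" "lead_coeff P = 1"
      "poly (map_poly (mp_subst pconst \<Psi>) P) [:0, 1:] = 0"
      "\<And>R. coeffs_in (polysV ?W) R \<Longrightarrow> poly (map_poly (mp_subst pconst \<Psi>) R) [:0, 1:] = 0 \<Longrightarrow> P dvd R"
    using minimal_relation[OF \<Psi>(2,3)] by blast
  have bidegree_le\<Psi>: "bidegree_le ?V (w i) 1 (\<Psi> i)" if i: "i \<in> ?W" for i
  proof -
    have "(if i \<le> m then g i else 0) \<in> polysV ?V \<and> wdeg_le (\<lambda>_. 1) (w i) (if i \<le> m then g i else 0)"
      using g i is_subringD(2)[OF is_subring_polysV[of ?V]] by (auto simp: w_def)
    moreover have "degree (\<Psi> i) \<le> 1" using l[OF i] by simp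
    ultimately show ?thesis
      using l[OF i] lw[OF i] is_subringD(2)[OF is_subring_polysV[of ?V]]
      by (auto simp: bidegree_le_def coeff_pCons split: nat.split)
  qed
  have P0: "P \<noteq> 0" using P(2) by auto
  have wP: "wdeg_le w (\<Prod>i\<in>?W. w i) (coeff P b)" for b
    by (rule weight_bound[OF w1 bidegree_le\<Psi> P(1) P0 P(4)])
  have "\<exists>h. (\<forall>i\<in>{1..m}. h i \<in> polysV ?V \<and> cofactor_le (\<Prod>i\<in>?W. w i) (w i) (h i)) \<and> (\<Sum>i\<in>{1..m}. g i * h i) = 1"
  proof (rule extract_combination[OF _ _ _ P(1,2) wP P(3)])
    fix i assume "i \<in> ?W"
    thus "l i \<in> polysV ?V \<and> wdeg_le (\<lambda>_. 1) (w i) (l i) \<and> \<Psi> i = [:l i, if i \<in> {1..m} then g i else 0:]"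
      using l lw by auto
  qed (use g in \<open>auto simp: w_def\<close>)
  thus ?thesis unfolding D by (auto simp: w_def)
qed

theorem theorem1p2:
  fixes n m r :: nat
    and f :: "nat \<Rightarrow> (nat, 'k::alg_closed_field) mpolynomial"
    and d :: "nat \<Rightarrow> nat"
  assumes "\<forall>i\<in>{1..m}. f i \<in> polys_upto n"
    and "\<forall>i\<in>{1..m}. total_degree (f i) = d i"
    and "\<forall>i\<in>{1..m}. \<forall>j\<in>{1..m}. i \<le> j \<longrightarrow> d j \<le> d i"
    and "\<not> (\<exists>a\<in>affine_points n. \<forall>i\<in>{1..m}. mp_eval a (f i) = 0)"
    and "trdeg (f ` {1..m}) = r"
  shows "\<exists>h :: nat \<Rightarrow> (nat, 'k) mpolynomial.
           (\<forall>i\<in>{1..m}. h i \<in> polys_upto n \<and>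
              total_degree (f i * h i) \<le> (\<Prod>j\<in>{j\<in>{1..r+1}. j \<le> m \<and> f j \<noteq> 0}. d j)) \<and>
           (\<Sum>i\<in>{1..m}. f i * h i) = 1"
proof (cases "\<exists>j\<in>{1..m}. f j \<noteq> 0 \<and> d j = 0")
  \<comment> \<open>A nonzero constant among the \<open>f i\<close> is a unit and settles the claim
    with cofactors of degree 0. Otherwise all nonzero \<open>f i\<close> have degree at least 1, as
    the weights require.\<close>
  case True
  then obtain j where j: "j \<in> {1..m}" "f j \<noteq> 0" "d j = 0" by blast
  have "wdeg_le (\<lambda>_. 1) 0 (f j)" using assms(2) j total_degree_le_iff[of "f j" 0] by simp
  hence "keys m' = {}" if "m' \<in> keys (f j)" for m'
    using that by (fastforce simp: wdeg_le_def wdeg_def in_keys_iff)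
  hence "f j \<in> polysV {}" by (simp add: polysV_def mp_vars_def)
  then obtain c where c: "f j = mp_const c" using polysV_empty by blast
  define h where "h i = (if i = j then mp_const (inverse c) else 0 :: (nat, 'k) mpolynomial)" for i
  have fh: "f i * h i = (if i = j then 1 else 0)" for i
    using c j(2) by (auto simp: h_def simp flip: mp_const_mult)
  have "total_degree (f i * h i) \<le> D" for i D
    by (simp add: fh total_degree_le_iff)
  moreover have "h i \<in> polys_upto n" for i by (auto simp: h_def polys_upto_def mp_vars_def[of 0])
  moreover have "(\<Sum>i\<in>{1..m}. f i * h i) = 1" using j(1) by (simp add: fh)
  ultimately show ?thesis by blast
next
  case False
  interpret kalg "mp_const :: 'k \<Rightarrow> 'k mp" by (rule kalg_const)
  let ?V = "{1..n}"
  have fV: "f i \<in> polysV ?V" if "i \<in> {1..m}" for i using assms(1) that by (simp add: polys_upto_polysV)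
  have fw: "wdeg_le (\<lambda>_. 1) (d i) (f i)" if "i \<in> {1..m}" for i
    using assms(2) that total_degree_le_iff[of "f i" "d i"] by simp
  have nz: "\<exists>i\<in>{1..m}. mp_eval a (f i) \<noteq> 0" for a
  proof -
    have "restrict a {1..n} \<in> affine_points n" by (simp add: affine_points_def)
    then obtain i where i: "i \<in> {1..m}" "mp_eval (restrict a {1..n}) (f i) \<noteq> 0" using assms(4) by blast
    have "mp_eval (restrict a {1..n}) (f i) = mp_eval a (f i)"
      using fV[OF i(1)] by (intro mp_eval_cong) (auto simp: polysV_def)
    thus ?thesis using i by auto
  qed
  define Z where "Z = {i\<in>{1..m}. f i \<noteq> 0}"
  have "Z \<noteq> {}"
  proof
    assume "Z = {}"
    hence "\<forall>i\<in>{1..m}. mp_eval undefined (f i) = 0"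
      by (auto simp: Z_def comm_ring_hom_zero[OF mp_eval_hom])
    thus False using nz by blast
  qed
  \<comment> \<open>As the degrees decrease and a nonzero \<open>f i\<close> has positive degree
    here, the nonzero polynomials are exactly those with index up to \<open>m1\<close>.\<close>
  define m1 where "m1 = Max Z"
  have fin: "finite Z" by (simp add: Z_def)
  have m1: "m1 \<in> Z" unfolding m1_def by (rule Max_in[OF fin \<open>Z \<noteq> {}\<close>])
  have m1m: "m1 \<le> m" "m1 \<ge> 1" using m1 by (auto simp: Z_def)
  have d1: "d i \<ge> 1" if "i \<in> {1..m1}" for i
  proof -
    have "d m1 \<ge> 1" using m1 False by (force simp: Z_def)
    moreover have "d m1 \<le> d i" using assms(3) that m1m by auto
    ultimately show ?thesis by simp
  qed
  have Zeq: "f i \<noteq> 0 \<longleftrightarrow> i \<le> m1" if "i \<in> {1..m}" for i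
  proof
    assume "f i \<noteq> 0"
    thus "i \<le> m1" unfolding m1_def using that by (intro Max_ge[OF fin]) (simp add: Z_def)
  next
    assume "i \<le> m1"
    hence "total_degree (f i) \<ge> 1" using d1[of i] that assms(2) by simp
    moreover have "total_degree (0 :: 'k mp) = 0" by (simp add: total_degree_def)
    ultimately show "f i \<noteq> 0" by force
  qed
  \<comment> \<open>The growth is bounded by \<open>r\<close> through the transcendence degree and
    by \<open>n\<close> through the ambient ring. The latter ensures at most n + 1 remaining
    generators, as the normalization demands.\<close>
  define s where "s = min r n"
  have "growth_le (f ` {1..m1}) s"
  proof (cases "r \<le> n")
    case True
    have "growth_le (f ` {1..m}) r" using trdeg_growth[of "f ` {1..m}"] assms(5) by simp
    hence "growth_le (f ` {1..m1}) r"
    proof (rule growth_span[rotated])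
      have "f ` {1..m1} \<subseteq> f ` {1..m}" using m1m by auto
      also have "\<dots> \<subseteq> vs.span (products (f ` {1..m}) (Suc 0))"
        using products_base[of _ "f ` {1..m}" 0] vs.span_base by blast
      finally show "f ` {1..m1} \<subseteq> vs.span (products (f ` {1..m}) (Suc 0))" .
    qed simp
    thus ?thesis using True by (simp add: s_def)
  next
    case False
    have grx: "growth_le (mvar ` ?V) n"
      using growth_exp_mono[OF growth_finite[of "mvar ` ?V"], of n] card_image_le[of ?V mvar] by simp
    define K where "K = Max ((\<lambda>i. total_degree (f i)) ` {1..m1})"
    have "f ` {1..m1} \<subseteq> vs.span (products (mvar ` ?V) K)"
    proof (rule image_subsetI)
      fix i assume i: "i \<in> {1..m1}"
      have "total_degree (f i) \<le> K" unfolding K_def using i by (intro Max_ge) auto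
      hence "wdeg_le (\<lambda>_. 1) K (f i)" by (rule wdeg_le_mono[OF wdeg_le_total_degree])
      moreover have "f i \<in> polysV ?V" using fV i m1m by auto
      ultimately show "f i \<in> vs.span (products (mvar ` ?V) K)"
        using subst_in_span[of "f i" ?V K mvar] by (simp add: subst_mvar_id)
    qed
    from growth_span[OF _ grx this] show ?thesis using False by (simp add: s_def)
  qed
  moreover have "\<forall>i\<in>{1..m1}. f i \<in> polysV ?V \<and> wdeg_le (\<lambda>_. 1) (d i) (f i)" using fV fw m1m by auto
  moreover have "\<forall>i\<in>{1..m1}. \<forall>j\<in>{1..m1}. i \<le> j \<longrightarrow> d j \<le> d i" using assms(3) m1m by auto
  moreover have "\<forall>a. \<exists>i\<in>{1..m1}. mp_eval a (f i) \<noteq> 0"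
  proof
    fix a
    obtain i where i: "i \<in> {1..m}" "mp_eval a (f i) \<noteq> 0" using nz by blast
    hence "f i \<noteq> 0" using comm_ring_hom_zero[OF mp_eval_hom, of a] by auto
    thus "\<exists>i\<in>{1..m1}. mp_eval a (f i) \<noteq> 0" using i Zeq[OF i(1)] by auto
  qed
  ultimately have "\<exists>m' g. m' \<le> m1 \<and> m' \<le> s + 1 \<and>
    (\<forall>i\<in>{1..m'}. g i \<in> polysV ?V \<and> wdeg_le (\<lambda>_. 1) (d i) (g i)) \<and>
    (\<forall>a. \<exists>i\<in>{1..m'}. mp_eval a (g i) \<noteq> 0) \<and>
    (\<forall>D h. (\<forall>i\<in>{1..m'}. h i \<in> polysV ?V \<and> cofactor_le D (d i) (h i)) \<longrightarrow>
      (\<exists>h'. (\<forall>i\<in>{1..m1}. h' i \<in> polysV ?V \<and> cofactor_le D (d i) (h' i)) \<and>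
        (\<Sum>i\<in>{1..m1}. f i * h' i) = (\<Sum>i\<in>{1..m'}. g i * h i)))"
    by (intro reduce_generators)
  then obtain m' g where m': "m' \<le> m1" "m' \<le> s + 1"
    and g: "\<forall>i\<in>{1..m'}. g i \<in> polysV ?V \<and> wdeg_le (\<lambda>_. 1) (d i) (g i)"
      "\<forall>a. \<exists>i\<in>{1..m'}. mp_eval a (g i) \<noteq> 0"
    and pull: "\<And>D h. (\<forall>i\<in>{1..m'}. h i \<in> polysV ?V \<and> cofactor_le D (d i) (h i)) \<Longrightarrow>
      (\<exists>h'. (\<forall>i\<in>{1..m1}. h' i \<in> polysV ?V \<and> cofactor_le D (d i) (h' i)) \<and>
        (\<Sum>i\<in>{1..m1}. f i * h' i) = (\<Sum>i\<in>{1..m'}. g i * h i))"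
    by blast
  have m'n: "m' \<le> n + 1" using m'(2) by (simp add: s_def)
  have dm': "\<forall>i\<in>{1..m'}. d i \<ge> 1" using d1 m'(1) by auto
  define D where "D = (\<Prod>i\<in>{1..m'}. d i)"
  from effective_nullstellensatz_few[OF m'n g(1) dm' g(2)] obtain h where
    h: "\<forall>i\<in>{1..m'}. h i \<in> polysV ?V \<and> cofactor_le D (d i) (h i)" "(\<Sum>i\<in>{1..m'}. g i * h i) = 1"
    by (auto simp: D_def)
  from pull[OF h(1)] obtain h' where h': "\<forall>i\<in>{1..m1}. h' i \<in> polysV ?V \<and> cofactor_le D (d i) (h' i)"
    "(\<Sum>i\<in>{1..m1}. f i * h' i) = 1" using h(2) by auto
  define k where "k i = (if i \<le> m1 then h' i else 0)" for i
  let ?J = "{j\<in>{1..r+1}. j \<le> m \<and> f j \<noteq> 0}"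
  have J: "{1..m'} \<subseteq> ?J"
  proof
    fix i assume i: "i \<in> {1..m'}"
    hence "i \<in> {1..m}" "i \<le> m1" "i \<le> r + 1" using m' m1m by (auto simp: s_def)
    thus "i \<in> ?J" using Zeq by auto
  qed
  have "D \<le> prod d ?J"
  proof -
    have "prod d ?J = prod d (?J - {1..m'}) * D"
      unfolding D_def by (rule prod.subset_diff[OF J]) simp
    moreover have "prod d (?J - {1..m'}) \<ge> 1"
      by (intro prod_ge_1 d1) (use Zeq in auto)
    ultimately show ?thesis by simp
  qed
  have "k i \<in> polys_upto n \<and> total_degree (f i * k i) \<le> prod d ?J" if i: "i \<in> {1..m}" for i
  proof (cases "i \<le> m1")
    case True
    hence h'i: "h' i \<in> polysV ?V" "cofactor_le D (d i) (h' i)" using h'(1) i by auto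
    have "wdeg_le (\<lambda>_. 1) D (f i * h' i)" by (rule cofactor_le_wdeg_le_mult[OF h'i(2) fw[OF i]])
    hence "total_degree (f i * h' i) \<le> prod d ?J"
      using \<open>D \<le> prod d ?J\<close> unfolding total_degree_le_iff by (rule wdeg_le_mono)
    thus ?thesis using True h'i(1) by (simp add: k_def polys_upto_polysV)
  next
    case False
    thus ?thesis by (simp add: k_def polys_upto_def mp_vars_def total_degree_def)
  qed
  moreover have "(\<Sum>i\<in>{1..m}. f i * k i) = (\<Sum>i\<in>{1..m1}. f i * h' i)"
  proof -
    have "(\<Sum>i\<in>{1..m}. f i * k i) = (\<Sum>i\<in>{1..m1}. f i * k i)"
      using m1m by (intro sum.mono_neutral_right) (auto simp: k_def)
    also have "\<dots> = (\<Sum>i\<in>{1..m1}. f i * h' i)" by (intro sum.cong) (auto simp: k_def)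
    finally show ?thesis .
  qed
  ultimately show ?thesis using h'(2) by (intro exI[of _ k]) auto
qed

end
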